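(* Let $\varepsilon\in[0,1)$, $(\eta,q,\beta)\in(0,1-\varepsilon)\times[1,\infty)\times(0,\infty)$, and let $(X_t)_{t\in[0,T]}\subseteq L_{\eta+\gamma}$ for some $\gamma>0$. Assume $$\rho\in\bigcup_{c>0}U(\varepsilon;c),\qquad X\in\bigcup_{c>0}\mathcal U(\beta,\mathrm{supp}(\rho);c),\qquad\text{and let}\quad \alpha:=\frac{1-(\varepsilon+\eta)}{\beta}.$$ Then there are constants $c_1,c_2>0$ such that $$\left(\int_0^T(T-t)^{\alpha q-1}\sup_{x\in\mathbb R}|D_\rho F(t,x)|^q\,dt\right)^{1/q}\le c_1\|f\|_{\mathrm{H\ddot ol}_{\eta,q}(\mathbb R)}\quad\text{for all } f\in\mathrm{H\ddot ol}_{\eta,q}(\mathbb R),$$ and $$\sup_{a\in[0,T)}(T-a)^\alpha\|\varphi_a(f,\rho)\|_{L_\infty}+\big\|\mathcal I^\alpha\varphi(f,\rho)-\varphi_0(f,\rho)\big\|_{\mathrm{BMO}_2([0,T))}\le c_2\|f\|_{\mathrm{H\ddot ol}_{\eta,2}(\mathbb R)}\quad\text{for all } f\in\mathrm{H\ddot ol}_{\eta,2}(\mathbb R).$$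
   Context: $T\in(0,\infty)$; $X=(X_t)_{t\in[0,T]}$ is a real Lévy process ($X_0\equiv0$, stationary independent increments, càdlàg paths) without Brownian part and with Lévy measure $\nu$ satisfying $\nu(\mathbb R)\in(0,\infty]$, on a complete probability space $(\Omega,\mathcal F,\mathbb P)$; $(\mathcal F_t)_{t\in[0,T]}$ is its augmented natural filtration, $\mathcal F=\mathcal F_T$. $\rho$ is a probability measure on $(\mathbb R,\mathcal B(\mathbb R))$ with $\rho(\{0\})=0$; $\mathrm{supp}(\rho)$ is its (closed) support. $\rho\in U(\varepsilon;c)$ means $\rho([-d,d])\le c\,d^\varepsilon$ for all $d\in[0,1]$ (with $0^0:=1$). For $A\subseteq\mathbb R$ closed and non-empty, $X\in\mathcal U(\beta,A;c)$ means $\|\mathbb P_{z+X_s}-\mathbb P_{X_s}\|_{\mathrm{TV}}\le c|z|s^{-1/\beta}$ for all $z\in A$, $s\in(0,T]$; here $\mathbb P_{\xi}$ is the law of $\xi$ and $\|\mu\|_{\mathrm{TV}}=|\mu|(\mathbb R)$ is the total variation of a signed measure. For a Borel function $f$ with $\mathbb E|f(x+X_s)|<\infty$ for all $(s,x)\in[0,T]\times\mathbb R$ let $F(t,x):=\mathbb E f(x+X_{T-t})$ and $D_\rho F(t,x):=\int_{\mathbb R\setminus\{0\}}\frac{F(t,x+z)-F(t,x)}{z}\,\rho(dz)$ for $(t,x)\in[0,T)\times\mathbb R$. Under the hypotheses of the theorem these integrals converge absolutely and $(D_\rho F(t,X_t))_{t\in[0,T)}$ is a martingale; $\varphi(f,\rho)=(\varphi_t(f,\rho))_{t\in[0,T)}$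 denotes a càdlàg version of it. H\"older spaces: $C_b^0(\mathbb R)$: bounded continuous functions vanishing at $0$ with sup-norm; $\mathrm{H\ddot ol}_1^0(\mathbb R)$: Lipschitz functions vanishing at $0$, normed by the Lipschitz constant; $K(v,f):=\inf\{\|f_0\|_{C_b^0}+v\|f_1\|_{\mathrm{H\ddot ol}_1^0}:f=f_0+f_1\}$, $v>0$. For $(\eta,q)\in(0,1)\times[1,\infty]$, $\mathrm{H\ddot ol}_{\eta,q}(\mathbb R)=(C_b^0(\mathbb R),\mathrm{H\ddot ol}_1^0(\mathbb R))_{\eta,q}$ consists of $f\in C_b^0+\mathrm{H\ddot ol}_1^0$ with $\|f\|_{\mathrm{H\ddot ol}_{\eta,q}}:=\|v\mapsto v^{-\eta}K(v,f)\|_{L_q((0,\infty),dv/v)}<\infty$. For càdlàg $K:[0,T)\to\mathbb R$ (path-wise for processes) and $\alpha>0$: $\mathcal I_t^\alpha K:=\frac{\alpha}{T^\alpha}\int_0^T(T-u)^{\alpha-1}K_{u\wedge t}\,du$, $\mathcal I^\alpha K:=(\mathcal I_t^\alpha K)_{t\in[0,T)}$. For adapted càdlàg $Y=(Y_t)_{t\in[0,T)}$ with $Y_0\equiv0$, $\|Y\|_{\mathrm{BMO}_2([0,T))}$ is the infimum of all $c\ge0$ with $\mathbb E^{\mathcal F_\sigma}[|Y_t-Y_{\sigma-}|^2]\le c^2$ a.s. for all $t\in[0,T)$ and stopping times $\sigma:\Omega\to[0,t]$ ($Y_{0-}:=Y_0$). *)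

theory Defs
  imports "HOL-Probability.Probability"
begin

section \<open>Path regularity, filtrations and Levy processes\<close>

text \<open>
  At the endpoints of \<open>I\<close> one of the two filters is \<open>bot\<close>, so the corresponding one-sided
  requirement is void there.
\<close>
definition cadlag_on :: "real set \<Rightarrow> (real \<Rightarrow> real) \<Rightarrow> bool" where
  "cadlag_on I k \<longleftrightarrow> (\<forall>t\<in>I.
     (k \<longlongrightarrow> k t) (at t within (I \<inter> {t<..})) \<and>
     (\<exists>l. (k \<longlongrightarrow> l) (at t within (I \<inter> {..<t}))))"

definition cadlag_version ::
    "'a measure \<Rightarrow> real \<Rightarrow> (real \<Rightarrow> 'a \<Rightarrow> real) \<Rightarrow> (real \<Rightarrow> 'a \<Rightarrow> real) \<Rightarrow> bool" where
  "cadlag_version M T Y \<phi> \<longleftrightarrow>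
     (\<forall>\<omega>\<in>space M. cadlag_on {0..<T} (\<lambda>t. \<phi> t \<omega>)) \<and>
     (\<forall>t\<in>{0..<T}. AE \<omega> in M. \<phi> t \<omega> = Y t \<omega>)"

text \<open>
  The natural filtration of \<open>(X\<^sub>t)\<close>, \<open>t \<in> [0,T]\<close>, augmented by the null sets of \<open>M\<close>. The index set is
  extended to all reals (constant after \<open>T\<close>) to fit the library's \<^const>\<open>stopping_time\<close>; for
  \<open>[0,T]\<close>-valued times this makes no difference.
\<close>
definition augmented_filtration ::
    "'a measure \<Rightarrow> real \<Rightarrow> (real \<Rightarrow> 'a \<Rightarrow> real) \<Rightarrow> real \<Rightarrow> 'a measure" where
  "augmented_filtration M T X t =
     sigma (space M) ({X s -` B \<inter> space M | s B. s \<in> {0..min t T} \<and> B \<in> sets borel} \<union> null_sets M)"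

lemma filtration_augmented_filtration:
  "filtration (space M) (augmented_filtration M T X)"
proof
  have sub: "{X s -` B \<inter> space M | s B. s \<in> {0..min t T} \<and> B \<in> sets borel} \<union> null_sets M
      \<subseteq> Pow (space M)" for t
    by (auto dest: null_setsD2 sets.sets_into_space)
  show "space (augmented_filtration M T X t) = space M" for t
    unfolding augmented_filtration_def by (rule space_measure_of[OF sub])
  fix s t :: real assume "s \<le> t"
  then show "sets (augmented_filtration M T X s) \<subseteq> sets (augmented_filtration M T X t)"
    unfolding augmented_filtration_def sets_measure_of[OF sub]
    by (intro sigma_sets_mono') fastforce
qed

definition levy_process :: "'a measure \<Rightarrow> real \<Rightarrow> (real \<Rightarrow> 'a \<Rightarrow> real) \<Rightarrow> bool" where
  "levy_process M T X \<longleftrightarrow>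
     (\<forall>t\<in>{0..T}. X t \<in> borel_measurable M) \<and>
     (\<forall>\<omega>\<in>space M. X 0 \<omega> = 0) \<and>
     (\<forall>s t. 0 \<le> s \<and> s \<le> t \<and> t \<le> T \<longrightarrow>
        distr M borel (\<lambda>\<omega>. X t \<omega> - X s \<omega>) = distr M borel (X (t - s))) \<and>
     (\<forall>n (\<tau> :: nat \<Rightarrow> real). \<tau> ` {..n} \<subseteq> {0..T} \<and> mono_on {..n} \<tau> \<longrightarrow>
        prob_space.indep_vars M (\<lambda>_. borel) (\<lambda>i \<omega>. X (\<tau> (Suc i)) \<omega> - X (\<tau> i) \<omega>) {..<n}) \<and>
     (\<forall>\<omega>\<in>space M. cadlag_on {0..T} (\<lambda>t. X t \<omega>))"

definition levy_measure :: "real measure \<Rightarrow> bool" where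
  "levy_measure \<nu> \<longleftrightarrow> sets \<nu> = sets borel \<and> emeasure \<nu> {0} = 0 \<and>
     (\<integral>\<^sup>+ x. ennreal (min 1 (x\<^sup>2)) \<partial>\<nu>) < \<infinity>"

text \<open>
  Characteristic triplet (drift \<open>b\<close>, Gaussian variance \<open>v\<close>, Levy measure \<open>\<nu>\<close>), through the
  Levy--Khintchine formula with truncation function \<open>x \<cdot> 1\<close> on \<open>{|x| \<le> 1}\<close>. The process has no
  Brownian part iff \<open>v = 0\<close>.
\<close>
definition has_levy_triplet ::
    "'a measure \<Rightarrow> real \<Rightarrow> (real \<Rightarrow> 'a \<Rightarrow> real) \<Rightarrow> real \<Rightarrow> real \<Rightarrow> real measure \<Rightarrow> bool" where
  "has_levy_triplet M T X b v \<nu> \<longleftrightarrow> levy_measure \<nu> \<and> 0 \<le> v \<and>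
     (\<forall>t\<in>{0..T}. \<forall>u. char (distr M borel (X t)) u =
        exp (complex_of_real t *
          (\<i> * complex_of_real (u * b) - complex_of_real (v * u\<^sup>2 / 2) +
           (CLINT x|\<nu>. iexp (u * x) - 1 - \<i> * complex_of_real (u * x * indicator {-1..1} x)))))"


section \<open>The conditions on \<open>\<rho>\<close> and \<open>X\<close>\<close>

definition measure_support :: "real measure \<Rightarrow> real set" where
  "measure_support \<rho> = {x. \<forall>V. open V \<and> x \<in> V \<longrightarrow> 0 < emeasure \<rho> V}"

text \<open>The case distinction implements \<open>0\<^sup>0 = 1\<close>, whereas \<open>0 powr 0 = 0\<close> in the library.\<close>
definition U_small_ball :: "real \<Rightarrow> real \<Rightarrow> real measure set" where
  "U_small_ball \<epsilon> c =
     {\<rho>. \<forall>d\<in>{0..1}. measure \<rho> {-d..d} \<le> c * (if d = 0 \<and> \<epsilon> = 0 then 1 else d powr \<epsilon>)}"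

text \<open>
  Total variation \<open>|P - Q|(\<Omega>)\<close> of the signed measure \<open>P - Q\<close>, for finite measures on the same
  \<open>\<sigma>\<close>-algebra (so there is no factor \<open>1/2\<close>).
\<close>
definition tv_norm_diff :: "'a measure \<Rightarrow> 'a measure \<Rightarrow> ennreal" where
  "tv_norm_diff P Q =
     (SUP \<A> \<in> {\<A>. finite \<A> \<and> \<A> \<subseteq> sets P \<and> disjoint \<A> \<and> \<Union>\<A> = space P}.
        \<Sum>A\<in>\<A>. ennreal \<bar>measure P A - measure Q A\<bar>)"

definition U_tv ::
    "'a measure \<Rightarrow> real \<Rightarrow> real \<Rightarrow> real set \<Rightarrow> real \<Rightarrow> (real \<Rightarrow> 'a \<Rightarrow> real) set" where
  "U_tv M T \<beta> A c =
     {X. \<forall>z\<in>A. \<forall>s\<in>{0<..T}.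
        tv_norm_diff (distr M borel (\<lambda>\<omega>. z + X s \<omega>)) (distr M borel (X s))
          \<le> ennreal (c * \<bar>z\<bar> * s powr (- 1 / \<beta>))}"


section \<open>Hoelder spaces by real interpolation\<close>

definition enn_powr :: "ennreal \<Rightarrow> real \<Rightarrow> ennreal" where
  "enn_powr x p = (if x = \<infinity> then \<infinity> else ennreal (enn2real x powr p))"

definition Cb0 :: "(real \<Rightarrow> real) set" where
  "Cb0 = {f. f \<in> bcontfun \<and> f 0 = 0}"

definition Cb0_norm :: "(real \<Rightarrow> real) \<Rightarrow> real" where
  "Cb0_norm f = (SUP x. \<bar>f x\<bar>)"

definition Lip0 :: "(real \<Rightarrow> real) set" where
  "Lip0 = {f. (\<exists>L. L-lipschitz_on UNIV f) \<and> f 0 = 0}"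

definition Lip0_norm :: "(real \<Rightarrow> real) \<Rightarrow> real" where
  "Lip0_norm f = Inf {L. L-lipschitz_on UNIV f}"

text \<open>Taken in \<^typ>\<open>ennreal\<close>, so that it is \<open>\<infinity>\<close> if \<open>f\<close> has no such decomposition.\<close>
definition K_functional :: "real \<Rightarrow> (real \<Rightarrow> real) \<Rightarrow> ennreal" where
  "K_functional v f =
     (INF (f0, f1) \<in> {(f0, f1). f0 \<in> Cb0 \<and> f1 \<in> Lip0 \<and> f = (\<lambda>x. f0 x + f1 x)}.
        ennreal (Cb0_norm f0 + v * Lip0_norm f1))"

text \<open>Only for finite \<open>q\<close>.\<close>
definition holder_norm :: "real \<Rightarrow> real \<Rightarrow> (real \<Rightarrow> real) \<Rightarrow> ennreal" where
  "holder_norm \<eta> q f =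
     enn_powr
       (\<integral>\<^sup>+ v\<in>{0<..}. (enn_powr (ennreal (v powr (- \<eta>)) * K_functional v f) q * ennreal (1 / v)) \<partial>lborel)
       (1 / q)"

definition holder_space :: "real \<Rightarrow> real \<Rightarrow> (real \<Rightarrow> real) set" where
  "holder_space \<eta> q =
     {f. (\<exists>f0\<in>Cb0. \<exists>f1\<in>Lip0. f = (\<lambda>x. f0 x + f1 x)) \<and> holder_norm \<eta> q f < \<infinity>}"


section \<open>The operator \<open>D\<^sub>\<rho>\<close>, Riemann--Liouville operators and BMO\<close>

definition F_sem :: "'a measure \<Rightarrow> real \<Rightarrow> (real \<Rightarrow> 'a \<Rightarrow> real) \<Rightarrow> (real \<Rightarrow> real) \<Rightarrow> real \<Rightarrow> real \<Rightarrow> real"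
  where "F_sem M T X f t x = (LINT \<omega>|M. f (x + X (T - t) \<omega>))"

definition D_rho ::
    "'a measure \<Rightarrow> real \<Rightarrow> (real \<Rightarrow> 'a \<Rightarrow> real) \<Rightarrow> real measure \<Rightarrow> (real \<Rightarrow> real) \<Rightarrow> real \<Rightarrow> real \<Rightarrow> real" where
  "D_rho M T X \<rho> f t x =
     (LINT z:-{0}|\<rho>. (F_sem M T X f t (x + z) - F_sem M T X f t x) / z)"

definition riemann_liouville :: "real \<Rightarrow> real \<Rightarrow> (real \<Rightarrow> real) \<Rightarrow> real \<Rightarrow> real" where
  "riemann_liouville T \<alpha> k t =
     \<alpha> / T powr \<alpha> * (LINT u:{0..T}|lborel. (T - u) powr (\<alpha> - 1) * k (min u t))"

definition left_lim :: "(real \<Rightarrow> real) \<Rightarrow> real \<Rightarrow> real" where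
  "left_lim k s = (if s = 0 then k 0 else Lim (at_left s) k)"

text \<open>
  \<open>\<FF>\<close> is the filtration; its \<open>\<sigma>\<close>-algebra at a stopping time is the library's \<open>pre_sigma\<close>.
  The infimum over the empty set is \<open>\<infinity>\<close>.
\<close>
definition bmo2_norm ::
    "'a measure \<Rightarrow> (real \<Rightarrow> 'a measure) \<Rightarrow> real \<Rightarrow> (real \<Rightarrow> 'a \<Rightarrow> real) \<Rightarrow> ennreal" where
  "bmo2_norm M \<FF> T Y =
     (INF c \<in> {c::real. 0 \<le> c \<and>
         (\<forall>t\<in>{0..<T}. \<forall>\<sigma>. stopping_time \<FF> \<sigma> \<and> (\<forall>\<omega>\<in>space M. \<sigma> \<omega> \<in> {0..t}) \<longrightarrow>
            (AE \<omega> in M.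
               nn_cond_exp M (filtration.pre_sigma (space M) \<FF> \<sigma>)
                 (\<lambda>\<omega>. ennreal (\<bar>Y t \<omega> - left_lim (\<lambda>s. Y s \<omega>) (\<sigma> \<omega>)\<bar>\<^sup>2)) \<omega>
               \<le> ennreal (c\<^sup>2)))}.
        ennreal c)"

end

theory Submission
  imports Defs
begin

text \<open>
  Put \<open>r = (T - t) powr (1 / \<beta>)\<close>. For a decomposition \<open>f = f\<^sub>0 + f\<^sub>1\<close> the increment \<open>F(t,x+z) - F(t,x)\<close> is at
  most \<open>min 2 (c \<bar>z\<bar> / r)\<close> times the sup-norm of \<open>f\<^sub>0\<close> plus \<open>\<bar>z\<bar>\<close> times the Lipschitz constant of \<open>f\<^sub>1\<close>, so
  after optimising, the difference quotient is bounded by the K-functional at scale \<open>r\<close> if \<open>\<bar>z\<bar> \<le> r\<close>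
  and at scale \<open>\<bar>z\<bar>\<close> otherwise. Cutting \<open>\<bar>z\<bar> > r\<close> into dyadic shells and using the small ball condition
  bounds \<open>D F(t,\<cdot>)\<close> uniformly by the sum over \<open>k\<close> of \<open>(2\<^sup>k r) powr (\<epsilon> - 1) * K(2\<^sup>k r, f)\<close>; since
  \<open>\<epsilon> + \<eta> < 1\<close>, Hardy's inequality gives the first estimate and the weighted sup bound on \<open>\<phi>\<close>.

  For the BMO estimate no stochastic integral is needed. Up to the constant \<open>T powr (-\<alpha>)\<close> and a term
  controlled by the sup bound, the increment of the Riemann--Liouville transform over \<open>[\<sigma>,t]\<close> is
  \<open>\<alpha>\<close> times the integral of \<open>w \<phi>\<close> over \<open>[\<sigma>,t]\<close> with \<open>w u = (T - u) powr (\<alpha> - 1)\<close>. In its conditional second moment the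
  martingale property replaces \<open>\<phi>\<^sub>u \<phi>\<^sub>v\<close>, \<open>u \<le> v\<close>, by \<open>\<phi>\<^sub>u\<close> squared, and integrating \<open>w v\<close> over \<open>[u,t]\<close> leaves
  the first estimate for \<open>q = 2\<close>.
\<close>

section \<open>The K-functional\<close>

text \<open>The pointwise bound on difference quotients is arranged to depend on z only, not on x.
  One majorant therefore serves three purposes: the supremum over x costs nothing, the
  \<rho>-integral becomes a series of ball masses, and Fubini applies when D is convolved with the
  law of an increment, which is how the martingale identity is obtained. All majorants live in
  \<open>ennreal\<close>, so finiteness matters only where Bochner integrals are exchanged. The
  obstacle in the BMO estimate is the random lower limit \<sigma>. For A in the \<sigma>-algebra at
  \<sigma> and a fixed time u, the event that A occurs and \<sigma> \<le> u belongs to the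
  \<sigma>-algebra at u. Hence mixed moments at deterministic times suffice, and optional stopping
  does not enter. A second obstacle is that the version \<phi> is tied to D only almost surely at
  each single time: completeness of the measure, right continuity and one exceptional null set make
  it jointly measurable and controlled along whole paths.\<close>

lemma Cb0_abs_le_norm: "g \<in> Cb0 \<Longrightarrow> \<bar>g x\<bar> \<le> Cb0_norm g"
proof -
  assume "g \<in> Cb0"
  then have "bounded (range g)" by (simp add: Cb0_def bcontfun_def)
  then obtain B where "\<And>x. \<bar>g x\<bar> \<le> B" by (auto simp: bounded_iff)
  then show ?thesis unfolding Cb0_norm_def by (intro cSUP_upper) (auto intro!: bdd_aboveI2)
qed

lemma Cb0_norm_nonneg: "g \<in> Cb0 \<Longrightarrow> 0 \<le> Cb0_norm g"
  using Cb0_abs_le_norm[of g 0] by linarith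

lemma Lip0_lipschitz: "g \<in> Lip0 \<Longrightarrow> \<bar>g x - g y\<bar> \<le> Lip0_norm g * \<bar>x - y\<bar>"
proof (cases "x = y")
  case False
  assume "g \<in> Lip0"
  then obtain L where L: "L-lipschitz_on UNIV g" by (auto simp: Lip0_def)
  have "\<bar>g x - g y\<bar> / \<bar>x - y\<bar> \<le> Lip0_norm g"
    unfolding Lip0_norm_def using L False
    by (intro cInf_greatest)
      (auto simp: divide_le_eq dest: lipschitz_onD[where x=x and y=y] simp: dist_real_def)
  then show ?thesis using False by (simp add: divide_le_eq)
qed simp

lemma Lip0_norm_nonneg: "g \<in> Lip0 \<Longrightarrow> 0 \<le> Lip0_norm g"
  using Lip0_lipschitz[of g 1 0] by simp

text \<open>Its being nonempty is the form in which membership of f in the sum space is passed on,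
  for instance in \<open>admissible\<close>.\<close>

definition decomp :: "(real \<Rightarrow> real) \<Rightarrow> ((real \<Rightarrow> real) \<times> (real \<Rightarrow> real)) set" where
  "decomp f = {(f0, f1). f0 \<in> Cb0 \<and> f1 \<in> Lip0 \<and> f = (\<lambda>x. f0 x + f1 x)}"

lemma K_functional_decomp:
  "K_functional v f = (INF p \<in> decomp f. ennreal (Cb0_norm (fst p) + v * Lip0_norm (snd p)))"
  unfolding K_functional_def decomp_def by (auto intro!: INF_cong)

lemma K_functional_greatest:
  assumes "\<And>f0 f1. (f0, f1) \<in> decomp f \<Longrightarrow> a \<le> ennreal (Cb0_norm f0 + v * Lip0_norm f1)"
  shows "a \<le> K_functional v f"
  unfolding K_functional_decomp using assms by (intro INF_greatest) auto

lemma K_functional_mono: "v \<le> w \<Longrightarrow> K_functional v f \<le> K_functional w f"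
  unfolding K_functional_decomp
  by (intro INF_superset_mono ennreal_leI add_left_mono mult_right_mono Lip0_norm_nonneg)
     (auto simp: decomp_def)

text \<open>Sublevel sets of a monotone function are intervals. This is needed because the
  K-functional is an infimum over an uncountable family, so its measurability in the scale comes
  from monotonicity.\<close>

lemma borel_measurable_mono_ennreal:
  fixes g :: "real \<Rightarrow> ennreal"
  assumes "mono g" shows "g \<in> borel_measurable borel"
proof (rule borel_measurableI_less)
  fix y
  have "is_interval {x. g x < y}"
    unfolding is_interval_1 by (auto intro: le_less_trans dest: monoD[OF assms])
  then have "{x. g x < y} \<in> sets borel"
    by (rule real_interval_borel_measurable)
  then show "{x \<in> space borel. g x < y} \<in> sets borel" by simp
qed

lemma K_functional_measurable [measurable]: "(\<lambda>v. K_functional v f) \<in> borel_measurable borel"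
  by (intro borel_measurable_mono_ennreal monoI K_functional_mono)

lemma holder_space_decomp:
  "f \<in> holder_space \<eta> q \<Longrightarrow> decomp f \<noteq> {}"
  unfolding holder_space_def decomp_def by auto

text \<open>Both parts of a decomposition vanish at 0, so the Lipschitz part is at most |x| times
  its constant. This is the source of the growth bound that turns the moment assumption into
  integrability of f along the process.\<close>

lemma abs_le_K_functional: "ennreal \<bar>f x\<bar> \<le> K_functional \<bar>x\<bar> f"
proof (rule K_functional_greatest)
  fix f0 f1 assume d: "(f0, f1) \<in> decomp f"
  have "\<bar>f1 x\<bar> \<le> Lip0_norm f1 * \<bar>x\<bar>"
    using Lip0_lipschitz[of f1 x 0] d by (simp add: decomp_def Lip0_def)
  moreover have "\<bar>f0 x\<bar> \<le> Cb0_norm f0"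
    using d by (intro Cb0_abs_le_norm) (simp add: decomp_def)
  ultimately show "ennreal \<bar>f x\<bar> \<le> ennreal (Cb0_norm f0 + \<bar>x\<bar> * Lip0_norm f1)"
    using d by (intro ennreal_leI) (auto simp: decomp_def mult.commute)
qed

lemma decomp_continuous: "(f0, f1) \<in> decomp f \<Longrightarrow> continuous_on UNIV f0 \<and> continuous_on UNIV f1"
  unfolding decomp_def Cb0_def Lip0_def bcontfun_def
  by (auto intro: lipschitz_on_continuous_on)

lemma decomp_measurable:
  assumes "decomp f \<noteq> {}" shows "f \<in> borel_measurable borel"
proof -
  obtain f0 f1 where d: "(f0, f1) \<in> decomp f" using assms by auto
  have "f = (\<lambda>x. f0 x + f1 x)" using d by (simp add: decomp_def)
  moreover have "continuous_on UNIV (\<lambda>x. f0 x + f1 x)"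
    using decomp_continuous[OF d] by (intro continuous_intros) auto
  ultimately show ?thesis by (simp add: borel_measurable_continuous_onI)
qed

section \<open>Real powers of extended nonnegative numbers\<close>

lemma enn_powr_ennreal: "0 \<le> x \<Longrightarrow> enn_powr (ennreal x) p = ennreal (x powr p)"
  by (simp add: enn_powr_def)

lemma enn_powr_top [simp]: "enn_powr \<top> p = \<top>"
  by (simp add: enn_powr_def)

lemma enn_powr_mono: "x \<le> y \<Longrightarrow> 0 \<le> p \<Longrightarrow> enn_powr x p \<le> enn_powr y p"
  unfolding enn_powr_def
  by (auto simp: top_unique intro!: ennreal_leI powr_mono2 enn2real_mono simp: less_top)

lemma enn_powr_mult: "0 \<le> c \<Longrightarrow> 0 < c \<or> x \<noteq> \<top> \<Longrightarrow> enn_powr (ennreal c * x) p = ennreal (c powr p) * enn_powr x p"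
  by (cases x) (auto simp: enn_powr_def ennreal_mult_top ennreal_mult'[symmetric] powr_mult
      ennreal_mult_eq_top_iff)

text \<open>The variable \<open>s\<close> is kept separate so that an exponent q * (1 / q) can be
  instantiated to 1. The value \<top> is covered because \<open>enn_powr\<close> fixes it for every
  exponent.\<close>

lemma enn_powr_powr: "p * r = s \<Longrightarrow> enn_powr (enn_powr x p) r = enn_powr x s"
  by (auto simp: enn_powr_def powr_powr)

lemma enn_powr_1 [simp]: "enn_powr x 1 = x"
  by (cases x) (auto simp: enn_powr_def)

lemma enn_powr_2: "enn_powr x 2 = x\<^sup>2"
  by (cases x) (auto simp: enn_powr_def ennreal_power powr_numeral power2_eq_square ennreal_mult)

lemma enn_powr_measurable [measurable]:
  assumes [measurable]: "g \<in> borel_measurable N"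
  shows "(\<lambda>x. enn_powr (g x) p) \<in> borel_measurable N"
  unfolding enn_powr_def by measurable

section \<open>Dyadic sums of the K-functional and a Hardy inequality\<close>

lemma nn_integral_incseq_sets:
  assumes [measurable]: "g \<in> borel_measurable N" and A: "incseq A" "range A \<subseteq> sets N"
  shows "(\<integral>\<^sup>+x\<in>(\<Union>i. A i). g x \<partial>N) = (SUP i. \<integral>\<^sup>+x\<in>A i. g x \<partial>N)"
proof -
  have "(SUP i. emeasure (density N g) (A i)) = emeasure (density N g) (\<Union>i. A i)"
    using A by (intro SUP_emeasure_incseq) auto
  moreover have "A i \<in> sets N" "(\<Union>i. A i) \<in> sets N" for i using A by auto
  ultimately show ?thesis by (simp add: emeasure_density)
qed

text \<open>The measure dv / v is Lebesgue measure in the variable ln v, which turns dilations into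
  translations. The change of variables is made on compact intervals and passes to the limit by
  monotone convergence.\<close>

lemma nn_integral_exp_substitution:
  assumes [measurable]: "g \<in> borel_measurable borel"
  shows "(\<integral>\<^sup>+v\<in>{0<..}. (g v * ennreal (1 / v)) \<partial>lborel) = (\<integral>\<^sup>+y. g (exp y) \<partial>lborel)"
proof -
  define A where "A n = {exp (- real n)..exp (real n)}" for n
  define B where "B n = {- real n..real n}" for n
  have "incseq A" unfolding A_def by (intro monoI) auto
  have "incseq B" unfolding B_def by (intro monoI) auto
  have sets: "range A \<subseteq> sets borel" "range B \<subseteq> sets borel" by (auto simp: A_def B_def)
  have UB: "(\<Union>n. B n) = UNIV"
  proof -
    have "x \<in> (\<Union>n. B n)" for x :: real
    proof -
      obtain n :: nat where "\<bar>x\<bar> \<le> real n" using real_arch_simple by blast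
      then have "x \<in> B n" by (simp add: B_def abs_le_iff)
      then show ?thesis by blast
    qed
    then show ?thesis by auto
  qed
  have UA: "(\<Union>n. A n) = {0<..}"
  proof safe
    fix x n assume "x \<in> A n" then show "0 < x"
      by (auto simp: A_def intro: less_le_trans[OF exp_gt_zero])
  next
    fix x :: real assume "0 < x"
    have "ln x \<in> (\<Union>n. B n)" unfolding UB by simp
    then obtain n where "- real n \<le> ln x" "ln x \<le> real n" by (auto simp: B_def)
    then have "exp (- real n) \<le> x" "x \<le> exp (real n)"
      using \<open>0 < x\<close> by (metis exp_le_cancel_iff exp_ln)+
    then show "x \<in> (\<Union>n. A n)" by (auto simp: A_def)
  qed
  have AB: "(\<integral>\<^sup>+v\<in>A n. (g v * ennreal (1 / v)) \<partial>lborel) = (\<integral>\<^sup>+y\<in>B n. g (exp y) \<partial>lborel)" for n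
  proof (cases "n = 0")
    \<comment> \<open>The substitution rule asks for a nondegenerate interval; for n = 0 both sides
      are integrals over one point.\<close>
    case True
    have "(\<integral>\<^sup>+v\<in>{1}. (g v * ennreal (1 / v)) \<partial>lborel) = 0"
      by (intro nn_integral_null_set) (simp add: null_sets_def)
    moreover have "(\<integral>\<^sup>+y\<in>{0}. g (exp y) \<partial>lborel) = 0"
      by (intro nn_integral_null_set) (simp add: null_sets_def)
    ultimately show ?thesis using True by (simp add: A_def B_def)
  next
    case False
    have "(\<integral>\<^sup>+v\<in>A n. (g v * ennreal (1 / v)) \<partial>lborel)
        = (\<integral>\<^sup>+x. (g (exp x) * ennreal (1 / exp x)) * ennreal (exp x) * indicator (B n) x \<partial>lborel)"
      unfolding A_def B_def using False
      by (intro nn_integral_substitution_aux) (auto intro!: derivative_eq_intros continuous_intros)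
    also have "\<dots> = (\<integral>\<^sup>+y\<in>B n. g (exp y) \<partial>lborel)"
      by (intro nn_integral_cong) (simp add: mult.assoc ennreal_mult[symmetric])
    finally show ?thesis .
  qed
  have "(\<integral>\<^sup>+v\<in>{0<..}. (g v * ennreal (1 / v)) \<partial>lborel) = (SUP n. \<integral>\<^sup>+v\<in>A n. (g v * ennreal (1 / v)) \<partial>lborel)"
    unfolding UA[symmetric] using \<open>incseq A\<close> sets by (intro nn_integral_incseq_sets) auto
  also have "\<dots> = (SUP n. \<integral>\<^sup>+y\<in>B n. g (exp y) \<partial>lborel)" by (simp only: AB)
  also have "\<dots> = (\<integral>\<^sup>+y\<in>(\<Union>n. B n). g (exp y) \<partial>lborel)"
    using \<open>incseq B\<close> sets by (intro nn_integral_incseq_sets[symmetric]) auto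
  finally show ?thesis by (simp add: UB)
qed

text \<open>A substitute for Minkowski's inequality that works for every q > 0. One of the two
  geometric factors is summed; what remains of each term is at most the q-th root of the full series
  on the right, because a single term never exceeds the sum.\<close>

lemma enn_powr_suminf_le:
  assumes r: "0 < r" "r < 1" and q: "0 < q"
  shows "enn_powr (\<Sum>k. ennreal (r ^ k) * (ennreal (r ^ k) * a k)) q
      \<le> ennreal ((1 / (1 - r)) powr q) * (\<Sum>k. ennreal ((r powr q) ^ k) * enn_powr (a k) q)"
proof -
  define s where "s = (\<Sum>k. ennreal ((r powr q) ^ k) * enn_powr (a k) q)"
  have le: "ennreal (r ^ k) * a k \<le> enn_powr s (1 / q)" for k
  proof -
    have "enn_powr (ennreal (r ^ k) * a k) q = ennreal ((r powr q) ^ k) * enn_powr (a k) q"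
      using r by (subst enn_powr_mult)
        (auto simp: powr_powr powr_realpow[symmetric] mult.commute)
    also have "\<dots> \<le> s" unfolding s_def
      using sum_le_suminf[of "\<lambda>k. ennreal ((r powr q) ^ k) * enn_powr (a k) q" "{k}"] by simp
    finally have "enn_powr (enn_powr (ennreal (r ^ k) * a k) q) (1 / q) \<le> enn_powr s (1 / q)"
      using q by (intro enn_powr_mono) auto
    then show ?thesis using q by (simp add: enn_powr_powr[where s=1])
  qed
  have geo: "(\<Sum>k. ennreal (r ^ k)) = ennreal (1 / (1 - r))"
    using r by (intro suminf_ennreal_eq) (auto simp: geometric_sums)
  have "(\<Sum>k. ennreal (r ^ k) * (ennreal (r ^ k) * a k)) \<le> (\<Sum>k. ennreal (r ^ k) * enn_powr s (1 / q))"
    by (intro suminf_le mult_left_mono le) auto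
  also have "\<dots> = ennreal (1 / (1 - r)) * enn_powr s (1 / q)"
    by (simp add: geo)
  finally have "enn_powr (\<Sum>k. ennreal (r ^ k) * (ennreal (r ^ k) * a k)) q
      \<le> enn_powr (ennreal (1 / (1 - r)) * enn_powr s (1 / q)) q"
    using q by (intro enn_powr_mono) auto
  also have "\<dots> = ennreal ((1 / (1 - r)) powr q) * s"
    using r q by (subst enn_powr_mult) (auto simp: enn_powr_powr[where s=1])
  finally show ?thesis unfolding s_def .
qed

definition weighted_K :: "real \<Rightarrow> (real \<Rightarrow> real) \<Rightarrow> real \<Rightarrow> ennreal" where
  "weighted_K \<eta> f v = ennreal (v powr (- \<eta>)) * K_functional v f"

text \<open>A dyadic form of the Hardy integral of v powr (\<epsilon> - 1) * K(v, f) against dv / v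
  over v > r. The radii are unbounded because the support of \<rho> may be.\<close>

definition dyadic_K :: "real \<Rightarrow> (real \<Rightarrow> real) \<Rightarrow> real \<Rightarrow> ennreal" where
  "dyadic_K \<epsilon> f r = (\<Sum>k. ennreal ((2 ^ k * r) powr (\<epsilon> - 1)) * K_functional (2 ^ k * r) f)"

lemma weighted_K_measurable [measurable]: "weighted_K \<eta> f \<in> borel_measurable borel"
  unfolding weighted_K_def by measurable

lemma dyadic_K_measurable [measurable]: "dyadic_K \<epsilon> f \<in> borel_measurable borel"
  unfolding dyadic_K_def by measurable

lemma holder_norm_exp:
  "holder_norm \<eta> q f = enn_powr (\<integral>\<^sup>+y. enn_powr (weighted_K \<eta> f (exp y)) q \<partial>lborel) (1 / q)"
  unfolding holder_norm_def weighted_K_def[symmetric]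
  by (subst nn_integral_exp_substitution) auto

lemma holder_norm_powr:
  assumes "0 < q"
  shows "enn_powr (holder_norm \<eta> q f) q = (\<integral>\<^sup>+y. enn_powr (weighted_K \<eta> f (exp y)) q \<partial>lborel)"
  using assms by (simp add: holder_norm_exp enn_powr_powr[where s=1])

text \<open>The embedding into the interpolation space with index \<infinity>. On the window from v
  to e * v the K-functional does not decrease and the weight loses at most the factor exp (-
  \<eta>); the window has length 1 in the logarithmic variable, so no further constant
  appears.\<close>

lemma weighted_K_le_holder_norm:
  assumes q: "0 < q" and "0 \<le> \<eta>" "0 < v"
  shows "weighted_K \<eta> f v \<le> ennreal (exp \<eta>) * holder_norm \<eta> q f"
proof -
  define y0 where "y0 = ln v"
  have v: "v = exp y0" using assms by (simp add: y0_def)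
  have "enn_powr (ennreal (exp (- \<eta>)) * weighted_K \<eta> f v) q
      = (\<integral>\<^sup>+y\<in>{y0..y0+1}. enn_powr (ennreal (exp (- \<eta>)) * weighted_K \<eta> f v) q \<partial>lborel)"
    by (simp add: nn_integral_cmult)
  also have "\<dots> \<le> (\<integral>\<^sup>+y. enn_powr (weighted_K \<eta> f (exp y)) q \<partial>lborel)"
  proof (intro nn_integral_mono)
    fix y :: real
    show "enn_powr (ennreal (exp (- \<eta>)) * weighted_K \<eta> f v) q * indicator {y0..y0+1} y
        \<le> enn_powr (weighted_K \<eta> f (exp y)) q"
    proof (cases "y \<in> {y0..y0+1}")
      case True
      have "ennreal (exp (- \<eta>)) * weighted_K \<eta> f v
          = ennreal (exp (- \<eta> - \<eta> * y0)) * K_functional (exp y0) f"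
        unfolding weighted_K_def v
        by (simp add: mult.assoc[symmetric] ennreal_mult[symmetric] powr_def exp_add[symmetric])
      also have "\<dots> \<le> ennreal (exp (- \<eta> * y)) * K_functional (exp y) f"
        using True \<open>0 \<le> \<eta>\<close> mult_left_mono[of y "y0+1" \<eta>]
        by (intro mult_mono ennreal_leI K_functional_mono) (auto simp: algebra_simps)
      also have "\<dots> = weighted_K \<eta> f (exp y)"
        by (simp add: weighted_K_def powr_def)
      finally show ?thesis using True q by (simp add: enn_powr_mono)
    qed simp
  qed
  also have "\<dots> = enn_powr (holder_norm \<eta> q f) q"
    using q by (simp add: holder_norm_powr)
  finally have "enn_powr (enn_powr (ennreal (exp (- \<eta>)) * weighted_K \<eta> f v) q) (1 / q)
      \<le> enn_powr (enn_powr (holder_norm \<eta> q f) q) (1 / q)"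
    by (rule enn_powr_mono) (use q in simp)
  then have "ennreal (exp (- \<eta>)) * weighted_K \<eta> f v \<le> holder_norm \<eta> q f"
    using q by (simp add: enn_powr_powr[where s=1])
  then have "ennreal (exp \<eta>) * (ennreal (exp (- \<eta>)) * weighted_K \<eta> f v) \<le> ennreal (exp \<eta>) * holder_norm \<eta> q f"
    by (intro mult_left_mono) auto
  then show ?thesis
    by (simp add: mult.assoc[symmetric] ennreal_mult[symmetric] exp_add[symmetric])
qed

text \<open>Since \<theta> + (\<epsilon> - 1) = - \<eta>, multiplying by r powr \<theta> leaves the
  Hoelder weight at the scale 2 ^ k * r and a geometric factor. Its ratio is below 1 exactly when
  \<epsilon> + \<eta> < 1.\<close>

lemma dyadic_K_eq_weighted:
  assumes r: "0 < r" and th: "\<theta> = 1 - (\<epsilon> + \<eta>)"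
  shows "ennreal (r powr \<theta>) * dyadic_K \<epsilon> f r
      = (\<Sum>k. ennreal ((2 powr (- \<theta>)) ^ k) * weighted_K \<eta> f (2 ^ k * r))"
  unfolding dyadic_K_def ennreal_suminf_cmult[symmetric]
proof (intro suminf_cong)
  fix k :: nat
  have "r powr \<theta> * (2 ^ k * r) powr (\<epsilon> - 1) = (2 powr (- \<theta>)) ^ k * (2 ^ k * r) powr (- \<eta>)"
  proof -
    have "r powr \<theta> = (2 powr (- \<theta>)) ^ k * (2 ^ k * r) powr \<theta>"
      using r by (simp add: powr_mult powr_realpow[symmetric] powr_powr powr_add[symmetric] mult.commute
          mult.left_commute flip: mult.assoc)
    then have "r powr \<theta> * (2 ^ k * r) powr (\<epsilon> - 1)
        = (2 powr (- \<theta>)) ^ k * ((2 ^ k * r) powr \<theta> * (2 ^ k * r) powr (\<epsilon> - 1))" by simp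
    also have "(2 ^ k * r) powr \<theta> * (2 ^ k * r) powr (\<epsilon> - 1) = (2 ^ k * r) powr (- \<eta>)"
      by (simp add: powr_add[symmetric] th)
    finally show ?thesis .
  qed
  then show "ennreal (r powr \<theta>) * (ennreal ((2 ^ k * r) powr (\<epsilon> - 1)) * K_functional (2 ^ k * r) f)
      = ennreal ((2 powr (- \<theta>)) ^ k) * weighted_K \<eta> f (2 ^ k * r)"
    unfolding weighted_K_def by (simp add: mult.assoc[symmetric] ennreal_mult[symmetric])
qed

lemma dyadic_K_le_holder_norm:
  assumes q: "0 < q" and "0 \<le> \<eta>" and r: "0 < r" and th: "\<theta> = 1 - (\<epsilon> + \<eta>)" "0 < \<theta>"
  shows "ennreal (r powr \<theta>) * dyadic_K \<epsilon> f r
      \<le> ennreal (exp \<eta> / (1 - 2 powr (- \<theta>))) * holder_norm \<eta> q f"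
proof -
  define p where "p = 2 powr (- \<theta>)"
  have p: "0 < p" "p < 1" using th by (auto simp: p_def powr_less_one)
  have geo: "(\<Sum>k. ennreal (p ^ k)) = ennreal (1 / (1 - p))"
    using p by (intro suminf_ennreal_eq) (auto simp: geometric_sums)
  have "ennreal (r powr \<theta>) * dyadic_K \<epsilon> f r = (\<Sum>k. ennreal (p ^ k) * weighted_K \<eta> f (2 ^ k * r))"
    unfolding p_def by (rule dyadic_K_eq_weighted) fact+
  also have "\<dots> \<le> (\<Sum>k. ennreal (p ^ k) * (ennreal (exp \<eta>) * holder_norm \<eta> q f))"
    using assms by (intro suminf_le mult_left_mono weighted_K_le_holder_norm) auto
  also have "\<dots> = ennreal (exp \<eta> / (1 - p)) * holder_norm \<eta> q f"
    by (simp only: ennreal_suminf_multc geo)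
      (use p in \<open>simp add: mult.assoc[symmetric] ennreal_mult[symmetric]\<close>)
  finally show ?thesis unfolding p_def .
qed

text \<open>Dilation by 2 ^ k is translation by k * ln 2 in the variable y, so every term of the
  series has the same integral and only geometric weights remain to be summed.\<close>

lemma dyadic_K_hardy:
  assumes q: "0 < q" and th: "\<theta> = 1 - (\<epsilon> + \<eta>)" "0 < \<theta>"
  shows "\<exists>C\<ge>0. \<forall>f. (\<integral>\<^sup>+y. enn_powr (ennreal (exp y powr \<theta>) * dyadic_K \<epsilon> f (exp y)) q \<partial>lborel)
      \<le> ennreal C * enn_powr (holder_norm \<eta> q f) q"
proof -
  \<comment> \<open>Half of the exponent: the weight 2 powr (- \<theta>) splits into the two equal
    factors that \<open>enn_powr_suminf_le\<close> expects.\<close>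
  define r where "r = 2 powr (- (\<theta> / 2))"
  have r: "0 < r" "r < 1" using th by (auto simp: r_def powr_less_one)
  have rr: "(2 powr (- \<theta>)) ^ k = r ^ k * r ^ k" for k
    unfolding r_def by (simp add: power_mult_distrib[symmetric] powr_add[symmetric])
  have rq: "0 < r powr q" "r powr q < 1" using r q by (auto simp: powr01_less_one)
  define C where "C = (1 / (1 - r)) powr q * (1 / (1 - r powr q))"
  have geo: "(\<Sum>k. ennreal ((r powr q) ^ k)) = ennreal (1 / (1 - r powr q))"
    using rq by (intro suminf_ennreal_eq) (auto simp: geometric_sums)
  have "(\<integral>\<^sup>+y. enn_powr (ennreal (exp y powr \<theta>) * dyadic_K \<epsilon> f (exp y)) q \<partial>lborel)
      \<le> ennreal C * enn_powr (holder_norm \<eta> q f) q" for f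
  proof -
    have shift: "(\<integral>\<^sup>+y. enn_powr (weighted_K \<eta> f (2 ^ k * exp y)) q \<partial>lborel) = enn_powr (holder_norm \<eta> q f) q" for k
    proof -
      have "enn_powr (holder_norm \<eta> q f) q
          = ennreal \<bar>1\<bar> * (\<integral>\<^sup>+y. enn_powr (weighted_K \<eta> f (exp (k * ln 2 + 1 * y))) q \<partial>lborel)"
        unfolding holder_norm_powr[OF q] by (rule nn_integral_real_affine) auto
      then show ?thesis by (simp add: exp_add exp_of_nat_mult)
    qed
    have "(\<integral>\<^sup>+y. enn_powr (ennreal (exp y powr \<theta>) * dyadic_K \<epsilon> f (exp y)) q \<partial>lborel)
       \<le> (\<integral>\<^sup>+y. ennreal ((1 / (1 - r)) powr q)
            * (\<Sum>k. ennreal ((r powr q) ^ k) * enn_powr (weighted_K \<eta> f (2 ^ k * exp y)) q) \<partial>lborel)"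
    proof (intro nn_integral_mono)
      fix y :: real
      have "ennreal (exp y powr \<theta>) * dyadic_K \<epsilon> f (exp y)
          = (\<Sum>k. ennreal (r ^ k) * (ennreal (r ^ k) * weighted_K \<eta> f (2 ^ k * exp y)))"
        using r by (subst dyadic_K_eq_weighted[OF _ th(1)])
          (auto simp: rr ennreal_mult mult.assoc)
      then show "enn_powr (ennreal (exp y powr \<theta>) * dyadic_K \<epsilon> f (exp y)) q
        \<le> ennreal ((1 / (1 - r)) powr q)
            * (\<Sum>k. ennreal ((r powr q) ^ k) * enn_powr (weighted_K \<eta> f (2 ^ k * exp y)) q)"
        using enn_powr_suminf_le[OF r q] by simp
    qed
    also have "\<dots> = ennreal ((1 / (1 - r)) powr q) *
        (\<Sum>k. ennreal ((r powr q) ^ k) * enn_powr (holder_norm \<eta> q f) q)"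
      by (simp add: nn_integral_cmult nn_integral_suminf shift)
    also have "\<dots> = ennreal C * enn_powr (holder_norm \<eta> q f) q"
      using rq by (simp only: ennreal_suminf_multc geo C_def)
        (simp add: ennreal_mult' mult.assoc[symmetric] ennreal_mult[symmetric])
    finally show ?thesis .
  qed
  moreover have "0 \<le> C" using rq by (simp add: C_def)
  ultimately show ?thesis by blast
qed

text \<open>Put \<theta> = 1 - (\<epsilon> + \<eta>) and s = T - t = exp (\<beta> * x). Then the
  radius s powr (1 / \<beta>) is exp x, and s powr \<alpha> is exp (\<theta> * x) because \<alpha> *
  \<beta> = \<theta>. The weight with exponent \<alpha> * q - 1 is the q-th power of s powr \<alpha>
  against ds / s, and \<beta> is the Jacobian.\<close>

lemma dyadic_K_time_integral:
  assumes q: "0 < q" and th: "1 - (\<epsilon> + \<eta>) > 0" and \<beta>: "0 < \<beta>" and \<alpha>: "\<alpha> = (1 - (\<epsilon> + \<eta>)) / \<beta>"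
  shows "\<exists>C\<ge>0. \<forall>f. (\<integral>\<^sup>+t\<in>{0..<T}. (ennreal ((T - t) powr (\<alpha> * q - 1)) *
        enn_powr (dyadic_K \<epsilon> f ((T - t) powr (1 / \<beta>))) q) \<partial>lborel)
      \<le> ennreal C * enn_powr (holder_norm \<eta> q f) q"
proof -
  define \<theta> where "\<theta> = 1 - (\<epsilon> + \<eta>)"
  obtain C where C: "0 \<le> C" "\<And>f. (\<integral>\<^sup>+y. enn_powr (ennreal (exp y powr \<theta>) * dyadic_K \<epsilon> f (exp y)) q \<partial>lborel)
      \<le> ennreal C * enn_powr (holder_norm \<eta> q f) q"
    using dyadic_K_hardy[OF q \<theta>_def] th by (auto simp: \<theta>_def)
  have "(\<integral>\<^sup>+t\<in>{0..<T}. (ennreal ((T - t) powr (\<alpha> * q - 1)) *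
        enn_powr (dyadic_K \<epsilon> f ((T - t) powr (1 / \<beta>))) q) \<partial>lborel)
      \<le> ennreal (\<beta> * C) * enn_powr (holder_norm \<eta> q f) q" for f
  proof -
    define G where "G s = ennreal (s powr (\<alpha> * q)) * enn_powr (dyadic_K \<epsilon> f (s powr (1 / \<beta>))) q" for s
    have [measurable]: "G \<in> borel_measurable borel" unfolding G_def by measurable
    have "(\<integral>\<^sup>+t\<in>{0..<T}. (ennreal ((T - t) powr (\<alpha> * q - 1)) *
        enn_powr (dyadic_K \<epsilon> f ((T - t) powr (1 / \<beta>))) q) \<partial>lborel)
      = ennreal \<bar>-1\<bar> * (\<integral>\<^sup>+s. ennreal ((T - (T + (-1) * s)) powr (\<alpha> * q - 1)) *
        enn_powr (dyadic_K \<epsilon> f ((T - (T + (-1) * s)) powr (1 / \<beta>))) q * indicator {0..<T} (T + (-1) * s) \<partial>lborel)"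
      by (rule nn_integral_real_affine) (auto intro!: borel_measurable_times_ennreal)
    \<comment> \<open>The values s > T are added here, so that the substitution can use the whole
      half-line.\<close>
    also have "\<dots> \<le> (\<integral>\<^sup>+s\<in>{0<..}. (G s * ennreal (1 / s)) \<partial>lborel)"
    proof -
      have "ennreal (s powr (\<alpha> * q - 1)) * u = ennreal (s powr (\<alpha> * q)) * u * ennreal (1 / s)"
        if "0 < s" for s u
        using that by (simp add: powr_diff divide_inverse ennreal_mult ac_simps)
      then show ?thesis
        by (auto intro!: nn_integral_mono simp: G_def split: split_indicator)
    qed
    also have "\<dots> = (\<integral>\<^sup>+y. G (exp y) \<partial>lborel)"
      by (rule nn_integral_exp_substitution) measurable
    also have "\<dots> = ennreal \<bar>\<beta>\<bar> * (\<integral>\<^sup>+x. G (exp (0 + \<beta> * x)) \<partial>lborel)"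
      using \<beta> by (intro nn_integral_real_affine) auto
    also have "(\<lambda>x. G (exp (0 + \<beta> * x))) = (\<lambda>x. enn_powr (ennreal (exp x powr \<theta>) * dyadic_K \<epsilon> f (exp x)) q)"
    proof
      fix x
      have "\<alpha> * \<beta> = \<theta>" using \<beta> \<alpha> by (simp add: \<theta>_def)
      then have 1: "exp (\<beta> * x) powr (\<alpha> * q) = (exp x powr \<theta>) powr q"
        by (simp add: powr_def)
      have 2: "exp (\<beta> * x) powr (1 / \<beta>) = exp x" using \<beta> by (simp add: powr_def)
      show "G (exp (0 + \<beta> * x)) = enn_powr (ennreal (exp x powr \<theta>) * dyadic_K \<epsilon> f (exp x)) q"
        unfolding G_def by (simp add: enn_powr_mult 1 2)
    qed
    also have "ennreal \<bar>\<beta>\<bar> * (\<integral>\<^sup>+x. enn_powr (ennreal (exp x powr \<theta>) * dyadic_K \<epsilon> f (exp x)) q \<partial>lborel)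
        \<le> ennreal \<bar>\<beta>\<bar> * (ennreal C * enn_powr (holder_norm \<eta> q f) q)"
      by (intro mult_left_mono C) auto
    finally show ?thesis using \<beta> C by (simp add: ennreal_mult mult.assoc)
  qed
  then show ?thesis using \<beta> C(1) by (intro exI[of _ "\<beta> * C"]) auto
qed

section \<open>Difference quotients under a total variation bound\<close>

text \<open>The total variation is a supremum over finite partitions, so g is rounded down to
  multiples of \<delta>; its level cells form a finite partition because g is bounded. Rounding
  costs \<delta> for each measure and rounded values have modulus at most B + \<delta>; then
  \<delta> tends to 0.\<close>

lemma tv_norm_diff_integral_le:
  fixes g :: "real \<Rightarrow> real"
  assumes P: "prob_space P" "sets P = sets borel" and Q: "prob_space Q" "sets Q = sets borel"
    and g [measurable]: "g \<in> borel_measurable borel" and B: "\<And>x. \<bar>g x\<bar> \<le> B"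
    and tv: "tv_norm_diff P Q \<le> ennreal \<tau>" "0 \<le> \<tau>"
  shows "\<bar>(\<integral>x. g x \<partial>P) - (\<integral>x. g x \<partial>Q)\<bar> \<le> B * \<tau>"
proof -
  have spP: "space P = UNIV" and spQ: "space Q = UNIV"
    using sets_eq_imp_space_eq[OF P(2)] sets_eq_imp_space_eq[OF Q(2)] by simp_all
  note [measurable_cong] = P(2) Q(2)
  have main: "\<bar>(\<integral>x. g x \<partial>P) - (\<integral>x. g x \<partial>Q)\<bar> \<le> 2 * \<delta> + (B + \<delta>) * \<tau>" if \<delta>: "0 < \<delta>" for \<delta>
  proof -
    define A where "A k = {x. \<lfloor>g x / \<delta>\<rfloor> = k}" for k
    define I where "I = {\<lfloor>- B / \<delta>\<rfloor>..\<lfloor>B / \<delta>\<rfloor>}"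
    define s where "s x = \<delta> * \<lfloor>g x / \<delta>\<rfloor>" for x
    have A_sets [measurable]: "A k \<in> sets borel" for k unfolding A_def by measurable
    have in_I: "\<lfloor>g x / \<delta>\<rfloor> \<in> I" for x
    proof -
      have "- B \<le> g x" "g x \<le> B" using B[of x] by linarith+
      then have "- B / \<delta> \<le> g x / \<delta>" "g x / \<delta> \<le> B / \<delta>"
        using \<delta> by (intro divide_right_mono; simp)+
      then show ?thesis unfolding I_def by (simp add: floor_mono)
    qed
    have s_le: "s x \<le> g x" and s_ge: "g x - \<delta> \<le> s x" for x
    proof -
      have eq: "\<delta> * (g x / \<delta>) = g x" using \<delta> by simp
      have "s x \<le> \<delta> * (g x / \<delta>)"
        unfolding s_def using \<delta> by (intro mult_left_mono of_int_floor_le) simp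
      then show "s x \<le> g x" unfolding eq .
      have "\<delta> * (g x / \<delta> - 1) \<le> s x"
        unfolding s_def using \<delta> by (intro mult_left_mono) linarith+
      then show "g x - \<delta> \<le> s x" unfolding right_diff_distrib eq by simp
    qed
    have s_sum: "s x = (\<Sum>k\<in>I. \<delta> * k * indicator (A k) x)" for x
    proof -
      have "(\<Sum>k\<in>I. \<delta> * k * indicator (A k) x) = (\<Sum>k\<in>I. if k = \<lfloor>g x / \<delta>\<rfloor> then \<delta> * k else 0)"
        by (intro sum.cong) (auto simp: A_def)
      also have "\<dots> = s x" using in_I[of x] by (simp add: s_def I_def)
      finally show ?thesis by simp
    qed
    have approx: "\<bar>(\<integral>x. g x \<partial>R) - (\<Sum>k\<in>I. \<delta> * k * measure R (A k))\<bar> \<le> \<delta>"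
      if "prob_space R" "sets R = sets borel" for R
    proof -
      interpret R: prob_space R by fact
      note [measurable_cong] = \<open>sets R = sets borel\<close>
      have spR: "space R = UNIV" using sets_eq_imp_space_eq[OF \<open>sets R = sets borel\<close>] by simp
      have int_g: "integrable R g" using B by (intro R.integrable_const_bound[where B=B]) auto
      have ind: "integrable R (\<lambda>x. \<delta> * real_of_int k * indicator (A k) x)" for k
        by (intro integrable_mult_right integrable_real_indicator) (auto simp: R.emeasure_eq_measure)
      then have int_s: "integrable R s" unfolding s_sum by (intro Bochner_Integration.integrable_sum)
      have eq: "(\<integral>x. s x \<partial>R) = (\<Sum>k\<in>I. \<delta> * k * measure R (A k))"
        unfolding s_sum using ind by (subst Bochner_Integration.integral_sum) (auto simp: spR)
      have "(\<integral>x. s x \<partial>R) \<le> (\<integral>x. g x \<partial>R)"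
        using int_g int_s s_le by (intro integral_mono) auto
      moreover have "(\<integral>x. g x \<partial>R) \<le> (\<integral>x. s x + \<delta> \<partial>R)"
        using int_g int_s s_ge by (intro integral_mono) (auto simp: algebra_simps)
      moreover have "(\<integral>x. s x + \<delta> \<partial>R) = (\<integral>x. s x \<partial>R) + \<delta>"
        using int_s by (simp add: R.prob_space)
      ultimately show ?thesis unfolding eq[symmetric] by linarith
    qed
    have k_bound: "\<bar>\<delta> * real_of_int \<lfloor>g x / \<delta>\<rfloor>\<bar> \<le> B + \<delta>" for x
      using s_le[of x] s_ge[of x] B[of x] \<delta> unfolding s_def by linarith
    have part: "A ` I \<in> {\<A>. finite \<A> \<and> \<A> \<subseteq> sets P \<and> disjoint \<A> \<and> \<Union>\<A> = space P}"
      using in_I by (auto simp: P(2) spP disjoint_def A_def[abs_def] I_def)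
    have "ennreal (\<Sum>k\<in>I. \<bar>measure P (A k) - measure Q (A k)\<bar>) = (\<Sum>A\<in>A ` I. ennreal \<bar>measure P A - measure Q A\<bar>)"
    \<comment> \<open>Levels in \<open>I\<close> that g does not attain give empty cells, so
      \<open>A\<close> need not be injective on \<open>I\<close>. Cells that coincide for different
      levels are empty and contribute 0.\<close>
    proof (subst sum.reindex_nontrivial)
      fix i j assume "i \<in> I" "j \<in> I" "i \<noteq> j" "A i = A j"
      then have "A i = {}" unfolding A_def by blast
      then show "ennreal \<bar>measure P (A i) - measure Q (A i)\<bar> = 0" by simp
    qed (auto simp: I_def)
    also have "\<dots> \<le> tv_norm_diff P Q" unfolding tv_norm_diff_def by (intro SUP_upper part)
    also note tv(1)
    finally have tv': "(\<Sum>k\<in>I. \<bar>measure P (A k) - measure Q (A k)\<bar>) \<le> \<tau>"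
      using tv(2) by simp
    have "\<bar>(\<Sum>k\<in>I. \<delta> * k * measure P (A k)) - (\<Sum>k\<in>I. \<delta> * k * measure Q (A k))\<bar>
        = \<bar>\<Sum>k\<in>I. \<delta> * k * (measure P (A k) - measure Q (A k))\<bar>"
      by (simp add: sum_subtractf algebra_simps)
    also have "\<dots> \<le> (\<Sum>k\<in>I. \<bar>\<delta> * k * (measure P (A k) - measure Q (A k))\<bar>)"
      by (rule sum_abs)
    also have "\<dots> \<le> (\<Sum>k\<in>I. (B + \<delta>) * \<bar>measure P (A k) - measure Q (A k)\<bar>)"
    proof (intro sum_mono)
      fix k assume "k \<in> I"
      show "\<bar>\<delta> * k * (measure P (A k) - measure Q (A k))\<bar> \<le> (B + \<delta>) * \<bar>measure P (A k) - measure Q (A k)\<bar>"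
      proof (cases "A k = {}")
        case False
        then obtain x where "\<lfloor>g x / \<delta>\<rfloor> = k" unfolding A_def by blast
        then show ?thesis using k_bound[of x] unfolding abs_mult[of "\<delta> * k"]
          by (intro mult_right_mono) auto
      qed simp
    qed
    also have "\<dots> = (B + \<delta>) * (\<Sum>k\<in>I. \<bar>measure P (A k) - measure Q (A k)\<bar>)"
      by (simp add: sum_distrib_left)
    also have "\<dots> \<le> (B + \<delta>) * \<tau>"
      using tv' B[of 0] \<delta> by (intro mult_left_mono) auto
    finally show ?thesis using approx[OF P] approx[OF Q] by linarith
  qed
  have "\<bar>(\<integral>x. g x \<partial>P) - (\<integral>x. g x \<partial>Q)\<bar> \<le> B * \<tau> + e" if "0 < e" for e
  proof -
    \<comment> \<open>With \<delta> = e / (2 + \<tau>) the total error 2 * \<delta> + \<delta> *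
      \<tau> equals e.\<close>
    have "\<bar>(\<integral>x. g x \<partial>P) - (\<integral>x. g x \<partial>Q)\<bar> \<le> 2 * (e / (2 + \<tau>)) + (B + e / (2 + \<tau>)) * \<tau>"
      using that tv(2) by (intro main) auto
    also have "\<dots> = B * \<tau> + (e / (2 + \<tau>)) * (2 + \<tau>)"
      by (simp only: algebra_simps)
    also have "\<dots> = B * \<tau> + e" using tv(2) by simp
    finally show ?thesis .
  qed
  then show ?thesis by (rule field_le_epsilon)
qed

text \<open>A point outside the support lies in a null open set, hence in a null member of a
  countable base, and there are only countably many of those.\<close>

lemma AE_measure_support:
  assumes "sets \<rho> = sets borel"
  shows "AE z in \<rho>. z \<in> measure_support \<rho>"
proof -
  obtain \<B> :: "real set set" where \<B>: "countable \<B>" "topological_basis \<B>"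
    using ex_countable_basis by blast
  define N where "N = {b \<in> \<B>. emeasure \<rho> b = 0}"
  have "AE z in \<rho>. z \<notin> b" if "b \<in> N" for b
    using that topological_basis_open[OF \<B>(2)] assms by (intro AE_not_in) (auto simp: N_def null_sets_def)
  then have "AE z in \<rho>. \<forall>b\<in>N. z \<notin> b"
    using \<B>(1) by (subst AE_ball_countable) (auto simp: N_def)
  then show ?thesis
  proof eventually_elim
    case (elim z)
    show ?case unfolding measure_support_def
    proof (safe)
      fix V assume "open V" "z \<in> V"
      then obtain b where b: "b \<in> \<B>" "z \<in> b" "b \<subseteq> V" using topological_basisE[OF \<B>(2)] by metis
      then have "emeasure \<rho> b \<noteq> 0" using elim by (auto simp: N_def)
      moreover have "emeasure \<rho> b \<le> emeasure \<rho> V"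
        using b \<open>open V\<close> assms by (intro emeasure_mono) auto
      ultimately show "0 < emeasure \<rho> V" by (auto simp: zero_less_iff_neq_zero)
    qed
  qed
qed

text \<open>Integrability is assumed of f; that of f1 follows because f0 is bounded. Shifting the
  argument of f0 by z amounts to integrating against the translated law, which is where the total
  variation enters.\<close>

lemma translated_mean_diff_le:
  assumes \<mu>: "prob_space \<mu>" "sets \<mu> = sets borel"
    and tv: "tv_norm_diff (distr \<mu> borel (\<lambda>y. z + y)) \<mu> \<le> ennreal \<tau>" "0 \<le> \<tau>"
    and d: "(f0, f1) \<in> decomp f"
    and int: "\<And>x. integrable \<mu> (\<lambda>y. f (x + y))"
  shows "\<bar>(\<integral>y. f (x + z + y) \<partial>\<mu>) - (\<integral>y. f (x + y) \<partial>\<mu>)\<bar>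
      \<le> min 2 \<tau> * Cb0_norm f0 + \<bar>z\<bar> * Lip0_norm f1"
proof -
  interpret prob_space \<mu> by fact
  note [measurable_cong] = \<mu>(2)
  have f: "f y = f0 y + f1 y" and f0: "f0 \<in> Cb0" and f1: "f1 \<in> Lip0" for y
    using d by (auto simp: decomp_def)
  have [measurable]: "f0 \<in> borel_measurable borel" "f1 \<in> borel_measurable borel"
    using decomp_continuous[OF d] by (auto intro: borel_measurable_continuous_onI)
  note bnd = Cb0_abs_le_norm[OF f0]
  have i0: "integrable \<mu> (\<lambda>y. f0 (x + y))" for x
    using bnd by (intro integrable_const_bound[where B="Cb0_norm f0"]) auto
  have i1: "integrable \<mu> (\<lambda>y. f1 (x + y))" for x
  proof -
    have "integrable \<mu> (\<lambda>y. f (x + y) - f0 (x + y))" by (intro Bochner_Integration.integrable_diff int i0)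
    then show ?thesis by (simp add: f)
  qed
  have eq: "(\<integral>y. f (x + y) \<partial>\<mu>) = (\<integral>y. f0 (x + y) \<partial>\<mu>) + (\<integral>y. f1 (x + y) \<partial>\<mu>)" for x
    unfolding f by (intro Bochner_Integration.integral_add i0 i1)
  have le0: "\<bar>(\<integral>y. f0 (x + y) \<partial>\<mu>)\<bar> \<le> Cb0_norm f0" for x
  proof -
    have "\<bar>(\<integral>y. f0 (x + y) \<partial>\<mu>)\<bar> \<le> (\<integral>y. \<bar>f0 (x + y)\<bar> \<partial>\<mu>)" by (rule integral_abs_bound)
    also have "\<dots> \<le> (\<integral>y. Cb0_norm f0 \<partial>\<mu>)"
      using bnd i0 by (intro integral_mono) auto
    finally show ?thesis by (simp add: prob_space)
  qed
  have "\<bar>(\<integral>y. f0 (x + z + y) \<partial>\<mu>) - (\<integral>y. f0 (x + y) \<partial>\<mu>)\<bar> \<le> 2 * Cb0_norm f0"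
    using le0[of "x + z"] le0[of x] by linarith
  moreover have "\<bar>(\<integral>y. f0 (x + z + y) \<partial>\<mu>) - (\<integral>y. f0 (x + y) \<partial>\<mu>)\<bar> \<le> \<tau> * Cb0_norm f0"
  proof -
    have "(\<integral>y. f0 (x + z + y) \<partial>\<mu>) = (\<integral>y. f0 (x + y) \<partial>distr \<mu> borel (\<lambda>y. z + y))"
      by (subst integral_distr) (auto simp: add.assoc)
    then show ?thesis
      using tv_norm_diff_integral_le[of "distr \<mu> borel (\<lambda>y. z + y)" \<mu> "\<lambda>y. f0 (x + y)" "Cb0_norm f0" \<tau>]
        \<mu> tv bnd by (simp add: prob_space_distr mult.commute)
  qed
  ultimately have 0: "\<bar>(\<integral>y. f0 (x + z + y) \<partial>\<mu>) - (\<integral>y. f0 (x + y) \<partial>\<mu>)\<bar> \<le> min 2 \<tau> * Cb0_norm f0"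
    by (simp add: min_def)
  have "\<bar>(\<integral>y. f1 (x + z + y) \<partial>\<mu>) - (\<integral>y. f1 (x + y) \<partial>\<mu>)\<bar> = \<bar>\<integral>y. f1 (x + z + y) - f1 (x + y) \<partial>\<mu>\<bar>"
    by (simp add: i1)
  also have "\<dots> \<le> (\<integral>y. \<bar>f1 (x + z + y) - f1 (x + y)\<bar> \<partial>\<mu>)" by (rule integral_abs_bound)
  also have "\<dots> \<le> (\<integral>y. \<bar>z\<bar> * Lip0_norm f1 \<partial>\<mu>)"
  proof (rule integral_mono)
    show "\<bar>f1 (x + z + y) - f1 (x + y)\<bar> \<le> \<bar>z\<bar> * Lip0_norm f1" for y
      using Lip0_lipschitz[OF f1, of "x + z + y" "x + y"] by (simp add: mult.commute)
  qed (auto intro!: i1)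
  finally have 1: "\<bar>(\<integral>y. f1 (x + z + y) \<partial>\<mu>) - (\<integral>y. f1 (x + y) \<partial>\<mu>)\<bar> \<le> \<bar>z\<bar> * Lip0_norm f1"
    by (simp add: prob_space)
  show ?thesis unfolding eq using 0 1 by linarith
qed

text \<open>Full balls stand in for shells: overlaps only enlarge the majorant, and its
  \<rho>-integral can be taken term by term with exactly the ball masses that
  \<open>U_small_ball\<close> controls.\<close>

definition kernel_bound :: "real \<Rightarrow> (real \<Rightarrow> real) \<Rightarrow> real \<Rightarrow> real \<Rightarrow> ennreal" where
  "kernel_bound c f r z =
     (\<Sum>k. ennreal (c / (2 ^ k * r)) * K_functional (2 ^ k * r) f * indicator {- (2 ^ k * r)..2 ^ k * r} z)"

lemma kernel_bound_measurable [measurable]: "kernel_bound c f r \<in> borel_measurable borel"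
  unfolding kernel_bound_def by measurable

lemma kernel_bound_term:
  assumes "\<bar>z\<bar> \<le> 2 ^ k * r"
  shows "ennreal (c / (2 ^ k * r)) * K_functional (2 ^ k * r) f \<le> kernel_bound c f r z"
proof -
  have "ennreal (c / (2 ^ k * r)) * K_functional (2 ^ k * r) f
     = (\<Sum>k\<in>{k}. ennreal (c / (2 ^ k * r)) * K_functional (2 ^ k * r) f * indicator {- (2 ^ k * r)..2 ^ k * r} z)"
    using assms by (auto simp: indicator_def abs_le_iff)
  also have "\<dots> \<le> kernel_bound c f r z"
    unfolding kernel_bound_def by (intro sum_le_suminf) auto
  finally show ?thesis .
qed

lemma ennreal_divide_le_K_functional:
  assumes "0 < a" and "\<And>f0 f1. (f0, f1) \<in> decomp f \<Longrightarrow> \<Delta> / a \<le> Cb0_norm f0 + v * Lip0_norm f1"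
  shows "ennreal \<Delta> \<le> ennreal a * K_functional v f"
proof -
  have "ennreal (\<Delta> / a) \<le> K_functional v f"
    using assms by (intro K_functional_greatest ennreal_leI)
  then have "ennreal a * ennreal (\<Delta> / a) \<le> ennreal a * K_functional v f" by (rule mult_left_mono) simp
  then show ?thesis using \<open>0 < a\<close> by (simp add: ennreal_mult'[symmetric])
qed

text \<open>The constant \<open>max c 4\<close> serves both ranges of z. For |z| \<le> r it has to
  exceed c for the bounded part and 1 for the Lipschitz part. For |z| > r, passing from |z| to the
  next dyadic radius w \<le> 2 * |z| turns 2 / |z| into at most 4 / w.\<close>

lemma difference_quotient_le_kernel_bound:
  assumes \<mu>: "prob_space \<mu>" "sets \<mu> = sets borel" and r: "0 < r" and c: "0 \<le> c" and z: "z \<noteq> 0"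
    and tv: "tv_norm_diff (distr \<mu> borel (\<lambda>y. z + y)) \<mu> \<le> ennreal (c * \<bar>z\<bar> / r)"
    and int: "\<And>x. integrable \<mu> (\<lambda>y. f (x + y))"
  shows "ennreal \<bar>((\<integral>y. f (x + z + y) \<partial>\<mu>) - (\<integral>y. f (x + y) \<partial>\<mu>)) / z\<bar> \<le> kernel_bound (max c 4) f r z"
proof -
  define \<Delta> where "\<Delta> = \<bar>(\<integral>y. f (x + z + y) \<partial>\<mu>) - (\<integral>y. f (x + y) \<partial>\<mu>)\<bar>"
  have \<Delta>0: "0 \<le> \<Delta>" by (simp add: \<Delta>_def)
  have \<Delta>: "\<Delta> \<le> min 2 (c * \<bar>z\<bar> / r) * Cb0_norm f0 + \<bar>z\<bar> * Lip0_norm f1"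
    and nn: "0 \<le> Cb0_norm f0" "0 \<le> Lip0_norm f1" if "(f0, f1) \<in> decomp f" for f0 f1
    unfolding \<Delta>_def using that r c
    by (auto intro!: translated_mean_diff_le[OF \<mu> tv _ _ int])
       (auto simp: decomp_def Cb0_norm_nonneg Lip0_norm_nonneg)
  have quot: "ennreal \<bar>((\<integral>y. f (x + z + y) \<partial>\<mu>) - (\<integral>y. f (x + y) \<partial>\<mu>)) / z\<bar> = ennreal (1 / \<bar>z\<bar>) * ennreal \<Delta>"
    using z by (simp add: \<Delta>_def ennreal_mult[symmetric])
  have le: "ennreal (1 / \<bar>z\<bar>) * (ennreal a * K) \<le> ennreal b * K" if "a / \<bar>z\<bar> \<le> b" "0 \<le> a" for a b K
  proof -
    have "ennreal (1 / \<bar>z\<bar>) * (ennreal a * K) = ennreal (a / \<bar>z\<bar>) * K"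
      using that by (simp add: mult.assoc[symmetric] ennreal_mult[symmetric])
    also have "\<dots> \<le> ennreal b * K" using that by (intro mult_right_mono ennreal_leI) auto
    finally show ?thesis .
  qed
  show ?thesis
  proof (cases "\<bar>z\<bar> \<le> r")
    case True
    define C where "C = max c 4"
    have C: "c \<le> C" "1 \<le> C" by (auto simp: C_def)
    have "ennreal \<Delta> \<le> ennreal (C * \<bar>z\<bar> / r) * K_functional r f"
    proof (rule ennreal_divide_le_K_functional)
      show "0 < C * \<bar>z\<bar> / r" using C r z by simp
      fix f0 f1 assume d: "(f0, f1) \<in> decomp f"
      have "\<Delta> \<le> (C * \<bar>z\<bar> / r) * Cb0_norm f0 + (C * \<bar>z\<bar> / r) * (r * Lip0_norm f1)"
      proof -
        have "min 2 (c * \<bar>z\<bar> / r) * Cb0_norm f0 \<le> (C * \<bar>z\<bar> / r) * Cb0_norm f0"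
          using C r nn[OF d] by (intro mult_right_mono) (auto intro!: min.coboundedI2 divide_right_mono mult_right_mono)
        moreover have "\<bar>z\<bar> * Lip0_norm f1 \<le> (C * \<bar>z\<bar> / r) * (r * Lip0_norm f1)"
          using C r nn[OF d] mult_right_mono[of 1 C "\<bar>z\<bar> * Lip0_norm f1"] by simp
        ultimately show ?thesis using \<Delta>[OF d] by linarith
      qed
      then show "\<Delta> / (C * \<bar>z\<bar> / r) \<le> Cb0_norm f0 + r * Lip0_norm f1"
        using C r z by (subst pos_divide_le_eq) (auto simp: algebra_simps)
    qed
    then have "ennreal (1 / \<bar>z\<bar>) * ennreal \<Delta> \<le> ennreal (1 / \<bar>z\<bar>) * (ennreal (C * \<bar>z\<bar> / r) * K_functional r f)"
      by (intro mult_left_mono) auto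
    also have "\<dots> \<le> ennreal (C / (2 ^ 0 * r)) * K_functional (2 ^ 0 * r) f"
      using le[of "C * \<bar>z\<bar> / r" "C / r" "K_functional r f"] z C r by simp
    also have "\<dots> \<le> kernel_bound C f r z"
      using True by (intro kernel_bound_term) auto
    finally show ?thesis unfolding quot C_def .
  next
    case False
    \<comment> \<open>The least n with |z| \<le> 2 ^ n * r is not 0 because |z| > r; k is its
      predecessor.\<close>
    obtain k where k: "2 ^ k * r < \<bar>z\<bar>" "\<bar>z\<bar> \<le> 2 ^ Suc k * r"
    proof -
      define P where "P k \<longleftrightarrow> \<bar>z\<bar> \<le> 2 ^ k * r" for k :: nat
      obtain n :: nat where "\<bar>z\<bar> / r < 2 ^ n" using real_arch_pow[of 2 "\<bar>z\<bar> / r"] by auto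
      then have "P n" using r by (simp add: P_def field_simps)
      then have "P (LEAST n. P n)" by (rule LeastI)
      moreover have "\<not> P 0" using False by (simp add: P_def)
      ultimately obtain k where "(LEAST n. P n) = Suc k" by (metis not0_implies_Suc)
      then have "P (Suc k)" "\<not> P k" using \<open>P (LEAST n. P n)\<close> not_less_Least[of k P] by auto
      then show ?thesis using that[of k] by (simp add: P_def)
    qed
    define w where "w = 2 ^ Suc k * r"
    have "ennreal \<Delta> \<le> ennreal 2 * K_functional \<bar>z\<bar> f"
    proof (rule ennreal_divide_le_K_functional)
      fix f0 f1 assume d: "(f0, f1) \<in> decomp f"
      have "min 2 (c * \<bar>z\<bar> / r) * Cb0_norm f0 \<le> 2 * Cb0_norm f0"
        using nn[OF d] by (intro mult_right_mono) auto
      then show "\<Delta> / 2 \<le> Cb0_norm f0 + \<bar>z\<bar> * Lip0_norm f1"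
        using \<Delta>[OF d] nn[OF d] mult_nonneg_nonneg[of "\<bar>z\<bar>" "Lip0_norm f1"] by linarith
    qed simp
    also have "\<dots> \<le> ennreal 2 * K_functional w f"
      using k by (intro mult_left_mono K_functional_mono) (auto simp: w_def)
    finally have "ennreal (1 / \<bar>z\<bar>) * ennreal \<Delta> \<le> ennreal (1 / \<bar>z\<bar>) * (ennreal 2 * K_functional w f)"
      by (intro mult_left_mono) auto
    also have "\<dots> \<le> ennreal (max c 4 / w) * K_functional w f"
    proof (rule le)
      have "2 * w \<le> 4 * \<bar>z\<bar>" using k by (simp add: w_def)
      also have "\<dots> \<le> max c 4 * \<bar>z\<bar>" by (intro mult_right_mono) auto
      finally show "2 / \<bar>z\<bar> \<le> max c 4 / w" using z r by (simp add: w_def field_simps)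
    qed simp
    also have "\<dots> \<le> kernel_bound (max c 4) f r z"
      unfolding w_def using k by (intro kernel_bound_term) auto
    finally show ?thesis unfolding quot .
  qed
qed

text \<open>The small ball condition speaks of radii up to 1. Beyond that its bound is free, as
  \<rho> has mass 1 and C * d powr \<epsilon> \<ge> 1, so all dyadic radii are treated
  alike.\<close>

lemma nn_integral_kernel_bound_le:
  assumes \<rho>: "prob_space \<rho>" "sets \<rho> = sets borel" and U: "\<rho> \<in> U_small_ball \<epsilon> C" "0 \<le> \<epsilon>" "1 \<le> C"
    and r: "0 < r" and c: "0 \<le> c"
  shows "(\<integral>\<^sup>+z. kernel_bound c f r z \<partial>\<rho>) \<le> ennreal (c * C) * dyadic_K \<epsilon> f r"
proof -
  interpret prob_space \<rho> by fact
  note [measurable_cong] = \<rho>(2)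
  have ball: "measure \<rho> {-d..d} \<le> C * d powr \<epsilon>" if "0 < d" for d
  proof (cases "d \<le> 1")
    case True
    then show ?thesis using U(1) that by (auto simp: U_small_ball_def dest!: bspec[of _ _ d])
  next
    case False
    then have "1 \<le> d powr \<epsilon>" using U(2) by (simp add: ge_one_powr_ge_zero)
    then have "1 * 1 \<le> C * d powr \<epsilon>" using U(3) by (intro mult_mono) auto
    then show ?thesis using prob_le_1[of "{-d..d}"] by linarith
  qed
  have "(\<integral>\<^sup>+z. kernel_bound c f r z \<partial>\<rho>)
      = (\<Sum>k. ennreal (c / (2 ^ k * r)) * K_functional (2 ^ k * r) f * emeasure \<rho> {- (2 ^ k * r)..2 ^ k * r})"
    unfolding kernel_bound_def by (simp add: nn_integral_suminf nn_integral_cmult)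
  also have "\<dots> \<le> (\<Sum>k. ennreal (c * C) * (ennreal ((2 ^ k * r) powr (\<epsilon> - 1)) * K_functional (2 ^ k * r) f))"
  proof (intro suminf_le)
    fix k :: nat
    define d where "d = 2 ^ k * r"
    have d: "0 < d" using r by (simp add: d_def)
    have "ennreal (c / d) * K_functional d f * emeasure \<rho> {-d..d}
        \<le> ennreal (c / d) * K_functional d f * ennreal (C * d powr \<epsilon>)"
      unfolding emeasure_eq_measure by (intro mult_left_mono ennreal_leI ball d) auto
    also have "\<dots> = ennreal ((c / d) * (C * d powr \<epsilon>)) * K_functional d f"
      using c d U(3) by (subst ennreal_mult) (auto simp: ac_simps)
    also have "(c / d) * (C * d powr \<epsilon>) = (c * C) * d powr (\<epsilon> - 1)"
      using d by (simp add: powr_diff field_simps)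
    also have "ennreal (c * C * d powr (\<epsilon> - 1)) = ennreal (c * C) * ennreal (d powr (\<epsilon> - 1))"
      using c U(3) by (subst ennreal_mult) auto
    finally show "ennreal (c / (2 ^ k * r)) * K_functional (2 ^ k * r) f * emeasure \<rho> {- (2 ^ k * r)..2 ^ k * r}
        \<le> ennreal (c * C) * (ennreal ((2 ^ k * r) powr (\<epsilon> - 1)) * K_functional (2 ^ k * r) f)"
      unfolding d_def by (simp add: mult.assoc)
  qed auto
  also have "\<dots> = ennreal (c * C) * dyadic_K \<epsilon> f r" unfolding dyadic_K_def by simp
  finally show ?thesis .
qed

section \<open>Independence of the increments from the augmented filtration\<close>

locale levy_proc = prob_space M for M :: "'a measure" +
  fixes X :: "real \<Rightarrow> 'a \<Rightarrow> real" and T :: real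
  assumes T_pos: "0 < T" and levy: "levy_process M T X"
begin

lemma X_measurable: "t \<in> {0..T} \<Longrightarrow> X t \<in> borel_measurable M"
  using levy by (simp add: levy_process_def)

lemma X_0: "\<omega> \<in> space M \<Longrightarrow> X 0 \<omega> = 0"
  using levy by (simp add: levy_process_def)

lemma distr_increment:
  "0 \<le> s \<Longrightarrow> s \<le> t \<Longrightarrow> t \<le> T \<Longrightarrow> distr M borel (\<lambda>\<omega>. X t \<omega> - X s \<omega>) = distr M borel (X (t - s))"
  using levy by (simp add: levy_process_def)

lemma indep_increments:
  "\<tau> ` {..n} \<subseteq> {0..T} \<Longrightarrow> mono_on {..n} \<tau> \<Longrightarrow>
    indep_vars (\<lambda>_. borel) (\<lambda>i \<omega>. X (\<tau> (Suc i)) \<omega> - X (\<tau> i) \<omega>) {..<n}"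
  for n :: nat
  using levy by (simp add: levy_process_def)

abbreviation "\<F> \<equiv> augmented_filtration M T X"

sublocale \<F>: filtration "space M" \<F>
  by (rule filtration_augmented_filtration)

lemma augmented_generator_subset:
  "{X s -` B \<inter> space M | s B. s \<in> {0..min t T} \<and> B \<in> sets borel} \<union> null_sets M \<subseteq> sets M"
  using X_measurable by (auto intro!: measurable_sets[of _ M borel])

lemma sets_\<F>:
  "sets (\<F> t) = sigma_sets (space M)
    ({X s -` B \<inter> space M | s B. s \<in> {0..min t T} \<and> B \<in> sets borel} \<union> null_sets M)"
  unfolding augmented_filtration_def
  using augmented_generator_subset[of t] sets.space_closed[of M]
  by (intro sets_measure_of) blast

lemma space_\<F> [simp]: "space (\<F> t) = space M"
  by (rule \<F>.space_F)

lemma subalgebra_\<F>: "subalgebra M (\<F> t)"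
  unfolding subalgebra_def sets_\<F>
  using sets.sigma_sets_subset[OF augmented_generator_subset] by simp

lemma X_adapted: "0 \<le> s \<Longrightarrow> s \<le> t \<Longrightarrow> t \<le> T \<Longrightarrow> X s \<in> borel_measurable (\<F> t)"
  by (intro measurableI) (auto simp: sets_\<F> intro!: sigma_sets.Basic)

text \<open>Past values are partial sums of increments along a grid containing 0, S and u, and X v -
  X u is the next increment on the same grid. The claim is independence of a block of increments
  from the one that follows.\<close>

lemma indep_cylinder:
  assumes uv: "0 \<le> u" "u \<le> v" "v \<le> T" and S: "finite S" "S \<subseteq> {0..u}"
    and B: "\<And>s. B s \<in> sets borel" and C: "C \<in> sets borel"
  shows "prob ({\<omega> \<in> space M. \<forall>s\<in>S. X s \<omega> \<in> B s} \<inter> ((\<lambda>\<omega>. X v \<omega> - X u \<omega>) -` C \<inter> space M))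
    = prob {\<omega> \<in> space M. \<forall>s\<in>S. X s \<omega> \<in> B s} * prob ((\<lambda>\<omega>. X v \<omega> - X u \<omega>) -` C \<inter> space M)"
proof -
  \<comment> \<open>The point 0 makes the partial sums start at X 0 = 0, and u makes the final
    increment equal X v - X u.\<close>
  define xs where "xs = sorted_list_of_set (insert 0 (insert u S))"
  define m where "m = length xs - 1"
  \<comment> \<open>Past the end of the list \<tau> is v, so the increment with index m runs from u
    to v.\<close>
  define \<tau> where "\<tau> i = (if i \<le> m then xs ! i else v)" for i
  define I where "I i \<omega> = X (\<tau> (Suc i)) \<omega> - X (\<tau> i) \<omega>" for i \<omega>
  have set_xs: "set xs = insert 0 (insert u S)" and sorted: "sorted xs"
    unfolding xs_def using S(1) by (simp_all only: set_sorted_list_of_set finite_insert sorted_sorted_list_of_set)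
  have len: "length xs = Suc m"
    using set_xs unfolding m_def by (cases xs) auto
  have xs_range: "xs ! i \<in> {0..u}" if "i \<le> m" for i
    using nth_mem[of i xs] that len set_xs S(2) uv by auto
  have xs_0: "xs ! 0 = 0"
  proof -
    obtain i where "i < length xs" "xs ! i = 0" using set_xs by (metis in_set_conv_nth insertI1)
    then show ?thesis using sorted_nth_mono[OF sorted, of 0 i] xs_range[of 0] by auto
  qed
  have xs_m: "xs ! m = u"
  proof -
    obtain i where "i < length xs" "xs ! i = u" using set_xs by (metis in_set_conv_nth insertCI)
    then show ?thesis using sorted_nth_mono[OF sorted, of i m] xs_range[of m] len by auto
  qed
  have "\<tau> ` {..Suc m} \<subseteq> {0..T}"
  proof (intro image_subsetI)
    fix i assume "i \<in> {..Suc m}"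
    show "\<tau> i \<in> {0..T}" using xs_range[of i] uv unfolding \<tau>_def by auto
  qed
  moreover have "mono_on {..Suc m} \<tau>"
  proof (intro mono_onI)
    fix i j assume ij: "i \<in> {..Suc m}" "j \<in> {..Suc m}" "i \<le> j"
    show "\<tau> i \<le> \<tau> j"
      using sorted_nth_mono[OF sorted, of i j] xs_range[of i] uv ij len unfolding \<tau>_def by auto
  qed
  ultimately have "indep_vars (\<lambda>_. borel) I {..<Suc m}"
    using indep_increments[of \<tau> "Suc m"] unfolding I_def[abs_def] by simp
  then have ind: "indep_var (PiM {..<m} (\<lambda>_. borel)) (\<lambda>\<omega>. restrict (\<lambda>i. I i \<omega>) {..<m})
      (PiM {m} (\<lambda>_. borel)) (\<lambda>\<omega>. restrict (\<lambda>i. I i \<omega>) {m})"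
    by (rule indep_var_restrict) auto
  have X_sum: "X (\<tau> j) \<omega> = (\<Sum>i<j. I i \<omega>)" if "\<omega> \<in> space M" for j \<omega>
    unfolding I_def using that X_0 xs_0
    by (subst sum_lessThan_telescope) (simp add: \<tau>_def)
  have I_m: "I m \<omega> = X v \<omega> - X u \<omega>" for \<omega>
    by (simp add: I_def \<tau>_def xs_m)
  \<comment> \<open>The cylinder condition read in increment coordinates; grid points outside S
    carry no condition.\<close>
  define G where "G = {g \<in> space (PiM {..<m} (\<lambda>_. borel :: real measure)). \<forall>j\<in>{..m}. \<tau> j \<in> S \<longrightarrow> (\<Sum>i<j. g i) \<in> B (\<tau> j)}"
  have "(\<lambda>g. \<Sum>i<j. g i) \<in> borel_measurable (PiM {..<m} (\<lambda>_. borel :: real measure))" if "j \<le> m" for j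
    using that by (intro borel_measurable_sum measurable_component_singleton) auto
  then have "Measurable.pred (PiM {..<m} (\<lambda>_. borel :: real measure)) (\<lambda>g. \<forall>j\<in>{..m}. \<tau> j \<in> S \<longrightarrow> (\<Sum>i<j. g i) \<in> B (\<tau> j))"
    using B by (intro pred_intros_finite pred_intros_logic) (auto intro: pred_sets2)
  then have G: "G \<in> sets (PiM {..<m} (\<lambda>_. borel))" unfolding G_def by simp
  define H where "H = {g \<in> space (PiM {m} (\<lambda>_. borel :: real measure)). g m \<in> C}"
  have H: "H \<in> sets (PiM {m} (\<lambda>_. borel))"
    unfolding H_def using C by measurable
  have S_eq: "(\<forall>s\<in>S. P s) \<longleftrightarrow> (\<forall>j\<in>{..m}. \<tau> j \<in> S \<longrightarrow> P (\<tau> j))" for P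
  proof
    assume R: "\<forall>j\<in>{..m}. \<tau> j \<in> S \<longrightarrow> P (\<tau> j)"
    show "\<forall>s\<in>S. P s"
    proof
      fix s assume "s \<in> S"
      then obtain j where "j < length xs" "xs ! j = s" using set_xs by (metis in_set_conv_nth insertCI)
      then show "P s" using R \<open>s \<in> S\<close> len by (auto simp: \<tau>_def dest: bspec[of _ _ j])
    qed
  qed auto
  have 1: "(\<lambda>\<omega>. restrict (\<lambda>i. I i \<omega>) {..<m}) -` G \<inter> space M = {\<omega> \<in> space M. \<forall>s\<in>S. X s \<omega> \<in> B s}"
  proof -
    have "(\<Sum>i<j. restrict (\<lambda>i. I i \<omega>) {..<m} i) = (\<Sum>i<j. I i \<omega>)" if "j \<le> m" for j \<omega>
      using that by (intro sum.cong) auto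
    then show ?thesis unfolding G_def S_eq using X_sum by (auto simp: space_PiM)
  qed
  have 2: "(\<lambda>\<omega>. restrict (\<lambda>i. I i \<omega>) {m}) -` H \<inter> space M = (\<lambda>\<omega>. X v \<omega> - X u \<omega>) -` C \<inter> space M"
    unfolding H_def by (auto simp: space_PiM I_m)
  have "(\<lambda>x. (restrict (\<lambda>i. I i x) {..<m}, restrict (\<lambda>i. I i x) {m})) -` (G \<times> H) \<inter> space M
    = ((\<lambda>\<omega>. restrict (\<lambda>i. I i \<omega>) {..<m}) -` G \<inter> space M) \<inter> ((\<lambda>\<omega>. restrict (\<lambda>i. I i \<omega>) {m}) -` H \<inter> space M)"
    by auto
  then show ?thesis using indep_varD[OF ind G H] unfolding 1 2 by simp
qed

text \<open>Augmentation is harmless: a null set is independent of every event, and adjoining the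
  null sets to the finite-dimensional cylinders keeps the family closed under intersection.
  Independence of generators that are stable under intersection extends to the generated
  \<sigma>-algebras.\<close>

lemma indep_increment_past:
  assumes uv: "0 \<le> u" "u \<le> v" "v \<le> T"
    and A: "A \<in> sets (\<F> u)" and C: "C \<in> sets borel"
  shows "prob (A \<inter> ((\<lambda>\<omega>. X v \<omega> - X u \<omega>) -` C \<inter> space M))
    = prob A * prob ((\<lambda>\<omega>. X v \<omega> - X u \<omega>) -` C \<inter> space M)"
proof -
  define W where "W \<omega> = X v \<omega> - X u \<omega>" for \<omega>
  define cyl where "cyl = {A. \<exists>S B. A = {\<omega> \<in> space M. \<forall>s\<in>S. X s \<omega> \<in> B s} \<and> finite S \<and> S \<subseteq> {0..u} \<and> (\<forall>s. B s \<in> sets borel)}"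
  have cylE: "\<exists>S B. A = {\<omega> \<in> space M. \<forall>s\<in>S. X s \<omega> \<in> B s} \<and> finite S \<and> S \<subseteq> {0..u} \<and> (\<forall>s. B s \<in> sets borel)"
    if "A \<in> cyl" for A
    using that by (simp only: cyl_def mem_Collect_eq)
  have cylI: "{\<omega> \<in> space M. \<forall>s\<in>S. X s \<omega> \<in> B s} \<in> cyl"
    if "finite S" "S \<subseteq> {0..u}" "\<forall>s. B s \<in> sets borel" for S B
    unfolding cyl_def mem_Collect_eq using that by (intro exI[of _ S] exI[of _ B]) simp
  define G1 where "G1 = cyl \<union> null_sets M"
  define G2 where "G2 = {W -` C \<inter> space M | C. C \<in> sets borel}"
  have W [measurable]: "W \<in> borel_measurable M"
    unfolding W_def[abs_def] using uv by (intro borel_measurable_diff X_measurable) auto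
  have cyl_sets: "cyl \<subseteq> sets M"
  proof
    fix A assume "A \<in> cyl"
    from cylE[OF this] obtain S B where
      A: "A = {\<omega> \<in> space M. \<forall>s\<in>S. X s \<omega> \<in> B s}" "finite S" "S \<subseteq> {0..u}" "\<forall>s. B s \<in> sets borel"
      by (elim exE conjE)
    have "{\<omega> \<in> space M. X s \<omega> \<in> B s} \<in> sets M" if "s \<in> S" for s
    proof -
      have "s \<in> {0..T}" using that A(3) uv by auto
      then have "X s -` B s \<inter> space M \<in> sets M"
        using A(4) by (intro measurable_sets[OF X_measurable]) simp_all
      also have "X s -` B s \<inter> space M = {\<omega> \<in> space M. X s \<omega> \<in> B s}" by blast
      finally show ?thesis .
    qed
    then show "A \<in> sets M" unfolding A(1) using A(2) by (intro sets.sets_Collect_finite_All) auto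
  qed
  have "Int_stable cyl"
  proof (rule Int_stableI)
    fix a b assume "a \<in> cyl" "b \<in> cyl"
    from cylE[OF \<open>a \<in> cyl\<close>] obtain S1 B1 where
      a: "a = {\<omega> \<in> space M. \<forall>s\<in>S1. X s \<omega> \<in> B1 s}" "finite S1" "S1 \<subseteq> {0..u}" "\<forall>s. B1 s \<in> sets borel"
      by (elim exE conjE)
    from cylE[OF \<open>b \<in> cyl\<close>] obtain S2 B2 where
      b: "b = {\<omega> \<in> space M. \<forall>s\<in>S2. X s \<omega> \<in> B2 s}" "finite S2" "S2 \<subseteq> {0..u}" "\<forall>s. B2 s \<in> sets borel"
      by (elim exE conjE)
    \<comment> \<open>Conditions on different index sets are brought to a common one;
      \<open>UNIV\<close> stands for no condition.\<close>
    define B where "B s = (if s \<in> S1 then B1 s else UNIV) \<inter> (if s \<in> S2 then B2 s else UNIV)" for s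
    have "a \<inter> b = {\<omega> \<in> space M. \<forall>s\<in>S1 \<union> S2. X s \<omega> \<in> B s}"
      unfolding a b B_def by auto
    moreover have "\<forall>s. B s \<in> sets borel" unfolding B_def using a b by auto
    ultimately show "a \<inter> b \<in> cyl" using a b by (simp only:) (intro cylI; simp)
  qed
  then have G1_stable: "Int_stable G1"
    unfolding G1_def Int_stable_def using cyl_sets by (auto intro: null_set_Int1 null_set_Int2)
  have G2_stable: "Int_stable G2"
  proof (rule Int_stableI)
    fix a b assume "a \<in> G2" "b \<in> G2"
    then obtain C D where "a = W -` C \<inter> space M" "b = W -` D \<inter> space M" "C \<in> sets borel" "D \<in> sets borel"
      unfolding G2_def by blast
    then show "a \<inter> b \<in> G2" unfolding G2_def by (intro CollectI exI[of _ "C \<inter> D"]) auto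
  qed
  have "indep_set G1 G2"
  proof (rule indep_setI)
    show "G1 \<subseteq> sets M" unfolding G1_def using cyl_sets by auto
    show "G2 \<subseteq> sets M" unfolding G2_def by auto
    fix a b assume a: "a \<in> G1" and b: "b \<in> G2"
    then obtain C where C: "b = W -` C \<inter> space M" "C \<in> sets borel" unfolding G2_def by blast
    show "prob (a \<inter> b) = prob a * prob b"
    proof (cases "a \<in> cyl")
      case True
      from cylE[OF this] obtain S B where
        "a = {\<omega> \<in> space M. \<forall>s\<in>S. X s \<omega> \<in> B s}" "finite S" "S \<subseteq> {0..u}" "\<forall>s. B s \<in> sets borel"
        by (elim exE conjE)
      then show ?thesis using indep_cylinder[OF uv, of S B C] C unfolding W_def[abs_def] by simp
    next
      case False
      then have "a \<in> null_sets M" using a by (simp add: G1_def)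
      moreover have "b \<in> sets M" using C by simp
      ultimately have "a \<inter> b \<in> null_sets M" by (rule null_set_Int2)
      then show ?thesis using \<open>a \<in> null_sets M\<close> by (simp add: measure_eq_0_null_sets)
    qed
  qed
  then have ind: "indep_set (sigma_sets (space M) G1) (sigma_sets (space M) G2)"
    by (rule indep_set_sigma_sets[OF _ G1_stable G2_stable])
  have "sets (\<F> u) \<subseteq> sigma_sets (space M) G1"
    unfolding sets_\<F>
  proof (rule sigma_sets_mono, safe)
    fix s and B :: "real set" assume s: "s \<in> {0..min u T}" and B: "B \<in> sets borel"
    have "X s -` B \<inter> space M = {\<omega> \<in> space M. \<forall>s\<in>{s}. X s \<omega> \<in> (\<lambda>_. B) s}" by auto
    also have "\<dots> \<in> cyl" using s B by (intro cylI) auto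
    finally show "X s -` B \<inter> space M \<in> sigma_sets (space M) G1" by (auto simp: G1_def)
  qed (auto simp: G1_def)
  then have "A \<in> sigma_sets (space M) G1" using A by blast
  moreover have "W -` C \<inter> space M \<in> sigma_sets (space M) G2" using C by (auto simp: G2_def)
  ultimately show ?thesis using indep_setD[OF ind] unfolding W_def[abs_def] by blast
qed

text \<open>The target space \<open>N\<close> is arbitrary so that the past variable can be the
  identity map to \<open>\<F> u\<close>, which encodes the entire past, as well as X u alone, which
  gives the convolution formula.\<close>

lemma pair_past_increment_distr:
  assumes uv: "0 \<le> u" "u \<le> v" "v \<le> T" and Y: "Y \<in> \<F> u \<rightarrow>\<^sub>M N"
  shows "distr M N Y \<Otimes>\<^sub>M distr M borel (\<lambda>\<omega>. X v \<omega> - X u \<omega>)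
    = distr M (N \<Otimes>\<^sub>M borel) (\<lambda>\<omega>. (Y \<omega>, X v \<omega> - X u \<omega>))"
proof -
  define W where "W \<omega> = X v \<omega> - X u \<omega>" for \<omega>
  have W [measurable]: "W \<in> borel_measurable M"
    unfolding W_def[abs_def] using uv by (intro borel_measurable_diff X_measurable) auto
  have Y_M [measurable]: "Y \<in> M \<rightarrow>\<^sub>M N" by (rule measurable_from_subalg[OF subalgebra_\<F> Y])
  have "distr M N Y \<Otimes>\<^sub>M distr M borel W = distr M (N \<Otimes>\<^sub>M borel) (\<lambda>\<omega>. (Y \<omega>, W \<omega>))"
  proof (rule pair_measure_eqI)
    show "sigma_finite_measure (distr M N Y)" "sigma_finite_measure (distr M borel W)"
      by (simp_all add: prob_space_distr prob_space_imp_sigma_finite)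
    fix A B assume "A \<in> sets (distr M N Y)" "B \<in> sets (distr M borel W)"
    then have AB [measurable]: "A \<in> sets N" "B \<in> sets borel" by auto
    have "Y -` A \<inter> space M \<in> sets (\<F> u)" using measurable_sets[OF Y AB(1)] by simp
    from indep_increment_past[OF uv this AB(2)]
    have "prob ((Y -` A \<inter> space M) \<inter> (W -` B \<inter> space M)) = prob (Y -` A \<inter> space M) * prob (W -` B \<inter> space M)"
      by (simp add: W_def[abs_def])
    moreover have "(Y -` A \<inter> space M) \<inter> (W -` B \<inter> space M) = (\<lambda>\<omega>. (Y \<omega>, W \<omega>)) -` (A \<times> B) \<inter> space M"
      by auto
    ultimately show "emeasure (distr M N Y) A * emeasure (distr M borel W) B
        = emeasure (distr M (N \<Otimes>\<^sub>M borel) (\<lambda>\<omega>. (Y \<omega>, W \<omega>))) (A \<times> B)"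
      by (simp add: emeasure_distr emeasure_eq_measure ennreal_mult)
  qed (simp cong: sets_pair_measure_cong)
  then show ?thesis by (simp add: W_def[abs_def])
qed

text \<open>The Markov property, tested against bounded past variables in place of conditional
  expectations. With the identity map as past variable, Z and X u are functions of one coordinate,
  and Fubini separates the increment.\<close>

lemma integral_mult_future:
  assumes uv: "0 \<le> u" "u \<le> v" "v \<le> T"
    and Z [measurable]: "Z \<in> borel_measurable (\<F> u)" and g [measurable]: "g \<in> borel_measurable borel"
    and Z_le: "\<And>\<omega>. \<omega> \<in> space M \<Longrightarrow> \<bar>Z \<omega>\<bar> \<le> A" and g_le: "\<And>x. \<bar>g x\<bar> \<le> (B::real)"
  shows "(\<integral>\<omega>. Z \<omega> * g (X v \<omega>) \<partial>M)
    = (\<integral>\<omega>. Z \<omega> * (\<integral>y. g (X u \<omega> + y) \<partial>distr M borel (X (v - u))) \<partial>M)"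
proof -
  define W where "W \<omega> = X v \<omega> - X u \<omega>" for \<omega>
  have id\<F>: "(\<lambda>\<omega>. \<omega>) \<in> \<F> u \<rightarrow>\<^sub>M \<F> u" by simp
  have [measurable]: "X u \<in> borel_measurable (\<F> u)" using uv by (intro X_adapted) auto
  have id: "(\<lambda>\<omega>. \<omega>) \<in> M \<rightarrow>\<^sub>M \<F> u" by (rule measurable_from_subalg[OF subalgebra_\<F> id\<F>])
  have W [measurable]: "W \<in> borel_measurable M"
    unfolding W_def[abs_def] using uv by (intro borel_measurable_diff X_measurable) auto
  define N where "N = distr M (\<F> u) (\<lambda>\<omega>. \<omega>)"
  have sN [measurable_cong]: "sets N = sets (\<F> u)" and spN: "space N = space M" by (simp_all add: N_def)
  have \<mu>: "distr M borel W = distr M borel (X (v - u))"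
    unfolding W_def[abs_def] using uv by (intro distr_increment)
  interpret N: prob_space N unfolding N_def by (rule prob_space_distr[OF id])
  interpret P: prob_space "distr M borel W" by (rule prob_space_distr[OF W])
  interpret NP: pair_prob_space N "distr M borel W" ..
  define h where "h = (\<lambda>(\<omega>, y). Z \<omega> * g (X u \<omega> + y))"
  have h [measurable]: "h \<in> borel_measurable (\<F> u \<Otimes>\<^sub>M borel)" unfolding h_def by measurable
  have "(\<integral>\<omega>. Z \<omega> * g (X v \<omega>) \<partial>M) = (\<integral>\<omega>. h (\<omega>, W \<omega>) \<partial>M)"
    by (simp add: h_def W_def)
  also have "\<dots> = (\<integral>p. h p \<partial>distr M (\<F> u \<Otimes>\<^sub>M borel) (\<lambda>\<omega>. (\<omega>, W \<omega>)))"
    using id by (intro integral_distr[symmetric] measurable_Pair) auto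
  also have "distr M (\<F> u \<Otimes>\<^sub>M borel) (\<lambda>\<omega>. (\<omega>, W \<omega>)) = N \<Otimes>\<^sub>M distr M borel W"
    using pair_past_increment_distr[OF uv id\<F>] by (simp add: N_def W_def[abs_def])
  also have "(\<integral>p. h p \<partial>(N \<Otimes>\<^sub>M distr M borel W)) = (\<integral>\<omega>. \<integral>y. h (\<omega>, y) \<partial>distr M borel W \<partial>N)"
  proof (rule NP.integral_fst'[symmetric])
    show "integrable (N \<Otimes>\<^sub>M distr M borel W) h"
    proof (rule NP.integrable_const_bound[where B="A * B"])
      show "AE p in N \<Otimes>\<^sub>M distr M borel W. norm (h p) \<le> A * B"
      proof (rule AE_I2)
        fix p assume "p \<in> space (N \<Otimes>\<^sub>M distr M borel W)"
        then obtain \<omega> y where p: "p = (\<omega>, y)" "\<omega> \<in> space M" by (auto simp: space_pair_measure spN)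
        then have "\<bar>Z \<omega>\<bar> * \<bar>g (X u \<omega> + y)\<bar> \<le> A * B"
          using Z_le[of \<omega>] by (intro mult_mono g_le) auto
        then show "norm (h p) \<le> A * B" by (simp add: h_def p abs_mult)
      qed
    qed measurable
  qed
  also have "\<dots> = (\<integral>\<omega>. Z \<omega> * (\<integral>y. g (X u \<omega> + y) \<partial>distr M borel W) \<partial>N)"
    by (simp add: h_def)
  also have "\<dots> = (\<integral>\<omega>. Z \<omega> * (\<integral>y. g (X u \<omega> + y) \<partial>distr M borel W) \<partial>M)"
    unfolding N_def
  proof (rule integral_distr[OF id])
    have "(\<lambda>\<omega>. \<integral>y. g (X u \<omega> + y) \<partial>distr M borel W) \<in> borel_measurable (\<F> u)"
      by (rule P.borel_measurable_lebesgue_integral) simp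
    then show "(\<lambda>\<omega>. Z \<omega> * (\<integral>y. g (X u \<omega> + y) \<partial>distr M borel W)) \<in> borel_measurable (\<F> u)"
      by simp
  qed
  finally show ?thesis unfolding \<mu> .
qed

text \<open>The same computation with only X u as past, but for an integrable g, because it is to be
  applied to an unbounded f.\<close>

lemma integral_convolution:
  assumes uv: "0 \<le> u" "0 \<le> s" "u + s \<le> T" and g [measurable]: "g \<in> borel_measurable borel"
    and int: "integrable M (\<lambda>\<omega>. g (x + X (u + s) \<omega>) :: real)"
  shows "integrable (distr M borel (X u)) (\<lambda>y. \<integral>w. g (x + y + w) \<partial>distr M borel (X s))"
    and "(\<integral>y. (\<integral>w. g (x + y + w) \<partial>distr M borel (X s)) \<partial>distr M borel (X u)) = (\<integral>\<omega>. g (x + X (u + s) \<omega>) \<partial>M)"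
proof -
  define W where "W \<omega> = X (u + s) \<omega> - X u \<omega>" for \<omega>
  have Xu [measurable]: "X u \<in> borel_measurable M" using uv by (intro X_measurable) auto
  have W [measurable]: "W \<in> borel_measurable M"
    unfolding W_def[abs_def] using uv by (intro borel_measurable_diff X_measurable) auto
  have \<mu>: "distr M borel W = distr M borel (X s)"
    unfolding W_def[abs_def] using distr_increment[of u "u + s"] uv by simp
  interpret P: prob_space "distr M borel (X u)" by (rule prob_space_distr[OF Xu])
  interpret Q: prob_space "distr M borel W" by (rule prob_space_distr[OF W])
  interpret PQ: pair_prob_space "distr M borel (X u)" "distr M borel W" ..
  have prod: "distr M borel (X u) \<Otimes>\<^sub>M distr M borel W = distr M (borel \<Otimes>\<^sub>M borel) (\<lambda>\<omega>. (X u \<omega>, W \<omega>))"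
    using pair_past_increment_distr[of u "u + s" "X u" borel] X_adapted[of u u] uv by (simp add: W_def[abs_def])
  define h where "h = (\<lambda>(y, w). g (x + y + w))"
  have h [measurable]: "h \<in> borel_measurable (borel \<Otimes>\<^sub>M borel)" unfolding h_def by measurable
  have hX: "h (X u \<omega>, W \<omega>) = g (x + X (u + s) \<omega>)" for \<omega>
    by (simp add: h_def W_def add.assoc)
  have ih: "integrable (distr M borel (X u) \<Otimes>\<^sub>M distr M borel W) h"
    unfolding prod by (subst integrable_distr_eq) (auto simp: hX int)
  have "integrable (distr M borel (X u)) (\<lambda>y. \<integral>w. h (y, w) \<partial>distr M borel W)"
    by (rule PQ.integrable_fst'[OF ih])
  then show "integrable (distr M borel (X u)) (\<lambda>y. \<integral>w. g (x + y + w) \<partial>distr M borel (X s))"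
    by (simp add: h_def \<mu>)
  have "(\<integral>y. \<integral>w. h (y, w) \<partial>distr M borel W \<partial>distr M borel (X u)) = (\<integral>p. h p \<partial>(distr M borel (X u) \<Otimes>\<^sub>M distr M borel W))"
    by (rule PQ.integral_fst'[OF ih])
  also have "\<dots> = (\<integral>\<omega>. g (x + X (u + s) \<omega>) \<partial>M)"
    unfolding prod by (subst integral_distr) (auto simp: hX)
  finally show "(\<integral>y. (\<integral>w. g (x + y + w) \<partial>distr M borel (X s)) \<partial>distr M borel (X u)) = (\<integral>\<omega>. g (x + X (u + s) \<omega>) \<partial>M)"
    by (simp add: h_def \<mu>)
qed

end

section \<open>The operator D for a Levy process\<close>

locale levy_smoothing = levy_proc M X T + R: prob_space \<rho>
  for M :: "'a measure" and X :: "real \<Rightarrow> 'a \<Rightarrow> real" and T :: real and \<rho> :: "real measure" +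
  fixes \<epsilon> \<beta> c\<^sub>\<rho> c\<^sub>X :: real
  assumes sets_\<rho> [measurable_cong]: "sets \<rho> = sets borel" and \<rho>_0: "emeasure \<rho> {0} = 0"
    and \<epsilon>_nonneg: "0 \<le> \<epsilon>" and \<beta>_pos: "0 < \<beta>"
    and \<rho>_U: "\<rho> \<in> U_small_ball \<epsilon> c\<^sub>\<rho>"
    and c\<^sub>X_pos: "0 < c\<^sub>X" and X_U: "X \<in> U_tv M T \<beta> (measure_support \<rho>) c\<^sub>X"
begin

abbreviation "F \<equiv> F_sem M T X"
abbreviation "D \<equiv> D_rho M T X \<rho>"

text \<open>What the probabilistic arguments need to know about f. It keeps the Hoelder index out of
  them, since the two estimates use the indices q and 2.\<close>

definition admissible :: "(real \<Rightarrow> real) \<Rightarrow> bool" where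
  "admissible f \<longleftrightarrow> decomp f \<noteq> {} \<and> (\<forall>s\<in>{0..T}. \<forall>x. integrable M (\<lambda>\<omega>. f (x + X s \<omega>)))"

text \<open>The distance below which, up to constants, the total variation bound c * |z| * (T - t)
  powr (-1 / \<beta>) improves on the trivial bound 2.\<close>

definition rad :: "real \<Rightarrow> real" where "rad t = (T - t) powr (1 / \<beta>)"

definition K_const :: real where "K_const = max c\<^sub>X 4"

definition D_const :: real where "D_const = K_const * max c\<^sub>\<rho> 1"

definition quot :: "(real \<Rightarrow> real) \<Rightarrow> real \<Rightarrow> real \<Rightarrow> real \<Rightarrow> real" where
  "quot f t x z = indicator (-{0}) z * ((F f t (x + z) - F f t x) / z)"

lemma rad_pos: "t < T \<Longrightarrow> 0 < rad t"
  by (simp add: rad_def)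

lemma K_const_pos: "0 < K_const" by (simp add: K_const_def)

lemma D_const_pos: "0 < D_const" unfolding D_const_def using K_const_pos by simp

lemma D_eq_quot: "D f t x = (\<integral>z. quot f t x z \<partial>\<rho>)"
  by (simp add: D_rho_def set_lebesgue_integral_def quot_def)

lemma admissible_measurable: "admissible f \<Longrightarrow> f \<in> borel_measurable borel"
  by (simp add: admissible_def decomp_measurable)

lemma prob_space_X: "s \<in> {0..T} \<Longrightarrow> prob_space (distr M borel (X s))"
  using X_measurable by (rule prob_space_distr)

lemma F_eq_integral_distr:
  assumes "admissible f" "t \<in> {0..T}"
  shows "F f t x = (\<integral>y. f (x + y) \<partial>distr M borel (X (T - t)))"
proof -
  note [measurable] = admissible_measurable[OF assms(1)]
  show ?thesis unfolding F_sem_def using assms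
    by (subst integral_distr) (auto intro!: X_measurable)
qed

lemma F_measurable [measurable]:
  assumes "admissible f" "t \<in> {0..T}"
  shows "F f t \<in> borel_measurable borel"
proof -
  interpret P: prob_space "distr M borel (X (T - t))" using assms by (intro prob_space_X) auto
  have [measurable]: "f \<in> borel_measurable borel" using assms(1) by (rule admissible_measurable)
  have "(\<lambda>x. \<integral>y. f (x + y) \<partial>distr M borel (X (T - t))) \<in> borel_measurable borel"
    by (rule P.borel_measurable_lebesgue_integral) simp
  also have "(\<lambda>x. \<integral>y. f (x + y) \<partial>distr M borel (X (T - t))) = F f t"
    using assms by (intro ext F_eq_integral_distr[symmetric])
  finally show ?thesis .
qed

text \<open>Translations are controlled by \<open>X_U\<close> at points of the support only; by
  \<open>AE_support\<close> these are \<rho>-almost all z.\<close>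

lemma quot_le_kernel_bound:
  assumes f: "admissible f" and t: "t \<in> {0..<T}" and z: "z \<in> measure_support \<rho>"
  shows "ennreal \<bar>quot f t x z\<bar> \<le> kernel_bound K_const f (rad t) z"
proof (cases "z = 0")
  case False
  have s: "T - t \<in> {0<..T}" using t by auto
  then have Xs [measurable]: "X (T - t) \<in> borel_measurable M" by (intro X_measurable) auto
  have [measurable]: "f \<in> borel_measurable borel" using f by (rule admissible_measurable)
  have tv: "tv_norm_diff (distr (distr M borel (X (T - t))) borel (\<lambda>y. z + y)) (distr M borel (X (T - t)))
      \<le> ennreal (c\<^sub>X * \<bar>z\<bar> / rad t)"
  proof -
    have "distr (distr M borel (X (T - t))) borel (\<lambda>y. z + y) = distr M borel (\<lambda>\<omega>. z + X (T - t) \<omega>)"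
      by (subst distr_distr) (auto simp: comp_def)
    moreover have "c\<^sub>X * \<bar>z\<bar> * (T - t) powr (- 1 / \<beta>) = c\<^sub>X * \<bar>z\<bar> / rad t"
      unfolding rad_def by (simp add: powr_minus divide_inverse)
    ultimately show ?thesis using X_U z s unfolding U_tv_def by fastforce
  qed
  have int: "integrable (distr M borel (X (T - t))) (\<lambda>y. f (x + y))" for x
    using f s by (subst integrable_distr_eq) (auto simp: admissible_def)
  have "quot f t x z = ((\<integral>y. f (x + z + y) \<partial>distr M borel (X (T - t))) - (\<integral>y. f (x + y) \<partial>distr M borel (X (T - t)))) / z"
    using f t False by (simp add: quot_def F_eq_integral_distr)
  then show ?thesis
    unfolding K_const_def using t s c\<^sub>X_pos False tv int
    by (simp only:) (intro difference_quotient_le_kernel_bound; auto intro!: prob_space_X rad_pos)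
qed (simp add: quot_def)

lemma AE_support: "AE z in \<rho>. z \<in> measure_support \<rho>"
  by (rule AE_measure_support[OF sets_\<rho>])

lemma nn_integral_kernel_le:
  assumes "t < T"
  shows "(\<integral>\<^sup>+z. kernel_bound K_const f (rad t) z \<partial>\<rho>) \<le> ennreal D_const * dyadic_K \<epsilon> f (rad t)"
  unfolding D_const_def
proof (rule nn_integral_kernel_bound_le)
  show "\<rho> \<in> U_small_ball \<epsilon> (max c\<^sub>\<rho> 1)"
    unfolding U_small_ball_def
  proof (intro CollectI ballI)
    fix d :: real assume "d \<in> {0..1}"
    define p where "p = (if d = 0 \<and> \<epsilon> = 0 then 1 else d powr \<epsilon>)"
    have "measure \<rho> {-d..d} \<le> c\<^sub>\<rho> * p"
      using \<rho>_U \<open>d \<in> {0..1}\<close> by (simp add: U_small_ball_def p_def)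
    also have "\<dots> \<le> max c\<^sub>\<rho> 1 * p" by (intro mult_right_mono) (auto simp: p_def)
    finally show "measure \<rho> {-d..d} \<le> max c\<^sub>\<rho> 1 * (if d = 0 \<and> \<epsilon> = 0 then 1 else d powr \<epsilon>)"
      unfolding p_def .
  qed
qed (use assms K_const_pos rad_pos \<epsilon>_nonneg sets_\<rho> R.prob_space_axioms in auto)

lemma quot_measurable [measurable]:
  assumes "admissible f" "t \<in> {0..T}"
  shows "(\<lambda>p. quot f t (fst p) (snd p)) \<in> borel_measurable (borel \<Otimes>\<^sub>M borel)"
proof -
  note [measurable] = F_measurable[OF assms]
  show ?thesis unfolding quot_def by measurable
qed

lemma D_measurable [measurable]:
  assumes "admissible f" "t \<in> {0..T}"
  shows "D f t \<in> borel_measurable borel"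
proof -
  note [measurable] = quot_measurable[OF assms]
  have "(\<lambda>x. \<integral>z. quot f t x z \<partial>\<rho>) \<in> borel_measurable borel"
    by (rule R.borel_measurable_lebesgue_integral) (simp add: split_beta')
  then show ?thesis by (simp add: D_eq_quot[abs_def])
qed

lemma abs_D_le:
  assumes "admissible f" "t \<in> {0..<T}"
  shows "ennreal \<bar>D f t x\<bar> \<le> ennreal D_const * dyadic_K \<epsilon> f (rad t)"
proof -
  have "ennreal \<bar>D f t x\<bar> \<le> (\<integral>\<^sup>+z. ennreal \<bar>quot f t x z\<bar> \<partial>\<rho>)"
  proof (cases "integrable \<rho> (quot f t x)")
    case True
    then show ?thesis using integral_norm_bound_ennreal[OF True] by (simp add: D_eq_quot)
  next
    \<comment> \<open>The Bochner integral defaults to 0 here, so the bound is trivial and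
      integrability need not be settled beforehand.\<close>
    case False
    then show ?thesis by (simp add: D_eq_quot not_integrable_integral_eq)
  qed
  also have "\<dots> \<le> (\<integral>\<^sup>+z. kernel_bound K_const f (rad t) z \<partial>\<rho>)"
    using AE_support by (intro nn_integral_mono_AE) (auto elim!: eventually_mono intro: quot_le_kernel_bound assms)
  also have "\<dots> \<le> ennreal D_const * dyadic_K \<epsilon> f (rad t)"
    using assms by (intro nn_integral_kernel_le) auto
  finally show ?thesis .
qed

section \<open>Semigroup and martingale identities for F and D\<close>

lemma F_semigroup:
  assumes f: "admissible f" and uv: "0 \<le> u" "u \<le> v" "v \<le> T"
  shows "integrable (distr M borel (X (v - u))) (\<lambda>y. F f v (x + y))"
    and "(\<integral>y. F f v (x + y) \<partial>distr M borel (X (v - u))) = F f u x"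
proof -
  have eq: "v - u + (T - v) = T - u" by simp
  have int: "integrable M (\<lambda>\<omega>. f (x + X (v - u + (T - v)) \<omega>))"
    using f uv by (simp add: admissible_def)
  note conv = integral_convolution[of "v - u" "T - v" f x, OF _ _ _ admissible_measurable[OF f] int]
  show "integrable (distr M borel (X (v - u))) (\<lambda>y. F f v (x + y))"
    using conv(1) uv f by (simp add: F_eq_integral_distr)
  show "(\<integral>y. F f v (x + y) \<partial>distr M borel (X (v - u))) = F f u x"
    using conv(2) uv f unfolding F_sem_def[of _ _ _ _ u] by (simp add: F_eq_integral_distr)
qed

text \<open>D is built from differences of translates, which commute with convolution by the law of
  an increment. The exchange of integrals is licensed by \<open>kernel_bound\<close> at time v: it
  is constant in y and has finite \<rho>-integral by \<open>fin\<close>.\<close>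

lemma D_semigroup:
  assumes f: "admissible f" and uv: "0 \<le> u" "u \<le> v" "v < T"
    and fin: "dyadic_K \<epsilon> f (rad v) < \<infinity>"
  shows "(\<integral>y. D f v (x + y) \<partial>distr M borel (X (v - u))) = D f u x"
proof -
  define \<mu> where "\<mu> = distr M borel (X (v - u))"
  interpret P: prob_space \<mu> unfolding \<mu>_def using uv by (intro prob_space_X) auto
  have [measurable_cong]: "sets \<mu> = sets borel" by (simp add: \<mu>_def)
  interpret PR: pair_prob_space \<mu> \<rho> ..
  have [measurable]: "(\<lambda>p. quot f v (fst p) (snd p)) \<in> borel_measurable (borel \<Otimes>\<^sub>M borel)"
    using uv by (intro quot_measurable f) auto
  have meas: "(\<lambda>(y, z). quot f v (x + y) z) \<in> borel_measurable (\<mu> \<Otimes>\<^sub>M \<rho>)"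
  proof -
    have "(\<lambda>p. quot f v (fst (x + fst p, snd p)) (snd (x + fst p, snd p))) \<in> borel_measurable (\<mu> \<Otimes>\<^sub>M \<rho>)"
      by measurable
    then show ?thesis by (simp add: split_beta')
  qed
  have "integrable (\<mu> \<Otimes>\<^sub>M \<rho>) (\<lambda>(y, z). quot f v (x + y) z)"
  proof (rule integrableI_bounded[OF meas])
    have "(\<integral>\<^sup>+p. ennreal (norm (case p of (y, z) \<Rightarrow> quot f v (x + y) z)) \<partial>(\<mu> \<Otimes>\<^sub>M \<rho>))
        = (\<integral>\<^sup>+y. \<integral>\<^sup>+z. ennreal \<bar>quot f v (x + y) z\<bar> \<partial>\<rho> \<partial>\<mu>)"
      using meas by (subst R.nn_integral_fst[symmetric]) auto
    also have "\<dots> \<le> (\<integral>\<^sup>+y. \<integral>\<^sup>+z. kernel_bound K_const f (rad v) z \<partial>\<rho> \<partial>\<mu>)"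
      using AE_support uv
      by (intro nn_integral_mono nn_integral_mono_AE) (auto elim!: eventually_mono intro: quot_le_kernel_bound f)
    also have "\<dots> = (\<integral>\<^sup>+z. kernel_bound K_const f (rad v) z \<partial>\<rho>)"
      by (simp add: P.emeasure_space_1)
    also have "\<dots> \<le> ennreal D_const * dyadic_K \<epsilon> f (rad v)"
      using uv by (intro nn_integral_kernel_le)
    also have "\<dots> < \<infinity>" using fin by (simp add: ennreal_mult_less_top)
    finally show "(\<integral>\<^sup>+p. ennreal (norm (case p of (y, z) \<Rightarrow> quot f v (x + y) z)) \<partial>(\<mu> \<Otimes>\<^sub>M \<rho>)) < \<infinity>" .
  qed
  from PR.Fubini_integral[OF this]
  have "(\<integral>y. \<integral>z. quot f v (x + y) z \<partial>\<rho> \<partial>\<mu>) = (\<integral>z. \<integral>y. quot f v (x + y) z \<partial>\<mu> \<partial>\<rho>)" by simp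
  moreover have "(\<integral>y. quot f v (x + y) z \<partial>\<mu>) = quot f u x z" for z
  proof -
    note F = F_semigroup[OF f uv(1,2), of "x + z"] F_semigroup[OF f uv(1,2), of x]
    have "(\<integral>y. quot f v (x + y) z \<partial>\<mu>) = (\<integral>y. indicator (-{0}) z / z * (F f v (x + z + y) - F f v (x + y)) \<partial>\<mu>)"
      by (intro Bochner_Integration.integral_cong) (auto simp: quot_def ac_simps)
    also have "\<dots> = quot f u x z"
      using F uv by (simp add: quot_def \<mu>_def)
    finally show ?thesis .
  qed
  ultimately show ?thesis by (simp add: D_eq_quot \<mu>_def)
qed

text \<open>The martingale property in the form used for the BMO estimate: the past test variable is
  D at time u, restricted to A. Finiteness at both times makes both factors bounded.\<close>

lemma D_martingale_product:
  assumes f: "admissible f" and uv: "0 \<le> u" "u \<le> v" "v < T"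
    and fin: "dyadic_K \<epsilon> f (rad u) < \<infinity>" "dyadic_K \<epsilon> f (rad v) < \<infinity>"
    and A: "A \<in> sets (\<F> u)"
  shows "(\<integral>\<omega>. indicator A \<omega> * D f u (X u \<omega>) * D f v (X v \<omega>) \<partial>M)
    = (\<integral>\<omega>. indicator A \<omega> * (D f u (X u \<omega>))\<^sup>2 \<partial>M)"
proof -
  define b where "b t = enn2real (ennreal D_const * dyadic_K \<epsilon> f (rad t))" for t
  have D_le: "\<bar>D f t x\<bar> \<le> b t" if "dyadic_K \<epsilon> f (rad t) < \<infinity>" "t \<in> {0..<T}" for t x
  proof -
    have "ennreal \<bar>D f t x\<bar> \<le> ennreal (b t)"
      using abs_D_le[OF f that(2), of x] that(1) by (simp add: b_def ennreal_mult_less_top)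
    then show ?thesis by (simp add: b_def)
  qed
  note [measurable] = D_measurable[OF f]
  have [measurable]: "X u \<in> borel_measurable (\<F> u)" "A \<in> sets (\<F> u)"
    "D f u \<in> borel_measurable borel" "D f v \<in> borel_measurable borel"
    using uv A by (auto intro: X_adapted)
  have "(\<integral>\<omega>. (indicator A \<omega> * D f u (X u \<omega>)) * D f v (X v \<omega>) \<partial>M)
     = (\<integral>\<omega>. (indicator A \<omega> * D f u (X u \<omega>)) * (\<integral>y. D f v (X u \<omega> + y) \<partial>distr M borel (X (v - u))) \<partial>M)"
  proof (rule integral_mult_future[where A="b u" and B="b v"])
    show "\<bar>D f v x\<bar> \<le> b v" for x using fin uv by (intro D_le) auto
    show "\<bar>indicator A \<omega> * D f u (X u \<omega>)\<bar> \<le> b u" for \<omega>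
      using D_le[OF fin(1), of "X u \<omega>"] uv by (auto simp: abs_mult indicator_def intro: order_trans[OF abs_ge_zero])
  qed (use uv in auto)
  also have "\<dots> = (\<integral>\<omega>. indicator A \<omega> * (D f u (X u \<omega>))\<^sup>2 \<partial>M)"
    by (simp add: D_semigroup[OF f uv fin(2)] power2_eq_square mult.assoc)
  finally show ?thesis .
qed

text \<open>The K-functional bounds f by a multiple of |y| powr \<eta>, so a moment of order p \<ge>
  \<eta> makes all translates integrable.\<close>

lemma holder_space_admissible:
  assumes f: "f \<in> holder_space \<eta> q" and q: "0 < q" and \<eta>: "0 < \<eta>"
    and p: "\<eta> \<le> p" "\<And>t. t \<in> {0..T} \<Longrightarrow> integrable M (\<lambda>\<omega>. \<bar>X t \<omega>\<bar> powr p)"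
  shows "admissible f"
  unfolding admissible_def
proof (intro conjI ballI allI)
  show ne: "decomp f \<noteq> {}" using f by (rule holder_space_decomp)
  note [measurable] = decomp_measurable[OF ne]
  define C where "C = exp \<eta> * enn2real (holder_norm \<eta> q f)"
  have C0: "0 \<le> C" by (simp add: C_def)
  have fin: "holder_norm \<eta> q f < \<infinity>" using f by (simp add: holder_space_def)
  have f_le: "\<bar>f y\<bar> \<le> C * \<bar>y\<bar> powr \<eta>" for y
  proof (cases "y = 0")
    case True
    have "f 0 = 0" using ne by (auto simp: decomp_def Cb0_def Lip0_def)
    then show ?thesis using True C0 by simp
  next
    case False
    have "ennreal \<bar>f y\<bar> \<le> K_functional \<bar>y\<bar> f" by (rule abs_le_K_functional)
    also have "\<dots> = ennreal (\<bar>y\<bar> powr \<eta>) * weighted_K \<eta> f \<bar>y\<bar>"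
      unfolding weighted_K_def using False
      by (simp add: mult.assoc[symmetric] ennreal_mult[symmetric] powr_add[symmetric])
    also have "\<dots> \<le> ennreal (\<bar>y\<bar> powr \<eta>) * (ennreal (exp \<eta>) * holder_norm \<eta> q f)"
      using False q \<eta> by (intro mult_left_mono weighted_K_le_holder_norm) auto
    also have "\<dots> = ennreal (\<bar>y\<bar> powr \<eta>) * (ennreal (exp \<eta>) * ennreal (enn2real (holder_norm \<eta> q f)))"
      using fin by simp
    also have "\<dots> = ennreal (C * \<bar>y\<bar> powr \<eta>)"
      by (simp only: C_def ennreal_mult[symmetric] exp_ge_zero enn2real_nonneg powr_ge_zero mult_nonneg_nonneg)
        (simp add: ac_simps)
    finally show ?thesis using C0 by simp
  qed
  fix s x assume s: "s \<in> {0..T}"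
  have [measurable]: "X s \<in> borel_measurable M" using s by (rule X_measurable)
  \<comment> \<open>Raising the exponent from \<eta> to p is possible where |x + a| > 1; the summand
    1 covers the rest.\<close>
  have bound: "\<bar>x + a\<bar> powr \<eta> \<le> 1 + 2 powr p * (\<bar>x\<bar> powr p + \<bar>a\<bar> powr p)" for a
  proof (cases "\<bar>x + a\<bar> \<le> 1")
    case True
    then have "\<bar>x + a\<bar> powr \<eta> \<le> 1" using \<eta> by (simp add: powr_le1)
    then show ?thesis by (smt (verit) mult_nonneg_nonneg powr_ge_zero)
  next
    case False
    have "\<bar>x + a\<bar> powr \<eta> \<le> \<bar>x + a\<bar> powr p" using False p by (intro powr_mono) auto
    also have "\<dots> \<le> (2 * max \<bar>x\<bar> \<bar>a\<bar>) powr p"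
      using p \<eta> by (intro powr_mono2) auto
    also have "\<dots> = 2 powr p * max \<bar>x\<bar> \<bar>a\<bar> powr p" by (simp add: powr_mult)
    also have "\<dots> \<le> 2 powr p * (\<bar>x\<bar> powr p + \<bar>a\<bar> powr p)"
      by (intro mult_left_mono) (auto simp: max_def)
    finally show ?thesis by simp
  qed
  show "integrable M (\<lambda>\<omega>. f (x + X s \<omega>))"
  proof (rule Bochner_Integration.integrable_bound)
    show "integrable M (\<lambda>\<omega>. C * (1 + 2 powr p * (\<bar>x\<bar> powr p + \<bar>X s \<omega>\<bar> powr p)))"
      using p(2)[OF s] by simp
    show "AE \<omega> in M. norm (f (x + X s \<omega>)) \<le> norm (C * (1 + 2 powr p * (\<bar>x\<bar> powr p + \<bar>X s \<omega>\<bar> powr p)))"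
    proof (rule AE_I2)
      fix \<omega>
      have "\<bar>f (x + X s \<omega>)\<bar> \<le> C * \<bar>x + X s \<omega>\<bar> powr \<eta>" by (rule f_le)
      also have "\<dots> \<le> C * (1 + 2 powr p * (\<bar>x\<bar> powr p + \<bar>X s \<omega>\<bar> powr p))"
        using C0 bound by (intro mult_left_mono)
      finally show "norm (f (x + X s \<omega>)) \<le> norm (C * (1 + 2 powr p * (\<bar>x\<bar> powr p + \<bar>X s \<omega>\<bar> powr p)))"
        by simp
    qed
  qed measurable
qed

end

section \<open>Measurability of paths, second moments and conditional expectations\<close>

text \<open>\<open>cadlag_version\<close> ties \<phi> t to D only almost everywhere; completeness is
  what makes \<phi> t measurable.\<close>

lemma (in complete_measure) borel_measurable_AE_cong:
  fixes g h :: "'a \<Rightarrow> 'b::topological_space"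
  assumes g: "g \<in> borel_measurable M" and eq: "AE x in M. h x = g x"
  shows "h \<in> borel_measurable M"
proof (rule measurableI)
  fix B :: "'b set" assume "B \<in> sets borel"
  show "h -` B \<inter> space M \<in> sets M"
  proof (rule in_sets_AE[of "g -` B \<inter> space M"])
    show "AE x in M. (x \<in> g -` B \<inter> space M) = (x \<in> h -` B \<inter> space M)"
      using eq by eventually_elim auto
  qed (use measurable_sets[OF g \<open>B \<in> sets borel\<close>] in auto)
qed simp

text \<open>
  The process is evaluated at dyadic points that approach the time argument from the right.
\<close>
lemma right_continuous_jointly_measurable:
  fixes \<psi> :: "real \<Rightarrow> 'a \<Rightarrow> real"
  assumes meas: "\<And>u. u \<in> {0..<T} \<Longrightarrow> \<psi> u \<in> borel_measurable N"
    and cont: "\<And>u \<omega>. u \<in> {0..<T} \<Longrightarrow> \<omega> \<in> space N \<Longrightarrow> ((\<lambda>s. \<psi> s \<omega>) \<longlongrightarrow> \<psi> u \<omega>) (at u within ({0..<T} \<inter> {u<..}))"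
  shows "(\<lambda>p. if fst p \<in> {0..<T} then \<psi> (fst p) (snd p) else 0) \<in> borel_measurable (borel \<Otimes>\<^sub>M N)"
proof -
  define \<psi>' where "\<psi>' u \<omega> = (if u \<in> {0..<T} then \<psi> u \<omega> else 0)" for u \<omega>
  \<comment> \<open>Adding 1 after the floor makes the approximation strictly larger than u even at
    dyadic u, as the filter of right neighbourhoods requires. For fixed n only countably many values
    occur, which gives measurability.\<close>
  define a where "a n u = (real_of_int \<lfloor>u * 2 ^ n\<rfloor> + 1) / 2 ^ n" for n :: nat and u :: real
  have \<psi>'_meas: "\<psi>' u \<in> borel_measurable N" for u
    unfolding \<psi>'_def using meas by (cases "u \<in> {0..<T}") auto
  have a_gt: "u < a n u" for n u
  proof -
    have "u * 2 ^ n < real_of_int \<lfloor>u * 2 ^ n\<rfloor> + 1" by linarith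
    then show ?thesis by (simp add: a_def less_divide_eq)
  qed
  have a_le: "a n u \<le> u + (1 / 2) ^ n" for n u
  proof -
    have "real_of_int \<lfloor>u * 2 ^ n\<rfloor> + 1 \<le> (u + (1 / 2) ^ n) * 2 ^ n"
      by (simp add: distrib_right power_one_over)
    then show ?thesis by (simp add: a_def divide_le_eq)
  qed
  have a_lim: "(\<lambda>n. a n u) \<longlonglongrightarrow> u" for u
  proof (rule tendsto_sandwich[of "\<lambda>_. u" _ _ "\<lambda>n. u + (1 / 2) ^ n"])
    show "(\<lambda>n. u + (1 / 2) ^ n) \<longlonglongrightarrow> u"
      using tendsto_add[OF tendsto_const LIMSEQ_power_zero[of "1/2::real"], of u] by simp
  qed (auto intro!: always_eventually less_imp_le a_gt a_le)
  have "(\<lambda>p. \<psi>' (fst p) (snd p)) \<in> borel_measurable (borel \<Otimes>\<^sub>M N)"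
  proof (rule borel_measurable_LIMSEQ_real)
    fix n
    have "(\<lambda>p. (\<lambda>i p. \<psi>' ((real_of_int i + 1) / 2 ^ n) (snd p)) (\<lfloor>fst p * (2::real) ^ n\<rfloor>) p) \<in> borel_measurable (borel \<Otimes>\<^sub>M N)"
    proof (rule measurable_compose_countable[where g="\<lambda>p. \<lfloor>fst p * (2::real) ^ n\<rfloor>"
          and f="\<lambda>i p. \<psi>' ((real_of_int i + 1) / 2 ^ n) (snd p)"])
      show "(\<lambda>p. \<psi>' ((real_of_int i + 1) / 2 ^ n) (snd p)) \<in> borel_measurable (borel \<Otimes>\<^sub>M N)" for i
        by (rule measurable_compose[OF measurable_snd \<psi>'_meas])
    qed measurable
    then show "(\<lambda>p. \<psi>' (a n (fst p)) (snd p)) \<in> borel_measurable (borel \<Otimes>\<^sub>M N)"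
      by (simp add: a_def)
  next
    fix p assume "p \<in> space (borel \<Otimes>\<^sub>M N :: (real \<times> 'a) measure)"
    then obtain u \<omega> where p: "p = (u, \<omega>)" and \<omega>: "\<omega> \<in> space N" by (auto simp: space_pair_measure)
    have "(\<lambda>n. \<psi>' (a n u) \<omega>) \<longlonglongrightarrow> \<psi>' u \<omega>"
    proof (cases "u \<in> {0..<T}")
      case True
      have ev: "\<forall>\<^sub>F n in sequentially. a n u < T"
        using order_tendstoD(2)[OF a_lim, of u T] True by simp
      have "filterlim (\<lambda>n. a n u) (at u within ({0..<T} \<inter> {u<..})) sequentially"
        unfolding filterlim_at
      proof (intro conjI a_lim)
        show "\<forall>\<^sub>F n in sequentially. a n u \<in> {0..<T} \<inter> {u<..} \<and> a n u \<noteq> u"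
          using ev
        proof eventually_elim
          case (elim n)
          then show ?case using a_gt[of u n] True by auto
        qed
      qed
      from filterlim_compose[OF cont[OF True \<omega>] this]
      have "(\<lambda>n. \<psi> (a n u) \<omega>) \<longlonglongrightarrow> \<psi> u \<omega>" .
      moreover have "\<forall>\<^sub>F n in sequentially. \<psi> (a n u) \<omega> = \<psi>' (a n u) \<omega>"
        using ev
      proof eventually_elim
        case (elim n)
        then show ?case using a_gt[of u n] True by (auto simp: \<psi>'_def)
      qed
      ultimately have "(\<lambda>n. \<psi>' (a n u) \<omega>) \<longlonglongrightarrow> \<psi> u \<omega>" by (rule Lim_transform_eventually)
      then show ?thesis using True by (simp add: \<psi>'_def)
    next
      case False
      have "\<forall>\<^sub>F n in sequentially. a n u \<notin> {0..<T}"
      \<comment> \<open>For u < 0 the approximation may be nonnegative at small n, so the claim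
        holds only eventually; for u \<ge> T it holds for every n.\<close>
      proof (cases "u < 0")
        case True
        show ?thesis using order_tendstoD(2)[OF a_lim True] by eventually_elim auto
      next
        case nonneg: False
        show ?thesis
        proof (rule always_eventually, rule allI)
          show "a n u \<notin> {0..<T}" for n using a_gt[of u n] nonneg False by auto
        qed
      qed
      then have "\<forall>\<^sub>F n in sequentially. \<psi>' (a n u) \<omega> = 0"
        by eventually_elim (auto simp: \<psi>'_def)
      moreover have "\<psi>' u \<omega> = 0" using False by (auto simp: \<psi>'_def)
      ultimately show ?thesis by (simp add: tendsto_eventually)
    qed
    then show "(\<lambda>n. \<psi>' (a n (fst p)) (snd p)) \<longlonglongrightarrow> \<psi>' (fst p) (snd p)" by (simp add: p)
  qed
  then show ?thesis by (simp add: \<psi>'_def)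
qed

text \<open>Valid without integrability, since the Bochner integral then defaults to 0 and
  \<open>ennreal\<close> cuts negative values to 0. Mixed moments can thus be bounded without
  knowing their sign.\<close>

lemma ennreal_integral_le_nn_integral:
  "ennreal (\<integral>x. g x \<partial>N) \<le> (\<integral>\<^sup>+x. ennreal (g x) \<partial>N)"
proof (cases "integrable N g")
  case True
  then have "(\<integral>x. g x \<partial>N) \<le> (\<integral>x. max 0 (g x) \<partial>N)"
    by (intro integral_mono) auto
  then have "ennreal (\<integral>x. g x \<partial>N) \<le> ennreal (\<integral>x. max 0 (g x) \<partial>N)" by (rule ennreal_leI)
  also have "\<dots> = (\<integral>\<^sup>+x. ennreal (max 0 (g x)) \<partial>N)"
    using True by (intro nn_integral_eq_integral[symmetric]) auto
  finally show ?thesis by simp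
qed (simp add: not_integrable_integral_eq)

text \<open>Expanding the square yields the double integral of the mixed moments of h u and h v.
  Boundedness of h and finiteness of both measures justify every exchange.\<close>

lemma (in prob_space) nn_integral_square_of_integral_le:
  fixes h :: "real \<Rightarrow> 'a \<Rightarrow> real"
  assumes L: "finite_measure L" and sets_L: "sets L = sets borel"
    and h [measurable]: "(\<lambda>p. h (fst p) (snd p)) \<in> borel_measurable (borel \<Otimes>\<^sub>M M)"
    and B: "\<And>u \<omega>. \<omega> \<in> space M \<Longrightarrow> \<bar>h u \<omega>\<bar> \<le> B"
    and k: "\<And>u v. ennreal (\<integral>\<omega>. h u \<omega> * h v \<omega> \<partial>M) \<le> k u v"
  shows "(\<integral>\<^sup>+\<omega>. ennreal ((\<integral>u. h u \<omega> \<partial>L)\<^sup>2) \<partial>M) \<le> (\<integral>\<^sup>+u. \<integral>\<^sup>+v. k u v \<partial>L \<partial>L)"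
proof -
  interpret L: finite_measure L by fact
  note [measurable_cong] = sets_L
  interpret LM: pair_sigma_finite L M ..
  interpret LM: finite_measure "L \<Otimes>\<^sub>M M" by (rule finite_measure_pair_measure) unfold_locales
  have [measurable]: "h u \<in> borel_measurable M" for u
    using measurable_compose[OF measurable_Pair1' h, of u] by simp
  have h_u [measurable]: "(\<lambda>u. h u \<omega>) \<in> borel_measurable borel" if "\<omega> \<in> space M" for \<omega>
    using measurable_compose[OF measurable_Pair2' h, of \<omega>] that by simp
  obtain \<omega>0 where "\<omega>0 \<in> space M" using not_empty by auto
  then have B0: "0 \<le> B" using B[of \<omega>0 0] by linarith
  define N where "N \<omega> = (\<integral>u. h u \<omega> \<partial>L)" for \<omega>
  have [measurable]: "N \<in> borel_measurable M"
  proof -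
    have "(\<lambda>(\<omega>, u). h u \<omega>) \<in> borel_measurable (M \<Otimes>\<^sub>M borel)"
      using measurable_pair_swap[OF h] by (simp add: split_beta')
    then have "(\<lambda>(\<omega>, u). h u \<omega>) \<in> borel_measurable (M \<Otimes>\<^sub>M L)" by measurable
    then show ?thesis unfolding N_def[abs_def] by (rule L.borel_measurable_lebesgue_integral)
  qed
  define B' where "B' = B * measure L (space L)"
  have N_le: "\<bar>N \<omega>\<bar> \<le> B'" if "\<omega> \<in> space M" for \<omega>
  proof -
    have "\<bar>N \<omega>\<bar> \<le> (\<integral>u. \<bar>h u \<omega>\<bar> \<partial>L)" unfolding N_def by (rule integral_abs_bound)
    also have "\<dots> \<le> (\<integral>u. B \<partial>L)"
    proof (rule integral_mono)
      have "integrable L (\<lambda>u. h u \<omega>)"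
        using that B h_u[OF that] by (intro L.integrable_const_bound[where B=B] AE_I2) auto
      then show "integrable L (\<lambda>u. \<bar>h u \<omega>\<bar>)" by simp
    qed (use that B in auto)
    finally show ?thesis by (simp add: B'_def mult.commute)
  qed
  \<comment> \<open>Used with Z = N and then with Z = h u, which expands one factor of the square at
    a time.\<close>
  have swap: "(\<integral>\<omega>. (\<integral>u. h u \<omega> * Z \<omega> \<partial>L) \<partial>M) = (\<integral>u. (\<integral>\<omega>. h u \<omega> * Z \<omega> \<partial>M) \<partial>L)"
    if [measurable]: "Z \<in> borel_measurable M" and Z: "\<And>\<omega>. \<omega> \<in> space M \<Longrightarrow> \<bar>Z \<omega>\<bar> \<le> C" for Z C
  proof (rule LM.Fubini_integral)
    show "integrable (L \<Otimes>\<^sub>M M) (\<lambda>(u, \<omega>). h u \<omega> * Z \<omega>)"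
    proof (rule LM.integrable_const_bound[where B="B * C"])
      show "AE p in L \<Otimes>\<^sub>M M. norm (case p of (u, \<omega>) \<Rightarrow> h u \<omega> * Z \<omega>) \<le> B * C"
        using B0 B Z by (intro AE_I2) (auto simp: space_pair_measure abs_mult intro!: mult_mono)
    qed (simp add: split_beta')
  qed
  have int_sq: "integrable M (\<lambda>\<omega>. (N \<omega>)\<^sup>2)"
  proof (rule integrable_const_bound[where B="B'\<^sup>2"])
    show "AE \<omega> in M. norm ((N \<omega>)\<^sup>2) \<le> B'\<^sup>2"
      using power_mono[OF N_le abs_ge_zero, of _ 2] by (intro AE_I2) simp
  qed simp
  have "(\<integral>\<^sup>+\<omega>. ennreal ((N \<omega>)\<^sup>2) \<partial>M) = ennreal (\<integral>\<omega>. (N \<omega>)\<^sup>2 \<partial>M)"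
    using int_sq by (intro nn_integral_eq_integral) auto
  also have "(\<integral>\<omega>. (N \<omega>)\<^sup>2 \<partial>M) = (\<integral>\<omega>. (\<integral>u. h u \<omega> * N \<omega> \<partial>L) \<partial>M)"
    by (simp add: N_def power2_eq_square)
  also have "\<dots> = (\<integral>u. (\<integral>\<omega>. h u \<omega> * N \<omega> \<partial>M) \<partial>L)"
    by (rule swap[OF _ N_le]) auto
  also have "\<dots> = (\<integral>u. (\<integral>v. (\<integral>\<omega>. h u \<omega> * h v \<omega> \<partial>M) \<partial>L) \<partial>L)"
  proof (intro Bochner_Integration.integral_cong refl)
    fix u
    have "(\<integral>\<omega>. h u \<omega> * N \<omega> \<partial>M) = (\<integral>\<omega>. (\<integral>v. h v \<omega> * h u \<omega> \<partial>L) \<partial>M)"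
      by (simp add: N_def mult.commute)
    also have "\<dots> = (\<integral>v. (\<integral>\<omega>. h v \<omega> * h u \<omega> \<partial>M) \<partial>L)"
      by (rule swap[OF _ B]) auto
    finally show "(\<integral>\<omega>. h u \<omega> * N \<omega> \<partial>M) = (\<integral>v. (\<integral>\<omega>. h u \<omega> * h v \<omega> \<partial>M) \<partial>L)"
      by (simp add: mult.commute)
  qed
  also have "ennreal \<dots> \<le> (\<integral>\<^sup>+u. ennreal (\<integral>v. (\<integral>\<omega>. h u \<omega> * h v \<omega> \<partial>M) \<partial>L) \<partial>L)"
    by (rule ennreal_integral_le_nn_integral)
  also have "\<dots> \<le> (\<integral>\<^sup>+u. \<integral>\<^sup>+v. ennreal (\<integral>\<omega>. h u \<omega> * h v \<omega> \<partial>M) \<partial>L \<partial>L)"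
    by (intro nn_integral_mono ennreal_integral_le_nn_integral)
  also have "\<dots> \<le> (\<integral>\<^sup>+u. \<integral>\<^sup>+v. k u v \<partial>L \<partial>L)"
    by (intro nn_integral_mono k)
  finally show ?thesis by (simp add: N_def)
qed

text \<open>If g is not measurable or G is not a subalgebra, \<open>nn_cond_exp\<close> is 0 by
  definition. The test on sets of G may therefore assume the subalgebra, and an application does not
  have to establish measurability of the increment at a stopping time.\<close>

lemma (in prob_space) nn_cond_exp_le_const:
  assumes "\<And>A. subalgebra M G \<Longrightarrow> A \<in> sets G \<Longrightarrow> (\<integral>\<^sup>+\<omega>\<in>A. g \<omega> \<partial>M) \<le> ennreal c * emeasure M A"
    and c: "0 \<le> c"
  shows "AE \<omega> in M. nn_cond_exp M G g \<omega> \<le> ennreal c"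
proof (cases "g \<in> borel_measurable M \<and> subalgebra M G")
  case False
  then have "nn_cond_exp M G g = (\<lambda>_. 0)" unfolding nn_cond_exp_def by (rule if_not_P)
  then show ?thesis by simp
next
  case True
  then have [measurable]: "g \<in> borel_measurable M" and sub: "subalgebra M G" by auto
  interpret G: finite_measure_subalgebra M G by unfold_locales fact
  define E where "E = nn_cond_exp M G g"
  have [measurable]: "E \<in> borel_measurable G" "E \<in> borel_measurable M" unfolding E_def by auto
  \<comment> \<open>Testing on the event that E is at least c + 1 / Suc n forces that event to be
    null.\<close>
  have null: "{\<omega> \<in> space M. ennreal (c + 1 / Suc n) \<le> E \<omega>} \<in> null_sets M" for n
  proof -
    define A where "A = {\<omega> \<in> space M. ennreal (c + 1 / Suc n) \<le> E \<omega>}"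
    have "A = {\<omega> \<in> space G. ennreal (c + 1 / Suc n) \<le> E \<omega>}"
      using sub by (simp add: A_def subalgebra_def)
    then have A [measurable]: "A \<in> sets G" by simp
    then have AM [measurable]: "A \<in> sets M" using sub by (auto simp: subalgebra_def)
    have "ennreal (c + 1 / Suc n) * emeasure M A = (\<integral>\<^sup>+\<omega>\<in>A. ennreal (c + 1 / Suc n) \<partial>M)"
      by (simp add: nn_integral_cmult_indicator)
    also have "\<dots> \<le> (\<integral>\<^sup>+\<omega>. indicator A \<omega> * E \<omega> \<partial>M)"
      by (intro nn_integral_mono) (auto simp: A_def split: split_indicator)
    also have "\<dots> = (\<integral>\<^sup>+\<omega>. indicator A \<omega> * g \<omega> \<partial>M)"
      unfolding E_def by (rule G.nn_cond_exp_intg) auto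
    also have "\<dots> \<le> ennreal c * emeasure M A"
      using assms(1)[OF sub A] by (simp add: mult.commute)
    finally have "ennreal ((c + 1 / Suc n) * prob A) \<le> ennreal (c * prob A)"
      by (simp only: emeasure_eq_measure ennreal_mult''[OF measure_nonneg])
    then have "(c + 1 / Suc n) * prob A \<le> c * prob A" using c by (simp only: ennreal_le_iff mult_nonneg_nonneg measure_nonneg)
    then have "prob A \<le> 0" by (simp add: distrib_right divide_le_0_iff)
    then have "prob A = 0" using measure_nonneg[of M A] by linarith
    then have "emeasure M A = 0" by (simp add: emeasure_eq_measure)
    then show ?thesis using AM unfolding A_def by blast
  qed
  have "AE \<omega> in M. \<forall>n. \<not> ennreal (c + 1 / Suc n) \<le> E \<omega>"
    unfolding AE_all_countable using AE_not_in[OF null] by (auto elim: eventually_mono)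
  then have "AE \<omega> in M. E \<omega> \<le> ennreal c"
  proof eventually_elim
    case (elim \<omega>)
    show ?case
    proof (rule ccontr)
      assume gt: "\<not> E \<omega> \<le> ennreal c"
      have "E \<omega> \<noteq> \<top>" using elim[rule_format, of 0] by auto
      then obtain e where e: "E \<omega> = ennreal e" "0 \<le> e" by (cases "E \<omega>") auto
      then have "0 < e - c" using gt c by (simp add: ennreal_le_iff)
      then obtain n where "1 / Suc n < e - c" using nat_approx_posE by blast
      then have "ennreal (c + 1 / Suc n) \<le> E \<omega>" using e by (simp add: ennreal_leI)
      then show False using elim by blast
    qed
  qed
  then show ?thesis unfolding E_def .
qed

text \<open>For \<alpha> < 1 and b = T the weight is singular at the right end. The primitive is
  continuous there all the same, so a fundamental theorem with derivatives in the open interval is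
  used.\<close>

lemma nn_integral_powr_weight:
  fixes T \<alpha> :: real
  assumes "0 < \<alpha>" "a \<le> b" "b \<le> T"
  shows "(\<integral>\<^sup>+u\<in>{a..b}. ennreal ((T - u) powr (\<alpha> - 1)) \<partial>lborel) = ennreal (((T - a) powr \<alpha> - (T - b) powr \<alpha>) / \<alpha>)"
proof -
  have "((\<lambda>u. (T - u) powr (\<alpha> - 1)) has_integral (- ((T - b) powr \<alpha> / \<alpha>) - (- ((T - a) powr \<alpha> / \<alpha>)))) {a..b}"
  proof (rule fundamental_theorem_of_calculus_interior[OF \<open>a \<le> b\<close>])
    show "continuous_on {a..b} (\<lambda>u. - ((T - u) powr \<alpha> / \<alpha>))"
      using assms by (intro continuous_intros continuous_on_powr') auto
    fix x assume "x \<in> {a<..<b}"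
    then show "((\<lambda>u. - ((T - u) powr \<alpha> / \<alpha>)) has_vector_derivative (T - x) powr (\<alpha> - 1)) (at x)"
      using assms unfolding has_real_derivative_iff_has_vector_derivative[symmetric]
      by (auto intro!: derivative_eq_intros)
  qed
  also have "- ((T - b) powr \<alpha> / \<alpha>) - (- ((T - a) powr \<alpha> / \<alpha>)) = ((T - a) powr \<alpha> - (T - b) powr \<alpha>) / \<alpha>"
    by (simp add: diff_divide_distrib)
  finally have "(\<integral>\<^sup>+u. ennreal (indicator {a..b} u * (T - u) powr (\<alpha> - 1)) \<partial>lborel)
      = ennreal (((T - a) powr \<alpha> - (T - b) powr \<alpha>) / \<alpha>)"
    by (intro nn_integral_has_integral_lebesgue) auto
  moreover have "(\<integral>\<^sup>+u\<in>{a..b}. ennreal ((T - u) powr (\<alpha> - 1)) \<partial>lborel)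
      = (\<integral>\<^sup>+u. ennreal (indicator {a..b} u * (T - u) powr (\<alpha> - 1)) \<partial>lborel)"
    by (intro nn_integral_cong) (auto split: split_indicator)
  ultimately show ?thesis by simp
qed

lemma powr_weight_integral:
  fixes T \<alpha> :: real
  assumes "0 < \<alpha>" "a \<le> b" "b \<le> T"
  shows "set_integrable lborel {a..b} (\<lambda>u. (T - u) powr (\<alpha> - 1))"
    and "(LINT u:{a..b}|lborel. (T - u) powr (\<alpha> - 1)) = ((T - a) powr \<alpha> - (T - b) powr \<alpha>) / \<alpha>"
proof -
  have nn: "(\<integral>\<^sup>+u. ennreal (indicator {a..b} u *\<^sub>R (T - u) powr (\<alpha> - 1)) \<partial>lborel) = ennreal (((T - a) powr \<alpha> - (T - b) powr \<alpha>) / \<alpha>)"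
    unfolding nn_integral_powr_weight[OF assms, symmetric]
    by (intro nn_integral_cong) (auto split: split_indicator)
  have "0 \<le> ((T - a) powr \<alpha> - (T - b) powr \<alpha>) / \<alpha>"
    using assms by (intro divide_nonneg_pos) (auto intro!: powr_mono2)
  then have "has_bochner_integral lborel (\<lambda>u. indicator {a..b} u *\<^sub>R (T - u) powr (\<alpha> - 1)) (((T - a) powr \<alpha> - (T - b) powr \<alpha>) / \<alpha>)"
    using nn by (intro has_bochner_integral_nn_integral) auto
  then show "set_integrable lborel {a..b} (\<lambda>u. (T - u) powr (\<alpha> - 1))"
    "(LINT u:{a..b}|lborel. (T - u) powr (\<alpha> - 1)) = ((T - a) powr \<alpha> - (T - b) powr \<alpha>) / \<alpha>"
    unfolding set_integrable_def set_lebesgue_integral_def by (auto simp: has_bochner_integral_iff)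
qed

section \<open>The Riemann--Liouville operator along a path\<close>

lemma riemann_liouville_jump_le:
  fixes T \<alpha> :: real
  assumes \<alpha>: "0 < \<alpha>" and st: "0 \<le> \<sigma>" "\<sigma> \<le> t" "t < T"
    and k: "cadlag_on {0..<T} k" and bound: "\<And>u. u \<in> {0..<T} \<Longrightarrow> \<bar>k u\<bar> * (T - u) powr \<alpha> \<le> c"
    and meas: "(\<lambda>u. if u \<in> {0..<T} then k u else 0) \<in> borel_measurable borel"
  shows "\<bar>(riemann_liouville T \<alpha> k t - k 0) - left_lim (\<lambda>s. riemann_liouville T \<alpha> k s - k 0) \<sigma>\<bar>
    \<le> T powr (- \<alpha>) * (\<alpha> * \<bar>\<integral>u. indicator {\<sigma>..t} u * ((T - u) powr (\<alpha> - 1) * k u) \<partial>lborel\<bar> + 2 * c)"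
proof -
  define w where "w u = (T - u) powr (\<alpha> - 1)" for u
  \<comment> \<open>Outside [0,T) the path is arbitrary; extending it by 0 supplies measurability on
    the whole line.\<close>
  define k' where "k' u = (if u \<in> {0..<T} then k u else 0)" for u
  define N where "N s = (\<integral>u. indicator {0..s} u * (w u * k u) \<partial>lborel)" for s
  define R where "R s = k s * (T - s) powr \<alpha>" for s
  have T: "0 < T" using st by simp
  have [measurable]: "k' \<in> borel_measurable borel" using meas unfolding k'_def .
  have [measurable]: "w \<in> borel_measurable borel" unfolding w_def by measurable
  have c: "0 \<le> c"
  proof -
    have "0 \<le> \<bar>k 0\<bar> * (T - 0) powr \<alpha>" by simp
    also have "\<dots> \<le> c" using T by (intro bound) auto
    finally show ?thesis .
  qed
  \<comment> \<open>Up to b < T the weighted path is bounded, since w u is (T - u) powr \<alpha>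
    divided by T - u \<ge> T - b.\<close>
  have wk_le: "\<bar>w u * k u\<bar> \<le> c / (T - b)" if "u \<in> {0..b}" "b < T" for u b
  proof -
    have "w u = (T - u) powr \<alpha> / (T - u)" using that by (simp add: w_def powr_diff)
    then have "\<bar>w u * k u\<bar> = (\<bar>k u\<bar> * (T - u) powr \<alpha>) / (T - u)"
      using that by (simp add: abs_mult)
    also have "\<dots> \<le> c / (T - b)" using that bound[of u] c by (intro frac_le) auto
    finally show ?thesis .
  qed
  have int_wk: "integrable lborel (\<lambda>u. indicator {a..b} u * (w u * k u))" if "0 \<le> a" "b < T" for a b
  proof (rule Bochner_Integration.integrable_bound)
    show "integrable lborel (\<lambda>u. indicator {a..b} u * (c / (T - b)))"
      by (intro integrable_mult_left integrable_real_indicator) (auto simp: emeasure_lborel_Icc_eq)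
    have "(\<lambda>u. indicator {a..b} u * (w u * k u)) = (\<lambda>u. indicator {a..b} u * (w u * k' u))"
      using that by (auto simp: k'_def indicator_def)
    then show "(\<lambda>u. indicator {a..b} u * (w u * k u)) \<in> borel_measurable lborel" by simp
    show "AE u in lborel. norm (indicator {a..b} u * (w u * k u)) \<le> norm (indicator {a..b} u * (c / (T - b)))"
    proof (rule AE_I2)
      fix u show "norm (indicator {a..b} u * (w u * k u)) \<le> norm (indicator {a..b} u * (c / (T - b)))"
        using wk_le[of u b] that c by (cases "u \<in> {a..b}") auto
    qed
  qed
  have N_diff: "N v - N s = (\<integral>u. indicator {s..v} u * (w u * k u) \<partial>lborel)" if "0 \<le> s" "s \<le> v" "v < T" for s v
  proof -
    have "N v = (\<integral>u. indicator {0..s} u * (w u * k u) + indicator {s..v} u * (w u * k u) \<partial>lborel)"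
      unfolding N_def
    proof (rule integral_cong_AE)
      show "AE u in lborel. indicator {0..v} u * (w u * k u) = indicator {0..s} u * (w u * k u) + indicator {s..v} u * (w u * k u)"
        using AE_lborel_singleton[of s] by eventually_elim (use that in \<open>auto simp: indicator_def\<close>)
    qed (use that int_wk in \<open>auto intro!: borel_measurable_integrable\<close>)
    also have "\<dots> = N s + (\<integral>u. indicator {s..v} u * (w u * k u) \<partial>lborel)"
      unfolding N_def using that by (intro Bochner_Integration.integral_add int_wk) auto
    finally show ?thesis by simp
  qed
  \<comment> \<open>On [s,T] the path is frozen at k s and the weight integrates to (T - s) powr
    \<alpha> / \<alpha>; the prefactor \<alpha> of the operator cancels the division.\<close>
  have RL: "riemann_liouville T \<alpha> k s = T powr (- \<alpha>) * (\<alpha> * N s + R s)" if s: "0 \<le> s" "s < T" for s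
  proof -
    have wi: "integrable lborel (\<lambda>u. indicator {s..T} u * w u)"
      "(\<integral>u. indicator {s..T} u * w u \<partial>lborel) = (T - s) powr \<alpha> / \<alpha>"
      using powr_weight_integral[OF \<alpha>, of s T T] s
      unfolding w_def set_integrable_def set_lebesgue_integral_def by simp_all
    have "(LINT u:{0..T}|lborel. (T - u) powr (\<alpha> - 1) * k (min u s))
        = (\<integral>u. indicator {0..s} u * (w u * k u) + indicator {s..T} u * w u * k s \<partial>lborel)"
      unfolding set_lebesgue_integral_def
    proof (rule integral_cong_AE)
      have "(\<lambda>u. indicator {0..T} u *\<^sub>R ((T - u) powr (\<alpha> - 1) * k (min u s)))
          = (\<lambda>u. indicator {0..T} u * (w u * k' (min u s)))"
        using s by (auto simp: w_def k'_def indicator_def fun_eq_iff)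
      then show "(\<lambda>u. indicator {0..T} u *\<^sub>R ((T - u) powr (\<alpha> - 1) * k (min u s))) \<in> borel_measurable lborel"
        by simp
      show "(\<lambda>u. indicator {0..s} u * (w u * k u) + indicator {s..T} u * w u * k s) \<in> borel_measurable lborel"
        using int_wk[of 0 s] wi(1) s by (intro borel_measurable_add) auto
      show "AE u in lborel. indicator {0..T} u *\<^sub>R ((T - u) powr (\<alpha> - 1) * k (min u s))
          = indicator {0..s} u * (w u * k u) + indicator {s..T} u * w u * k s"
        using AE_lborel_singleton[of s] by eventually_elim (use s in \<open>auto simp: indicator_def w_def min_def\<close>)
    qed
    also have "\<dots> = N s + (T - s) powr \<alpha> / \<alpha> * k s"
      unfolding N_def wi(2)[symmetric] using s wi(1)
      by (subst Bochner_Integration.integral_add) (auto intro!: int_wk)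
    finally show ?thesis
      using \<alpha> T by (simp add: riemann_liouville_def R_def powr_minus field_simps)
  qed
  have R_le: "\<bar>R s\<bar> \<le> c" if "s \<in> {0..<T}" for s
    using bound[OF that] by (simp add: R_def abs_mult)
  have "\<exists>r. \<bar>r\<bar> \<le> c \<and> left_lim (\<lambda>s. riemann_liouville T \<alpha> k s - k 0) \<sigma> = T powr (- \<alpha>) * (\<alpha> * N \<sigma> + r) - k 0"
  proof (cases "\<sigma> = 0")
    \<comment> \<open>By convention the left limit at 0 is the value at 0, hence r = R 0.\<close>
    case True
    then show ?thesis using RL[of 0] R_le[of 0] T by (intro exI[of _ "R 0"]) (auto simp: left_lim_def)
  next
    case False
    then have \<sigma>: "0 < \<sigma>" "\<sigma> < T" using st by auto
    obtain l where "(k \<longlongrightarrow> l) (at \<sigma> within ({0..<T} \<inter> {..<\<sigma>}))"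
      using k \<sigma> unfolding cadlag_on_def by fastforce
    moreover have "at \<sigma> within ({0..<T} \<inter> {..<\<sigma>}) = at_left \<sigma>"
      using \<sigma> by (intro at_within_nhd[of \<sigma> "{0<..}"]) auto
    ultimately have l: "(k \<longlongrightarrow> l) (at_left \<sigma>)" by simp
    have ev: "\<forall>\<^sub>F s in at_left \<sigma>. s \<in> {0<..<\<sigma>}" by (rule eventually_at_left_real[OF \<sigma>(1)])
    define r where "r = l * (T - \<sigma>) powr \<alpha>"
    have R_lim: "(R \<longlongrightarrow> r) (at_left \<sigma>)"
      unfolding R_def r_def using \<sigma> l by (intro tendsto_intros) auto
    have r: "\<bar>r\<bar> \<le> c"
    proof (rule tendsto_upperbound)
      show "((\<lambda>s. \<bar>R s\<bar>) \<longlongrightarrow> \<bar>r\<bar>) (at_left \<sigma>)" using R_lim by (rule tendsto_rabs)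
      show "\<forall>\<^sub>F s in at_left \<sigma>. \<bar>R s\<bar> \<le> c"
        using ev by eventually_elim (use \<sigma> R_le in auto)
    qed simp
    have "((\<lambda>s. N \<sigma> - N s) \<longlongrightarrow> 0) (at_left \<sigma>)"
    proof (rule Lim_null_comparison)
      show "\<forall>\<^sub>F s in at_left \<sigma>. norm (N \<sigma> - N s) \<le> (\<sigma> - s) * (c / (T - \<sigma>))"
        using ev
      proof eventually_elim
        case (elim s)
        then have s: "0 \<le> s" "s \<le> \<sigma>" by auto
        have "norm (N \<sigma> - N s) \<le> (\<integral>u. \<bar>indicator {s..\<sigma>} u * (w u * k u)\<bar> \<partial>lborel)"
          unfolding N_diff[OF s \<sigma>(2)] real_norm_def by (rule integral_abs_bound)
        also have "\<dots> \<le> (\<integral>u. indicator {s..\<sigma>} u * (c / (T - \<sigma>)) \<partial>lborel)"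
        proof (rule integral_mono)
          show "integrable lborel (\<lambda>u. \<bar>indicator {s..\<sigma>} u * (w u * k u)\<bar>)"
            using s \<sigma> by (intro integrable_abs int_wk)
          show "integrable lborel (\<lambda>u. indicator {s..\<sigma>} u * (c / (T - \<sigma>)))"
            by (intro integrable_mult_left integrable_real_indicator) (auto simp: emeasure_lborel_Icc_eq)
          show "\<bar>indicator {s..\<sigma>} u * (w u * k u)\<bar> \<le> indicator {s..\<sigma>} u * (c / (T - \<sigma>))" for u
            using wk_le[of u \<sigma>] s \<sigma> by (cases "u \<in> {s..\<sigma>}") auto
        qed
        also have "\<dots> = (\<sigma> - s) * (c / (T - \<sigma>))" using s by simp
        finally show ?case .
      qed
      have "((\<lambda>s. (\<sigma> - s) * (c / (T - \<sigma>))) \<longlongrightarrow> (\<sigma> - \<sigma>) * (c / (T - \<sigma>))) (at_left \<sigma>)"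
        using \<sigma> by (intro tendsto_intros) auto
      then show "((\<lambda>s. (\<sigma> - s) * (c / (T - \<sigma>))) \<longlongrightarrow> 0) (at_left \<sigma>)" by simp
    qed
    then have "((\<lambda>s. N \<sigma> - (N \<sigma> - N s)) \<longlongrightarrow> N \<sigma> - 0) (at_left \<sigma>)" by (intro tendsto_intros)
    then have N_lim: "(N \<longlongrightarrow> N \<sigma>) (at_left \<sigma>)" by simp
    have "((\<lambda>s. T powr (- \<alpha>) * (\<alpha> * N s + R s) - k 0) \<longlongrightarrow> T powr (- \<alpha>) * (\<alpha> * N \<sigma> + r) - k 0) (at_left \<sigma>)"
      by (intro tendsto_intros N_lim R_lim)
    moreover have "\<forall>\<^sub>F s in at_left \<sigma>. T powr (- \<alpha>) * (\<alpha> * N s + R s) - k 0 = riemann_liouville T \<alpha> k s - k 0"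
      using ev by eventually_elim (use \<sigma> RL in auto)
    ultimately have "((\<lambda>s. riemann_liouville T \<alpha> k s - k 0) \<longlongrightarrow> T powr (- \<alpha>) * (\<alpha> * N \<sigma> + r) - k 0) (at_left \<sigma>)"
      by (rule Lim_transform_eventually)
    then have "Lim (at_left \<sigma>) (\<lambda>s. riemann_liouville T \<alpha> k s - k 0) = T powr (- \<alpha>) * (\<alpha> * N \<sigma> + r) - k 0"
      by (intro tendsto_Lim) auto
    then show ?thesis using r \<sigma> by (intro exI[of _ r]) (auto simp: left_lim_def)
  qed
  then obtain r where r: "\<bar>r\<bar> \<le> c"
    "left_lim (\<lambda>s. riemann_liouville T \<alpha> k s - k 0) \<sigma> = T powr (- \<alpha>) * (\<alpha> * N \<sigma> + r) - k 0" by blast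
  have "(riemann_liouville T \<alpha> k t - k 0) - left_lim (\<lambda>s. riemann_liouville T \<alpha> k s - k 0) \<sigma>
      = T powr (- \<alpha>) * (\<alpha> * (N t - N \<sigma>) + (R t - r))"
    unfolding r(2) using RL[of t] st by (simp add: algebra_simps)
  also have "\<bar>\<dots>\<bar> \<le> T powr (- \<alpha>) * (\<alpha> * \<bar>N t - N \<sigma>\<bar> + 2 * c)"
  proof -
    have "\<bar>\<alpha> * (N t - N \<sigma>) + (R t - r)\<bar> \<le> \<bar>\<alpha> * (N t - N \<sigma>)\<bar> + 2 * c"
      using R_le[of t] r(1) st by (simp add: abs_le_iff) linarith
    also have "\<bar>\<alpha> * (N t - N \<sigma>)\<bar> = \<alpha> * \<bar>N t - N \<sigma>\<bar>" using \<alpha> by (simp add: abs_mult)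
    finally show ?thesis by (simp add: abs_mult mult_left_mono)
  qed
  finally show ?thesis unfolding N_diff[OF st] w_def .
qed

text \<open>A strict violation at u would persist on an interval to the right of u, which contains a
  rational. This turns countably many almost sure bounds into one for all times.\<close>

lemma cadlag_on_bound_from_rationals:
  assumes k: "cadlag_on {0..<T} k" and g: "continuous_on {0..<T} g"
    and rat: "\<And>q. q \<in> \<rat> \<inter> {0..<T} \<Longrightarrow> \<bar>k q\<bar> * g q \<le> c" and u: "u \<in> {0..<T}"
  shows "\<bar>k u\<bar> * g u \<le> (c::real)"
proof (rule ccontr)
  assume gt: "\<not> \<bar>k u\<bar> * g u \<le> c"
  have F: "at u within ({0..<T} \<inter> {u<..}) = at_right u"
    using u by (intro at_within_nhd[of u "{..<T}"]) auto
  have "(k \<longlongrightarrow> k u) (at_right u)" using k u unfolding cadlag_on_def F[symmetric] by blast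
  moreover have "(g \<longlongrightarrow> g u) (at_right u)"
    using g u unfolding continuous_on_def F[symmetric] by (blast intro: tendsto_within_subset)
  ultimately have "((\<lambda>s. \<bar>k s\<bar> * g s) \<longlongrightarrow> \<bar>k u\<bar> * g u) (at_right u)"
    by (intro tendsto_intros)
  then have "\<forall>\<^sub>F s in at_right u. c < \<bar>k s\<bar> * g s"
    using gt by (intro order_tendstoD) auto
  then obtain b where b: "u < b" "\<And>y. u < y \<Longrightarrow> y < b \<Longrightarrow> c < \<bar>k y\<bar> * g y"
    unfolding eventually_at_right_field by blast
  obtain q where q: "q \<in> \<rat>" "u < q" "q < min b T"
    using Rats_dense_in_real[of u "min b T"] b u by auto
  then show False using b(2)[of q] rat[of q] u by auto
qed

section \<open>Bounds in time\<close>

context levy_smoothing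
begin

definition D_bound :: "(real \<Rightarrow> real) \<Rightarrow> real \<Rightarrow> ennreal" where
  "D_bound f t = ennreal D_const * dyadic_K \<epsilon> f (rad t)"

lemma D_bound_measurable [measurable]: "D_bound f \<in> borel_measurable borel"
  unfolding D_bound_def rad_def by measurable

lemma rad_powr:
  assumes "\<alpha> = \<theta> / \<beta>" shows "rad t powr \<theta> = (T - t) powr \<alpha>"
  using assms by (simp add: rad_def powr_powr)

lemma D_bound_le_holder_norm:
  assumes q: "0 < q" and \<eta>: "0 \<le> \<eta>" and \<theta>: "\<theta> = 1 - (\<epsilon> + \<eta>)" "0 < \<theta>" and \<alpha>: "\<alpha> = \<theta> / \<beta>" and t: "t < T"
  shows "ennreal ((T - t) powr \<alpha>) * D_bound f t
    \<le> ennreal (D_const * (exp \<eta> / (1 - 2 powr (- \<theta>)))) * holder_norm \<eta> q f"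
proof -
  have "2 powr (- \<theta>) < 1" using \<theta> by (simp add: powr_less_one)
  have "ennreal ((T - t) powr \<alpha>) * D_bound f t = ennreal D_const * (ennreal (rad t powr \<theta>) * dyadic_K \<epsilon> f (rad t))"
    unfolding D_bound_def rad_powr[OF \<alpha>] by (simp add: ac_simps)
  also have "\<dots> \<le> ennreal D_const * (ennreal (exp \<eta> / (1 - 2 powr (- \<theta>))) * holder_norm \<eta> q f)"
    using assms rad_pos by (intro mult_left_mono dyadic_K_le_holder_norm) auto
  also have "\<dots> = ennreal (D_const * (exp \<eta> / (1 - 2 powr (- \<theta>)))) * holder_norm \<eta> q f"
    using D_const_pos \<open>2 powr (- \<theta>) < 1\<close> by (subst ennreal_mult) (auto simp: mult.assoc)
  finally show ?thesis .
qed

lemma D_bound_time_integral: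
  assumes q: "0 < q" and th: "0 < 1 - (\<epsilon> + \<eta>)" and \<alpha>: "\<alpha> = (1 - (\<epsilon> + \<eta>)) / \<beta>"
  shows "\<exists>C\<ge>0. \<forall>f. (\<integral>\<^sup>+t\<in>{0..<T}. (ennreal ((T - t) powr (\<alpha> * q - 1)) * enn_powr (D_bound f t) q) \<partial>lborel)
      \<le> ennreal C * enn_powr (holder_norm \<eta> q f) q"
proof -
  obtain C where C: "0 \<le> C" "\<And>f. (\<integral>\<^sup>+t\<in>{0..<T}. (ennreal ((T - t) powr (\<alpha> * q - 1)) *
        enn_powr (dyadic_K \<epsilon> f ((T - t) powr (1 / \<beta>))) q) \<partial>lborel)
      \<le> ennreal C * enn_powr (holder_norm \<eta> q f) q"
    using dyadic_K_time_integral[OF q th \<beta>_pos \<alpha>, of T] by blast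
  have "(\<integral>\<^sup>+t\<in>{0..<T}. (ennreal ((T - t) powr (\<alpha> * q - 1)) * enn_powr (D_bound f t) q) \<partial>lborel)
      \<le> ennreal (D_const powr q * C) * enn_powr (holder_norm \<eta> q f) q" for f
  proof -
    have "enn_powr (D_bound f t) q = ennreal (D_const powr q) * enn_powr (dyadic_K \<epsilon> f ((T - t) powr (1 / \<beta>))) q" for t
      unfolding D_bound_def rad_def using D_const_pos by (intro enn_powr_mult) auto
    then have "(\<integral>\<^sup>+t\<in>{0..<T}. (ennreal ((T - t) powr (\<alpha> * q - 1)) * enn_powr (D_bound f t) q) \<partial>lborel)
      = (\<integral>\<^sup>+t. ennreal (D_const powr q) * (ennreal ((T - t) powr (\<alpha> * q - 1)) *
        enn_powr (dyadic_K \<epsilon> f ((T - t) powr (1 / \<beta>))) q * indicator {0..<T} t) \<partial>lborel)"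
      by (simp add: ac_simps)
    also have "\<dots> = ennreal (D_const powr q) * (\<integral>\<^sup>+t\<in>{0..<T}. (ennreal ((T - t) powr (\<alpha> * q - 1)) *
        enn_powr (dyadic_K \<epsilon> f ((T - t) powr (1 / \<beta>))) q) \<partial>lborel)"
      by (rule nn_integral_cmult) measurable
    also have "\<dots> \<le> ennreal (D_const powr q) * (ennreal C * enn_powr (holder_norm \<eta> q f) q)"
      by (intro mult_left_mono C) auto
    also have "\<dots> = ennreal (D_const powr q * C) * enn_powr (holder_norm \<eta> q f) q"
      using C by (simp add: ennreal_mult mult.assoc)
    finally show ?thesis .
  qed
  then show ?thesis using C(1) by (intro exI[of _ "D_const powr q * C"]) auto
qed

text \<open>A comparison of integrands, so measurability in t of a supremum over uncountably many x
  is not at issue.\<close>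

lemma D_time_integral_le:
  assumes f: "admissible f" and q: "0 < q"
  shows "(\<integral>\<^sup>+t\<in>{0..<T}. (ennreal ((T - t) powr a) * (SUP x. ennreal (\<bar>D f t x\<bar> powr q))) \<partial>lborel)
    \<le> (\<integral>\<^sup>+t\<in>{0..<T}. (ennreal ((T - t) powr a) * enn_powr (D_bound f t) q) \<partial>lborel)"
proof (intro nn_integral_mono)
  fix t
  show "ennreal ((T - t) powr a) * (SUP x. ennreal (\<bar>D f t x\<bar> powr q)) * indicator {0..<T} t
    \<le> ennreal ((T - t) powr a) * enn_powr (D_bound f t) q * indicator {0..<T} t"
  proof (cases "t \<in> {0..<T}")
    case True
    have "ennreal (\<bar>D f t x\<bar> powr q) \<le> enn_powr (D_bound f t) q" for x
      using enn_powr_mono[OF abs_D_le[OF f True, of x], of q] q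
      by (simp add: enn_powr_ennreal D_bound_def)
    then have "(SUP x. ennreal (\<bar>D f t x\<bar> powr q)) \<le> enn_powr (D_bound f t) q" by (intro SUP_least)
    then show ?thesis by (intro mult_right_mono mult_left_mono) auto
  qed simp
qed

text \<open>J is the path integral on A and 0 off A. The factor 2 / \<alpha> has two sources:
  symmetry in the two times gives 2, and integrating the weight of the later time over [u,t] gives
  at most (T - u) powr \<alpha> / \<alpha>. The product of the latter with w u has the exponent
  \<alpha> * 2 - 1.\<close>

lemma stopped_second_moment:
  assumes f: "admissible f" and fin: "\<And>u. u \<in> {0..<T} \<Longrightarrow> D_bound f u < \<infinity>"
    and \<alpha>: "0 < \<alpha>" and t: "t \<in> {0..<T}"
    and \<sigma>: "stopping_time \<F> \<sigma>" "\<And>\<omega>. \<omega> \<in> space M \<Longrightarrow> \<sigma> \<omega> \<in> {0..t}"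
    and A: "A \<in> sets (\<F>.pre_sigma \<sigma>)"
    and \<psi>_meas: "\<And>u. u \<in> {0..<T} \<Longrightarrow> \<psi> u \<in> borel_measurable M"
    and \<psi>_cadlag: "\<And>\<omega>. \<omega> \<in> space M \<Longrightarrow> cadlag_on {0..<T} (\<lambda>u. \<psi> u \<omega>)"
    and \<psi>_D: "\<And>u. u \<in> {0..<T} \<Longrightarrow> AE \<omega> in M. \<psi> u \<omega> = D f u (X u \<omega>)"
    and \<psi>_le: "\<And>u \<omega>. u \<in> {0..<T} \<Longrightarrow> \<omega> \<in> space M \<Longrightarrow> \<bar>\<psi> u \<omega>\<bar> * (T - u) powr \<alpha> \<le> c"
  shows "\<exists>J\<in>borel_measurable M.
      (\<forall>\<omega>\<in>A. J \<omega> = (\<integral>u. indicator {\<sigma> \<omega>..t} u * ((T - u) powr (\<alpha> - 1) * \<psi> u \<omega>) \<partial>lborel)) \<and>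
      (\<integral>\<^sup>+\<omega>. ennreal ((J \<omega>)\<^sup>2) \<partial>M) \<le> ennreal (2 / \<alpha>) * emeasure M A *
        (\<integral>\<^sup>+u\<in>{0..<T}. (ennreal ((T - u) powr (\<alpha> * 2 - 1)) * (D_bound f u)\<^sup>2) \<partial>lborel)"
proof -
  define w where "w u = (T - u) powr (\<alpha> - 1)" for u
  have [measurable]: "w \<in> borel_measurable borel" unfolding w_def by measurable
  have w0: "0 \<le> w u" for u by (simp add: w_def)
  have A_space: "A \<subseteq> space M" using sets.sets_into_space[OF A] by (simp add: \<F>.space_pre_sigma)
  \<comment> \<open>The fact on stopping times that makes \<open>D_martingale_product\<close>
    applicable at deterministic times.\<close>
  have AF: "{\<omega> \<in> A. \<sigma> \<omega> \<le> u} \<in> sets (\<F> u)" for u by (rule \<F>.sets_pre_sigmaD[OF \<sigma>(1) A])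
  have "{\<omega> \<in> A. \<sigma> \<omega> \<le> T} = A" using A_space \<sigma>(2) t by fastforce
  then have AM [measurable]: "A \<in> sets M" using AF[of T] subalgebra_\<F>[of T] by (auto simp: subalgebra_def)
  have [measurable]: "\<sigma> \<in> borel_measurable M"
    using measurable_stopping_time[OF \<sigma>(1), of M] subalgebra_\<F> by (auto simp: subalgebra_def)
  define \<psi>' where "\<psi>' p = (if fst p \<in> {0..<T} then \<psi> (fst p) (snd p) else 0)" for p
  have [measurable]: "\<psi>' \<in> borel_measurable (borel \<Otimes>\<^sub>M M)"
    unfolding \<psi>'_def[abs_def]
    using \<psi>_cadlag by (intro right_continuous_jointly_measurable \<psi>_meas) (auto simp: cadlag_on_def)
  \<comment> \<open>The condition \<sigma> \<omega> \<le> u is expressed through the difference u -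
    \<sigma> \<omega>, for which joint measurability is immediate.\<close>
  define h where "h u \<omega> = indicator A \<omega> * (indicator {0..} (u - \<sigma> \<omega>) * (indicator {0..t} u * (w u * \<psi>' (u, \<omega>))))" for u \<omega>
  have h [measurable]: "(\<lambda>p. h (fst p) (snd p)) \<in> borel_measurable (borel \<Otimes>\<^sub>M M)"
    unfolding h_def by measurable
  have c: "0 \<le> c"
  proof -
    obtain \<omega> where "\<omega> \<in> space M" using not_empty by auto
    have "0 \<le> \<bar>\<psi> 0 \<omega>\<bar> * (T - 0) powr \<alpha>" by simp
    also have "\<dots> \<le> c" using T_pos \<open>\<omega> \<in> space M\<close> by (intro \<psi>_le) auto
    finally show ?thesis .
  qed
  \<comment> \<open>This bound blows up as t tends to T, but it only justifies exchanging integrals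
    and does not enter the final constant.\<close>
  have h_le: "\<bar>h u \<omega>\<bar> \<le> c / (T - t)" if "\<omega> \<in> space M" for u \<omega>
  proof (cases "u \<in> {0..t}")
    case True
    have "w u = (T - u) powr \<alpha> / (T - u)" using True t by (simp add: w_def powr_diff)
    then have "\<bar>w u * \<psi> u \<omega>\<bar> = (\<bar>\<psi> u \<omega>\<bar> * (T - u) powr \<alpha>) / (T - u)"
      using True t by (simp add: abs_mult)
    also have "\<dots> \<le> c / (T - t)" using True t c \<psi>_le[of u \<omega>] that by (intro frac_le) auto
    finally have "\<bar>w u * \<psi> u \<omega>\<bar> \<le> c / (T - t)" .
    then show ?thesis using True t c by (auto simp: h_def \<psi>'_def indicator_def)
  next
    case False
    then show ?thesis using c t by (simp add: h_def)
  qed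
  define L where "L = density lborel (indicator {0..t} :: real \<Rightarrow> ennreal)"
  have sets_L [measurable_cong]: "sets L = sets borel" by (simp add: L_def)
  have fin_L: "finite_measure L"
    by (rule finite_measureI) (use t in \<open>simp add: L_def emeasure_density\<close>)
  interpret L: finite_measure L by (rule fin_L)
  interpret LL: pair_sigma_finite L L ..
  have nn_L: "(\<integral>\<^sup>+u. g u \<partial>L) = (\<integral>\<^sup>+u\<in>{0..t}. g u \<partial>lborel)" if "g \<in> borel_measurable borel" for g
    unfolding L_def using that by (subst nn_integral_density) (auto simp: mult.commute)
  define J where "J \<omega> = (\<integral>u. h u \<omega> \<partial>L)" for \<omega>
  have J_meas: "J \<in> borel_measurable M"
  proof -
    have "(\<lambda>(\<omega>, u). h u \<omega>) \<in> borel_measurable (M \<Otimes>\<^sub>M borel)"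
      using measurable_pair_swap[OF h] by (simp add: split_beta')
    then have "(\<lambda>(\<omega>, u). h u \<omega>) \<in> borel_measurable (M \<Otimes>\<^sub>M L)" by measurable
    then show ?thesis unfolding J_def[abs_def] by (rule L.borel_measurable_lebesgue_integral)
  qed
  have J_eq: "J \<omega> = (\<integral>u. indicator {\<sigma> \<omega>..t} u * ((T - u) powr (\<alpha> - 1) * \<psi> u \<omega>) \<partial>lborel)" if "\<omega> \<in> A" for \<omega>
  proof -
    have \<omega>: "\<omega> \<in> space M" using that A_space by auto
    have h_u: "(\<lambda>u. h u \<omega>) \<in> borel_measurable borel"
      using measurable_compose[OF measurable_Pair2' h, of \<omega>] \<omega> by simp
    have "J \<omega> = (\<integral>u. h u \<omega> \<partial>density lborel (\<lambda>u. ennreal (indicator {0..t} u)))"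
      unfolding J_def L_def by (simp add: ennreal_indicator)
    also have "\<dots> = (\<integral>u. indicator {0..t} u *\<^sub>R h u \<omega> \<partial>lborel)"
      using h_u by (intro integral_density) auto
    also have "\<dots> = (\<integral>u. indicator {\<sigma> \<omega>..t} u * ((T - u) powr (\<alpha> - 1) * \<psi> u \<omega>) \<partial>lborel)"
      using that \<sigma>(2)[OF \<omega>] t
      by (intro Bochner_Integration.integral_cong) (auto simp: h_def w_def \<psi>'_def indicator_def)
    finally show ?thesis .
  qed
  define G where "G u = (D_bound f u)\<^sup>2" for u
  have [measurable]: "G \<in> borel_measurable borel" unfolding G_def by measurable
  \<comment> \<open>Bounds the mixed moment of h u and h v on 0 \<le> u \<le> v \<le> t; by the
    martingale property the earlier time u carries the square of D.\<close>
  define k1 where "k1 u v = indicator {0..t} u * (indicator {0..} (v - u) * (indicator {0..t} v * (ennreal (w u) * (ennreal (w v) * (G u * emeasure M A)))))" for u v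
  have k1 [measurable]: "(\<lambda>p. k1 (fst p) (snd p)) \<in> borel_measurable (borel \<Otimes>\<^sub>M borel)"
    unfolding k1_def by measurable
  have cov: "ennreal (\<integral>\<omega>. h u \<omega> * h v \<omega> \<partial>M) \<le> k1 u v" if uv: "u \<le> v" for u v
  proof (cases "0 \<le> u \<and> v \<le> t")
    case False
    then have "(\<lambda>\<omega>. h u \<omega> * h v \<omega>) = (\<lambda>_. 0)" using uv by (auto simp: h_def fun_eq_iff)
    then have "(\<integral>\<omega>. h u \<omega> * h v \<omega> \<partial>M) = 0" by simp
    then show ?thesis by simp
  next
    case True
    then have u: "u \<in> {0..<T}" "u \<in> {0..t}" and v: "v \<in> {0..<T}" "v \<in> {0..t}" using uv t by auto
    define A' where "A' = {\<omega> \<in> A. \<sigma> \<omega> \<le> u}"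
    have A' [measurable]: "A' \<in> sets M" "A' \<subseteq> A"
      using AF[of u] subalgebra_\<F>[of u] by (auto simp: A'_def subalgebra_def)
    have [measurable]: "X u \<in> borel_measurable M" "X v \<in> borel_measurable M"
      using u v by (auto intro: X_measurable)
    have [measurable]: "D f u \<in> borel_measurable borel" "D f v \<in> borel_measurable borel"
      using u v by (auto intro: D_measurable f)
    have [measurable]: "\<psi> u \<in> borel_measurable M" "\<psi> v \<in> borel_measurable M"
      using u v \<psi>_meas by auto
    have dy: "dyadic_K \<epsilon> f (rad s) < \<infinity>" if "s \<in> {0..<T}" for s
      using fin[OF that] D_const_pos by (auto simp: D_bound_def ennreal_mult_less_top)
    have "(\<integral>\<omega>. h u \<omega> * h v \<omega> \<partial>M) = (\<integral>\<omega>. (w u * w v) * (indicator A' \<omega> * \<psi> u \<omega> * \<psi> v \<omega>) \<partial>M)"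
      using u v uv by (intro Bochner_Integration.integral_cong) (auto simp: h_def A'_def \<psi>'_def indicator_def)
    also have "\<dots> = (w u * w v) * (\<integral>\<omega>. indicator A' \<omega> * \<psi> u \<omega> * \<psi> v \<omega> \<partial>M)" by simp
    also have "(\<integral>\<omega>. indicator A' \<omega> * \<psi> u \<omega> * \<psi> v \<omega> \<partial>M) = (\<integral>\<omega>. indicator A' \<omega> * D f u (X u \<omega>) * D f v (X v \<omega>) \<partial>M)"
    proof (rule integral_cong_AE)
      show "AE \<omega> in M. indicator A' \<omega> * \<psi> u \<omega> * \<psi> v \<omega> = indicator A' \<omega> * D f u (X u \<omega>) * D f v (X v \<omega>)"
        using \<psi>_D[OF u(1)] \<psi>_D[OF v(1)] by eventually_elim simp
    qed measurable
    also have "\<dots> = (\<integral>\<omega>. indicator A' \<omega> * (D f u (X u \<omega>))\<^sup>2 \<partial>M)"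
      using u v uv AF[of u] by (intro D_martingale_product f dy) (auto simp: A'_def)
    finally have "ennreal (\<integral>\<omega>. h u \<omega> * h v \<omega> \<partial>M)
        = ennreal (w u) * (ennreal (w v) * ennreal (\<integral>\<omega>. indicator A' \<omega> * (D f u (X u \<omega>))\<^sup>2 \<partial>M))"
      using w0 by (simp add: ennreal_mult' mult.assoc)
    also have "\<dots> \<le> ennreal (w u) * (ennreal (w v) * (G u * emeasure M A))"
    proof (intro mult_left_mono)
      have "ennreal (\<integral>\<omega>. indicator A' \<omega> * (D f u (X u \<omega>))\<^sup>2 \<partial>M) \<le> (\<integral>\<^sup>+\<omega>. ennreal (indicator A' \<omega> * (D f u (X u \<omega>))\<^sup>2) \<partial>M)"
        by (rule ennreal_integral_le_nn_integral)
      also have "\<dots> \<le> (\<integral>\<^sup>+\<omega>. G u * indicator A \<omega> \<partial>M)"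
      proof (intro nn_integral_mono)
        fix \<omega>
        have "(ennreal \<bar>D f u (X u \<omega>)\<bar>)\<^sup>2 \<le> G u"
          unfolding G_def D_bound_def by (intro power_mono abs_D_le f u) auto
        then have "ennreal ((D f u (X u \<omega>))\<^sup>2) \<le> G u" by (simp add: ennreal_power)
        then show "ennreal (indicator A' \<omega> * (D f u (X u \<omega>))\<^sup>2) \<le> G u * indicator A \<omega>"
          using A'(2) by (auto simp: indicator_def)
      qed
      also have "\<dots> = G u * emeasure M A" by (simp add: nn_integral_cmult_indicator)
      finally show "ennreal (\<integral>\<omega>. indicator A' \<omega> * (D f u (X u \<omega>))\<^sup>2 \<partial>M) \<le> G u * emeasure M A" .
    qed auto
    also have "\<dots> = k1 u v" using u v uv by (simp add: k1_def)
    finally show ?thesis .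
  qed
  \<comment> \<open>One summand suffices, depending on the order of u and v; adding both avoids a
    case distinction under the integral.\<close>
  have cov2: "ennreal (\<integral>\<omega>. h u \<omega> * h v \<omega> \<partial>M) \<le> k1 u v + k1 v u" for u v
  proof (cases "u \<le> v")
    case True
    then show ?thesis using cov[of u v] by (simp add: add_increasing2)
  next
    case False
    then have "ennreal (\<integral>\<omega>. h v \<omega> * h u \<omega> \<partial>M) \<le> k1 v u" by (intro cov) simp
    then show ?thesis by (simp add: add_increasing mult.commute)
  qed
  have k1_v [measurable]: "k1 u \<in> borel_measurable borel" for u
    using measurable_compose[OF measurable_Pair1' k1, of u] by simp
  have k1_u [measurable]: "(\<lambda>u. k1 u v) \<in> borel_measurable borel" for v
    using measurable_compose[OF measurable_Pair2' k1, of v] by simp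
  define I where "I = (\<integral>\<^sup>+u. \<integral>\<^sup>+v. k1 u v \<partial>L \<partial>L)"
  have I_meas [measurable]: "(\<lambda>u. \<integral>\<^sup>+v. k1 u v \<partial>L) \<in> borel_measurable borel"
    "(\<lambda>u. \<integral>\<^sup>+v. k1 v u \<partial>L) \<in> borel_measurable borel"
  proof -
    have "(\<lambda>(u, v). k1 u v) \<in> borel_measurable (borel \<Otimes>\<^sub>M L)" using k1 by (simp add: split_beta' cong: measurable_cong_sets)
    then show "(\<lambda>u. \<integral>\<^sup>+v. k1 u v \<partial>L) \<in> borel_measurable borel" by (rule L.borel_measurable_nn_integral)
    have "(\<lambda>(u, v). k1 v u) \<in> borel_measurable (borel \<Otimes>\<^sub>M borel)"
      using measurable_pair_swap[OF k1] by (simp add: split_beta')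
    then have "(\<lambda>(u, v). k1 v u) \<in> borel_measurable (borel \<Otimes>\<^sub>M L)" by measurable
    then show "(\<lambda>u. \<integral>\<^sup>+v. k1 v u \<partial>L) \<in> borel_measurable borel" by (rule L.borel_measurable_nn_integral)
  qed
  have "(\<integral>\<^sup>+\<omega>. ennreal ((J \<omega>)\<^sup>2) \<partial>M) \<le> (\<integral>\<^sup>+u. \<integral>\<^sup>+v. (k1 u v + k1 v u) \<partial>L \<partial>L)"
    unfolding J_def by (rule nn_integral_square_of_integral_le[OF fin_L sets_L h h_le cov2])
  also have "\<dots> = I + (\<integral>\<^sup>+u. \<integral>\<^sup>+v. k1 v u \<partial>L \<partial>L)"
    unfolding I_def by (simp add: nn_integral_add)
  also have "(\<integral>\<^sup>+u. \<integral>\<^sup>+v. k1 v u \<partial>L \<partial>L) = I"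
    unfolding I_def using LL.Fubini'[of k1] k1 by (simp add: split_beta')
  also have "I + I = 2 * I" by (simp add: mult_2)
  finally have J_le: "(\<integral>\<^sup>+\<omega>. ennreal ((J \<omega>)\<^sup>2) \<partial>M) \<le> 2 * I" .
  have "I \<le> (\<integral>\<^sup>+u. (ennreal (1 / \<alpha>) * emeasure M A) * (ennreal ((T - u) powr (\<alpha> * 2 - 1)) * G u * indicator {0..<T} u) \<partial>lborel)"
  proof -
    have inner: "(\<integral>\<^sup>+v. k1 u v \<partial>L) \<le> (ennreal (1 / \<alpha>) * emeasure M A) * (ennreal ((T - u) powr (\<alpha> * 2 - 1)) * G u)"
      if u: "u \<in> {0..t}" for u
    proof -
      have "(\<integral>\<^sup>+v. k1 u v \<partial>L) = (\<integral>\<^sup>+v. (ennreal (w u) * (G u * emeasure M A)) * (ennreal ((T - v) powr (\<alpha> - 1)) * indicator {u..t} v) \<partial>lborel)"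
        unfolding nn_L[OF k1_v]
      proof (intro nn_integral_cong)
        fix v
        show "k1 u v * indicator {0..t} v = (ennreal (w u) * (G u * emeasure M A)) * (ennreal ((T - v) powr (\<alpha> - 1)) * indicator {u..t} v)"
        proof (cases "v \<in> {u..t}")
          case True
          then have "k1 u v = ennreal (w u) * (ennreal (w v) * (G u * emeasure M A))"
            using u by (simp add: k1_def)
          moreover have "indicator {0..t} v = (1::ennreal)" "indicator {u..t} v = (1::ennreal)"
            using True u by auto
          ultimately show ?thesis unfolding w_def[of v] by (simp only: mult_1_right ac_simps)
        next
          case False
          then have "k1 u v * indicator {0..t} v = 0"
            by (cases "v < u") (simp_all add: k1_def)
          then show ?thesis using False by simp
        qed
      qed
      also have "\<dots> = (ennreal (w u) * (G u * emeasure M A)) * ennreal (((T - u) powr \<alpha> - (T - t) powr \<alpha>) / \<alpha>)"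
        using u t \<alpha> by (subst nn_integral_cmult) (auto simp: nn_integral_powr_weight)
      \<comment> \<open>Dropping (T - t) powr \<alpha> makes the bound uniform in t, as the BMO norm
        requires.\<close>
      also have "\<dots> \<le> (ennreal (w u) * (G u * emeasure M A)) * ennreal ((T - u) powr \<alpha> / \<alpha>)"
        using \<alpha> by (intro mult_left_mono ennreal_leI divide_right_mono) auto
      also have "\<dots> = ennreal (w u * ((T - u) powr \<alpha> / \<alpha>)) * (G u * emeasure M A)"
        using \<alpha> w0 by (subst ennreal_mult) (auto simp: ac_simps)
      also have "w u * ((T - u) powr \<alpha> / \<alpha>) = (1 / \<alpha>) * (T - u) powr (\<alpha> * 2 - 1)"
      proof -
        have "\<alpha> - 1 + \<alpha> = \<alpha> * 2 - 1" by simp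
        then have "w u * (T - u) powr \<alpha> = (T - u) powr (\<alpha> * 2 - 1)"
          unfolding w_def powr_add[symmetric] by (simp only:)
        then show ?thesis by simp
      qed
      also have "ennreal ((1 / \<alpha>) * (T - u) powr (\<alpha> * 2 - 1)) = ennreal (1 / \<alpha>) * ennreal ((T - u) powr (\<alpha> * 2 - 1))"
        using \<alpha> by (intro ennreal_mult) auto
      finally show ?thesis by (simp add: ac_simps)
    qed
    show ?thesis
      unfolding I_def nn_L[OF I_meas(1)]
    proof (intro nn_integral_mono)
      fix u
      show "(\<integral>\<^sup>+v. k1 u v \<partial>L) * indicator {0..t} u
        \<le> (ennreal (1 / \<alpha>) * emeasure M A) * (ennreal ((T - u) powr (\<alpha> * 2 - 1)) * G u * indicator {0..<T} u)"
        using inner[of u] t by (auto simp: indicator_def)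
    qed
  qed
  also have "(\<integral>\<^sup>+u. (ennreal (1 / \<alpha>) * emeasure M A) * (ennreal ((T - u) powr (\<alpha> * 2 - 1)) * G u * indicator {0..<T} u) \<partial>lborel)
      = (ennreal (1 / \<alpha>) * emeasure M A) * (\<integral>\<^sup>+u\<in>{0..<T}. (ennreal ((T - u) powr (\<alpha> * 2 - 1)) * G u) \<partial>lborel)"
    by (rule nn_integral_cmult) measurable
  finally have "2 * I \<le> 2 * ((ennreal (1 / \<alpha>) * emeasure M A) * (\<integral>\<^sup>+u\<in>{0..<T}. (ennreal ((T - u) powr (\<alpha> * 2 - 1)) * G u) \<partial>lborel))"
    by (rule mult_left_mono) simp
  also have "\<dots> = (2 * ennreal (1 / \<alpha>)) * emeasure M A * (\<integral>\<^sup>+u\<in>{0..<T}. (ennreal ((T - u) powr (\<alpha> * 2 - 1)) * G u) \<partial>lborel)"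
    by (simp only: mult.assoc)
  also have "2 * ennreal (1 / \<alpha>) = ennreal (2 / \<alpha>)"
    using \<alpha> ennreal_mult[of 2 "1 / \<alpha>"] by simp
  finally show ?thesis using J_meas J_eq J_le unfolding G_def by (intro bexI[of _ J]) (auto intro: order_trans)
qed

end

section \<open>The two estimates\<close>

context levy_smoothing
begin

lemma cadlag_version_measurable:
  assumes "complete_measure M" and f: "admissible f"
    and \<phi>: "cadlag_version M T (\<lambda>t \<omega>. D f t (X t \<omega>)) \<phi>" and t: "t \<in> {0..<T}"
  shows "\<phi> t \<in> borel_measurable M"
proof -
  interpret complete_measure M by fact
  have [measurable]: "D f t \<in> borel_measurable borel" "X t \<in> borel_measurable M"
    using t by (auto intro: D_measurable f X_measurable)
  show ?thesis
  proof (rule borel_measurable_AE_cong)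
    show "AE \<omega> in M. \<phi> t \<omega> = D f t (X t \<omega>)" using \<phi> t by (simp add: cadlag_version_def)
  qed measurable
qed

text \<open>One null set has to serve all times, hence rational times first and right continuity
  afterwards.\<close>

lemma cadlag_version_bound:
  assumes f: "admissible f" and \<phi>: "cadlag_version M T (\<lambda>t \<omega>. D f t (X t \<omega>)) \<phi>"
    and \<alpha>: "0 < \<alpha>" and c: "0 \<le> c" "\<And>u. u \<in> {0..<T} \<Longrightarrow> ennreal ((T - u) powr \<alpha>) * D_bound f u \<le> ennreal c"
  shows "AE \<omega> in M. \<forall>u\<in>{0..<T}. \<bar>\<phi> u \<omega>\<bar> * (T - u) powr \<alpha> \<le> c"
proof -
  have "AE \<omega> in M. \<forall>q\<in>\<rat> \<inter> {0..<T}. \<bar>\<phi> q \<omega>\<bar> * (T - q) powr \<alpha> \<le> c"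
  proof (subst AE_ball_countable)
    show "countable (\<rat> \<inter> {0..<T})" using countable_rat by blast
    show "\<forall>q\<in>\<rat> \<inter> {0..<T}. AE \<omega> in M. \<bar>\<phi> q \<omega>\<bar> * (T - q) powr \<alpha> \<le> c"
    proof
      fix q assume "q \<in> \<rat> \<inter> {0..<T}"
      then have q: "q \<in> {0..<T}" by simp
      then have "AE \<omega> in M. \<phi> q \<omega> = D f q (X q \<omega>)" using \<phi> by (simp add: cadlag_version_def)
      then show "AE \<omega> in M. \<bar>\<phi> q \<omega>\<bar> * (T - q) powr \<alpha> \<le> c"
      proof eventually_elim
        case (elim \<omega>)
        have "ennreal ((T - q) powr \<alpha> * \<bar>D f q (X q \<omega>)\<bar>) \<le> ennreal ((T - q) powr \<alpha>) * D_bound f q"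
          unfolding D_bound_def by (subst ennreal_mult) (auto intro!: mult_left_mono abs_D_le f q)
        also have "\<dots> \<le> ennreal c" by (rule c(2)[OF q])
        finally show ?case using c(1) by (simp add: elim mult.commute)
      qed
    qed
  qed
  then show ?thesis
    using AE_space
  proof eventually_elim
    case (elim \<omega>)
    have k: "cadlag_on {0..<T} (\<lambda>u. \<phi> u \<omega>)" using \<phi> elim(2) by (simp add: cadlag_version_def)
    have g: "continuous_on {0..<T} (\<lambda>u. (T - u) powr \<alpha>)"
      by (intro continuous_intros) auto
    show ?case
      using cadlag_on_bound_from_rationals[OF k g] elim(1) by blast
  qed
qed

text \<open>With I the path integral from \<sigma> to t, the square of \<alpha> * |I| + 2 * c is at
  most 2 * \<alpha>^2 * I^2 + 8 * c^2. The second moment of I on A is at most (2 / \<alpha>) * b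
  times the probability of A, so the first summand contributes 4 * \<alpha> * b.\<close>

lemma riemann_liouville_bmo2_norm_le:
  assumes compl: "complete_measure M" and f: "admissible f" and \<phi>: "cadlag_version M T (\<lambda>t \<omega>. D f t (X t \<omega>)) \<phi>"
    and \<alpha>: "0 < \<alpha>" and c: "0 \<le> c" "\<And>u. u \<in> {0..<T} \<Longrightarrow> ennreal ((T - u) powr \<alpha>) * D_bound f u \<le> ennreal c"
    and b: "0 \<le> b" "(\<integral>\<^sup>+u\<in>{0..<T}. (ennreal ((T - u) powr (\<alpha> * 2 - 1)) * (D_bound f u)\<^sup>2) \<partial>lborel) \<le> ennreal b"
  shows "bmo2_norm M \<F> T (\<lambda>t \<omega>. riemann_liouville T \<alpha> (\<lambda>u. \<phi> u \<omega>) t - \<phi> 0 \<omega>)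
    \<le> ennreal (T powr (- \<alpha>) * sqrt (4 * \<alpha> * b + 8 * c\<^sup>2))"
proof -
  interpret complete_measure M by (rule compl)
  define C where "C = T powr (- \<alpha>) * sqrt (4 * \<alpha> * b + 8 * c\<^sup>2)"
  define p where "p = (T powr (- \<alpha>))\<^sup>2"
  have C0: "0 \<le> C" using \<alpha> b by (simp add: C_def)
  have C2: "C\<^sup>2 = p * (4 * \<alpha> * b + 8 * c\<^sup>2)"
    using \<alpha> b by (simp add: C_def p_def power_mult_distrib)
  have fin: "D_bound f u < \<infinity>" if u: "u \<in> {0..<T}" for u
  proof -
    have "ennreal ((T - u) powr \<alpha>) * D_bound f u < \<infinity>"
      using c(2)[OF u] by (rule le_less_trans) simp
    then show ?thesis using u by (auto simp: ennreal_mult_less_top)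
  qed
  have "AE \<omega> in M. \<forall>u\<in>{0..<T}. \<bar>\<phi> u \<omega>\<bar> * (T - u) powr \<alpha> \<le> c"
    by (rule cadlag_version_bound[OF f \<phi> \<alpha> c(1)]) (rule c(2))
  then obtain N where N: "N \<in> null_sets M" "{\<omega> \<in> space M. \<not> (\<forall>u\<in>{0..<T}. \<bar>\<phi> u \<omega>\<bar> * (T - u) powr \<alpha> \<le> c)} \<subseteq> N"
    by (auto elim!: AE_E intro: that null_setsI)
  have NM [measurable]: "N \<in> sets M" using N(1) by auto
  \<comment> \<open>Setting \<phi> to 0 on the null set turns the almost sure path bound into one
    for every \<omega>, as the pathwise and second moment lemmas require.\<close>
  define \<psi> where "\<psi> u \<omega> = (if \<omega> \<in> N then 0 else \<phi> u \<omega>)" for u \<omega>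
  have AE_N: "AE \<omega> in M. \<omega> \<notin> N" by (rule AE_not_in[OF N(1)])
  have \<psi>_meas: "\<psi> u \<in> borel_measurable M" if "u \<in> {0..<T}" for u
  proof -
    have [measurable]: "\<phi> u \<in> borel_measurable M" by (rule cadlag_version_measurable[OF compl f \<phi> that])
    show ?thesis unfolding \<psi>_def[abs_def] by measurable
  qed
  have \<psi>_cadlag: "cadlag_on {0..<T} (\<lambda>u. \<psi> u \<omega>)" if "\<omega> \<in> space M" for \<omega>
  proof (cases "\<omega> \<in> N")
    case True
    then show ?thesis by (auto simp: \<psi>_def cadlag_on_def intro: tendsto_const)
  next
    case False
    then show ?thesis using \<phi> that by (simp add: \<psi>_def cadlag_version_def)
  qed
  have \<psi>_D: "AE \<omega> in M. \<psi> u \<omega> = D f u (X u \<omega>)" if "u \<in> {0..<T}" for u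
  proof -
    have "AE \<omega> in M. \<phi> u \<omega> = D f u (X u \<omega>)" using \<phi> that by (simp add: cadlag_version_def)
    then show ?thesis using AE_N by eventually_elim (simp add: \<psi>_def)
  qed
  have \<psi>_le: "\<bar>\<psi> u \<omega>\<bar> * (T - u) powr \<alpha> \<le> c" if "u \<in> {0..<T}" "\<omega> \<in> space M" for u \<omega>
  proof (cases "\<omega> \<in> N")
    case False
    then have "\<bar>\<phi> u \<omega>\<bar> * (T - u) powr \<alpha> \<le> c" using that N(2) by blast
    then show ?thesis using False by (simp add: \<psi>_def)
  qed (simp add: \<psi>_def c)
  have \<psi>_path: "(\<lambda>u. if u \<in> {0..<T} then \<psi> u \<omega> else 0) \<in> borel_measurable borel" if "\<omega> \<in> space M" for \<omega>
  proof -
    have "(\<lambda>p. if fst p \<in> {0..<T} then \<psi> (fst p) (snd p) else 0) \<in> borel_measurable (borel \<Otimes>\<^sub>M M)"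
      using \<psi>_cadlag by (intro right_continuous_jointly_measurable \<psi>_meas) (auto simp: cadlag_on_def)
    from measurable_compose[OF measurable_Pair2'[OF that] this] show ?thesis unfolding fst_conv snd_conv .
  qed
  define Y where "Y t \<omega> = riemann_liouville T \<alpha> (\<lambda>u. \<phi> u \<omega>) t - \<phi> 0 \<omega>" for t \<omega>
  have "AE \<omega> in M. nn_cond_exp M (\<F>.pre_sigma \<sigma>) (\<lambda>\<omega>. ennreal (\<bar>Y t \<omega> - left_lim (\<lambda>s. Y s \<omega>) (\<sigma> \<omega>)\<bar>\<^sup>2)) \<omega> \<le> ennreal (C\<^sup>2)"
    if t: "t \<in> {0..<T}" and \<sigma>: "stopping_time \<F> \<sigma>" "\<forall>\<omega>\<in>space M. \<sigma> \<omega> \<in> {0..t}" for t \<sigma>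
  proof (rule nn_cond_exp_le_const)
    show "0 \<le> C\<^sup>2" by simp
    fix A assume sub: "subalgebra M (\<F>.pre_sigma \<sigma>)" and A: "A \<in> sets (\<F>.pre_sigma \<sigma>)"
    have AM [measurable]: "A \<in> sets M" using A sub by (auto simp: subalgebra_def)
    define I where "I \<omega> = (\<integral>u. indicator {\<sigma> \<omega>..t} u * ((T - u) powr (\<alpha> - 1) * \<psi> u \<omega>) \<partial>lborel)" for \<omega>
    obtain J where J [measurable]: "J \<in> borel_measurable M" and J_eq: "\<And>\<omega>. \<omega> \<in> A \<Longrightarrow> J \<omega> = I \<omega>"
      and J_le: "(\<integral>\<^sup>+\<omega>. ennreal ((J \<omega>)\<^sup>2) \<partial>M) \<le> ennreal (2 / \<alpha>) * emeasure M A *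
        (\<integral>\<^sup>+u\<in>{0..<T}. (ennreal ((T - u) powr (\<alpha> * 2 - 1)) * (D_bound f u)\<^sup>2) \<partial>lborel)"
      using stopped_second_moment[OF f fin \<alpha> t \<sigma>(1) _ A \<psi>_meas \<psi>_cadlag \<psi>_D \<psi>_le] \<sigma>(2)
      unfolding I_def by blast
    have incr: "\<bar>Y t \<omega> - left_lim (\<lambda>s. Y s \<omega>) (\<sigma> \<omega>)\<bar>\<^sup>2 \<le> p * (2 * \<alpha>\<^sup>2) * (J \<omega>)\<^sup>2 + p * (8 * c\<^sup>2)"
      if \<omega>: "\<omega> \<in> A" "\<omega> \<notin> N" for \<omega>
    proof -
      have sp: "\<omega> \<in> space M" using \<omega>(1) sets.sets_into_space[OF AM] by blast
      have eq: "\<psi> u \<omega> = \<phi> u \<omega>" for u using \<omega>(2) by (simp add: \<psi>_def)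
      have "\<bar>Y t \<omega> - left_lim (\<lambda>s. Y s \<omega>) (\<sigma> \<omega>)\<bar> \<le> T powr (- \<alpha>) * (\<alpha> * \<bar>I \<omega>\<bar> + 2 * c)"
        unfolding Y_def I_def eq[symmetric]
        using \<sigma>(2) sp t by (intro riemann_liouville_jump_le \<alpha> \<psi>_cadlag \<psi>_path \<psi>_le) auto
      then have "\<bar>Y t \<omega> - left_lim (\<lambda>s. Y s \<omega>) (\<sigma> \<omega>)\<bar>\<^sup>2 \<le> (T powr (- \<alpha>) * (\<alpha> * \<bar>I \<omega>\<bar> + 2 * c))\<^sup>2"
        by (intro power_mono) auto
      also have "\<dots> = p * (\<alpha> * \<bar>I \<omega>\<bar> + 2 * c)\<^sup>2" by (simp add: p_def power_mult_distrib)
      also have "\<dots> \<le> p * (2 * (\<alpha> * \<bar>I \<omega>\<bar>)\<^sup>2 + 2 * (2 * c)\<^sup>2)"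
        using sum_squares_bound[of "\<alpha> * \<bar>I \<omega>\<bar>" "2 * c"]
        by (intro mult_left_mono) (auto simp: p_def power2_sum)
      also have "\<dots> = p * (2 * \<alpha>\<^sup>2) * (J \<omega>)\<^sup>2 + p * (8 * c\<^sup>2)"
        using J_eq[OF \<omega>(1)] by (simp add: power_mult_distrib algebra_simps)
      finally show ?thesis .
    qed
    have p0: "0 \<le> p" by (simp add: p_def)
    have "(\<integral>\<^sup>+\<omega>\<in>A. ennreal (\<bar>Y t \<omega> - left_lim (\<lambda>s. Y s \<omega>) (\<sigma> \<omega>)\<bar>\<^sup>2) \<partial>M)
        \<le> (\<integral>\<^sup>+\<omega>. ennreal (p * (2 * \<alpha>\<^sup>2)) * ennreal ((J \<omega>)\<^sup>2) + ennreal (p * (8 * c\<^sup>2)) * indicator A \<omega> \<partial>M)"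
    proof (intro nn_integral_mono_AE)
      show "AE \<omega> in M. ennreal (\<bar>Y t \<omega> - left_lim (\<lambda>s. Y s \<omega>) (\<sigma> \<omega>)\<bar>\<^sup>2) * indicator A \<omega>
          \<le> ennreal (p * (2 * \<alpha>\<^sup>2)) * ennreal ((J \<omega>)\<^sup>2) + ennreal (p * (8 * c\<^sup>2)) * indicator A \<omega>"
        using AE_N
      proof eventually_elim
        case (elim \<omega>)
        show ?case
        proof (cases "\<omega> \<in> A")
          case True
          have "ennreal (\<bar>Y t \<omega> - left_lim (\<lambda>s. Y s \<omega>) (\<sigma> \<omega>)\<bar>\<^sup>2) \<le> ennreal (p * (2 * \<alpha>\<^sup>2) * (J \<omega>)\<^sup>2 + p * (8 * c\<^sup>2))"
            by (intro ennreal_leI incr True elim)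
          also have "\<dots> = ennreal (p * (2 * \<alpha>\<^sup>2)) * ennreal ((J \<omega>)\<^sup>2) + ennreal (p * (8 * c\<^sup>2))"
            using p0 by (simp add: ennreal_mult ennreal_plus)
          finally show ?thesis using True by simp
        qed simp
      qed
    qed
    also have "\<dots> = ennreal (p * (2 * \<alpha>\<^sup>2)) * (\<integral>\<^sup>+\<omega>. ennreal ((J \<omega>)\<^sup>2) \<partial>M) + ennreal (p * (8 * c\<^sup>2)) * emeasure M A"
      by (simp add: nn_integral_add nn_integral_cmult nn_integral_cmult_indicator)
    also have "\<dots> \<le> ennreal (p * (2 * \<alpha>\<^sup>2)) * (ennreal (2 / \<alpha>) * emeasure M A * ennreal b) + ennreal (p * (8 * c\<^sup>2)) * emeasure M A"
      by (intro add_right_mono mult_left_mono order_trans[OF J_le] b(2)) auto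
    also have "\<dots> = ennreal ((p * (2 * \<alpha>\<^sup>2) * (2 / \<alpha>) * b + p * (8 * c\<^sup>2)) * prob A)"
      using p0 \<alpha> b(1)
      by (simp add: emeasure_eq_measure ennreal_mult[symmetric] ennreal_plus[symmetric] algebra_simps del: ennreal_plus)
    also have "p * (2 * \<alpha>\<^sup>2) * (2 / \<alpha>) * b + p * (8 * c\<^sup>2) = C\<^sup>2"
      using \<alpha> unfolding C2 by (simp add: power2_eq_square algebra_simps)
    also have "ennreal (C\<^sup>2 * prob A) = ennreal (C\<^sup>2) * emeasure M A"
      by (simp add: emeasure_eq_measure ennreal_mult)
    finally show "(\<integral>\<^sup>+\<omega>\<in>A. ennreal (\<bar>Y t \<omega> - left_lim (\<lambda>s. Y s \<omega>) (\<sigma> \<omega>)\<bar>\<^sup>2) \<partial>M) \<le> ennreal (C\<^sup>2) * emeasure M A" .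
  qed
  then have "bmo2_norm M \<F> T Y \<le> ennreal C"
    unfolding bmo2_norm_def using C0 by (intro INF_lower) auto
  then show ?thesis unfolding C_def Y_def[abs_def] .
qed

lemma time_integral_holder_bound:
  assumes q: "1 \<le> q" and \<eta>: "0 < \<eta>" "\<eta> < 1 - \<epsilon>" and \<alpha>: "\<alpha> = (1 - (\<epsilon> + \<eta>)) / \<beta>"
    and adm: "\<And>f. f \<in> holder_space \<eta> q \<Longrightarrow> admissible f"
  shows "\<exists>c>0. \<forall>f\<in>holder_space \<eta> q.
       enn_powr (\<integral>\<^sup>+t\<in>{0..<T}. (ennreal ((T - t) powr (\<alpha> * q - 1)) *
            (SUP x. ennreal (\<bar>D f t x\<bar> powr q))) \<partial>lborel) (1 / q)
       \<le> ennreal c * holder_norm \<eta> q f"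
proof -
  obtain C where C: "0 \<le> C" "\<And>f. (\<integral>\<^sup>+t\<in>{0..<T}. (ennreal ((T - t) powr (\<alpha> * q - 1)) * enn_powr (D_bound f t) q) \<partial>lborel)
      \<le> ennreal C * enn_powr (holder_norm \<eta> q f) q"
    using D_bound_time_integral[of q \<eta> \<alpha>] q \<eta> \<alpha> by auto
  \<comment> \<open>C may be 0; C + 1 yields a positive constant.\<close>
  define c where "c = (C + 1) powr (1 / q)"
  have "enn_powr (\<integral>\<^sup>+t\<in>{0..<T}. (ennreal ((T - t) powr (\<alpha> * q - 1)) *
            (SUP x. ennreal (\<bar>D f t x\<bar> powr q))) \<partial>lborel) (1 / q)
       \<le> ennreal c * holder_norm \<eta> q f" if f: "f \<in> holder_space \<eta> q" for f
  proof -
    have "(\<integral>\<^sup>+t\<in>{0..<T}. (ennreal ((T - t) powr (\<alpha> * q - 1)) * (SUP x. ennreal (\<bar>D f t x\<bar> powr q))) \<partial>lborel)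
        \<le> (\<integral>\<^sup>+t\<in>{0..<T}. (ennreal ((T - t) powr (\<alpha> * q - 1)) * enn_powr (D_bound f t) q) \<partial>lborel)"
      using q by (intro D_time_integral_le adm[OF f]) auto
    also have "\<dots> \<le> ennreal C * enn_powr (holder_norm \<eta> q f) q" by (rule C(2))
    also have "\<dots> \<le> ennreal (C + 1) * enn_powr (holder_norm \<eta> q f) q"
      by (intro mult_right_mono ennreal_leI) auto
    finally have "enn_powr (\<integral>\<^sup>+t\<in>{0..<T}. (ennreal ((T - t) powr (\<alpha> * q - 1)) *
            (SUP x. ennreal (\<bar>D f t x\<bar> powr q))) \<partial>lborel) (1 / q)
        \<le> enn_powr (ennreal (C + 1) * enn_powr (holder_norm \<eta> q f) q) (1 / q)"
      by (rule enn_powr_mono) (use q in simp)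
    also have "\<dots> = ennreal c * holder_norm \<eta> q f"
      using q C(1) by (subst enn_powr_mult) (auto simp: c_def enn_powr_powr[where s=1])
    finally show ?thesis .
  qed
  moreover have "0 < c" using C(1) by (simp add: c_def)
  ultimately show ?thesis by blast
qed

lemma cadlag_version_holder_bound:
  assumes compl: "complete_measure M" and \<eta>: "0 < \<eta>" "\<eta> < 1 - \<epsilon>" and \<alpha>: "\<alpha> = (1 - (\<epsilon> + \<eta>)) / \<beta>"
    and adm: "\<And>f. f \<in> holder_space \<eta> 2 \<Longrightarrow> admissible f"
  shows "\<exists>c>0. \<forall>f\<in>holder_space \<eta> 2. \<forall>\<phi>.
       cadlag_version M T (\<lambda>t \<omega>. D f t (X t \<omega>)) \<phi> \<longrightarrow>
       (SUP a\<in>{0..<T}. ennreal ((T - a) powr \<alpha>) * esssup M (\<lambda>\<omega>. ennreal \<bar>\<phi> a \<omega>\<bar>)) +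
       bmo2_norm M \<F> T (\<lambda>t \<omega>. riemann_liouville T \<alpha> (\<lambda>u. \<phi> u \<omega>) t - \<phi> 0 \<omega>)
       \<le> ennreal c * holder_norm \<eta> 2 f"
proof -
  define \<theta> where "\<theta> = 1 - (\<epsilon> + \<eta>)"
  have \<theta>: "0 < \<theta>" using \<eta> by (simp add: \<theta>_def)
  have \<alpha>_pos: "0 < \<alpha>" using \<theta> \<beta>_pos by (simp add: \<alpha> \<theta>_def)
  obtain C where C: "0 \<le> C" "\<And>f. (\<integral>\<^sup>+t\<in>{0..<T}. (ennreal ((T - t) powr (\<alpha> * 2 - 1)) * enn_powr (D_bound f t) 2) \<partial>lborel)
      \<le> ennreal C * enn_powr (holder_norm \<eta> 2 f) 2"
    using D_bound_time_integral[of 2 \<eta> \<alpha>] \<eta> \<alpha> by auto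
  define S where "S = D_const * (exp \<eta> / (1 - 2 powr (- \<theta>)))"
  have S: "0 < S" unfolding S_def using D_const_pos \<theta> by (simp add: powr_less_one)
  \<comment> \<open>The BMO bound is applied with \<open>C * n\<^sup>2\<close> and
    \<open>S * n\<close> in place of b and c, where n is the norm of f; the square root then
    releases n and leaves B.\<close>
  define B where "B = T powr (- \<alpha>) * sqrt (4 * \<alpha> * C + 8 * S\<^sup>2)"
  have B: "0 \<le> B" using \<alpha>_pos C(1) by (simp add: B_def)
  have "(SUP a\<in>{0..<T}. ennreal ((T - a) powr \<alpha>) * esssup M (\<lambda>\<omega>. ennreal \<bar>\<phi> a \<omega>\<bar>)) +
       bmo2_norm M \<F> T (\<lambda>t \<omega>. riemann_liouville T \<alpha> (\<lambda>u. \<phi> u \<omega>) t - \<phi> 0 \<omega>)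
       \<le> ennreal (S + B) * holder_norm \<eta> 2 f"
    if f: "f \<in> holder_space \<eta> 2" and \<phi>: "cadlag_version M T (\<lambda>t \<omega>. D f t (X t \<omega>)) \<phi>" for f \<phi>
  proof -
    define n where "n = enn2real (holder_norm \<eta> 2 f)"
    have n: "0 \<le> n" "holder_norm \<eta> 2 f = ennreal n"
      using f by (auto simp: n_def holder_space_def)
    have D_le: "ennreal ((T - u) powr \<alpha>) * D_bound f u \<le> ennreal (S * n)" if "u \<in> {0..<T}" for u
    proof -
      have "ennreal ((T - u) powr \<alpha>) * D_bound f u \<le> ennreal S * holder_norm \<eta> 2 f"
        unfolding S_def using that \<eta> \<theta> by (intro D_bound_le_holder_norm) (auto simp: \<theta>_def \<alpha>)
      then show ?thesis using S n by (simp add: ennreal_mult)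
    qed
    have Sn: "0 \<le> S * n" using S n by simp
    have bound: "AE \<omega> in M. \<forall>u\<in>{0..<T}. \<bar>\<phi> u \<omega>\<bar> * (T - u) powr \<alpha> \<le> S * n"
      by (rule cadlag_version_bound[OF adm[OF f] \<phi> \<alpha>_pos Sn]) (rule D_le)
    have sup: "ennreal ((T - a) powr \<alpha>) * esssup M (\<lambda>\<omega>. ennreal \<bar>\<phi> a \<omega>\<bar>) \<le> ennreal (S * n)" if a: "a \<in> {0..<T}" for a
    proof -
      have [measurable]: "\<phi> a \<in> borel_measurable M"
        by (rule cadlag_version_measurable[OF compl adm[OF f] \<phi> a])
      have "esssup M (\<lambda>\<omega>. ennreal \<bar>\<phi> a \<omega>\<bar>) \<le> ennreal (S * n / (T - a) powr \<alpha>)"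
      proof (rule esssup_I)
        show "AE \<omega> in M. ennreal \<bar>\<phi> a \<omega>\<bar> \<le> ennreal (S * n / (T - a) powr \<alpha>)"
          using bound
        proof eventually_elim
          case (elim \<omega>)
          then show ?case using a by (intro ennreal_leI) (auto simp: le_divide_eq)
        qed
      qed measurable
      then have "ennreal ((T - a) powr \<alpha>) * esssup M (\<lambda>\<omega>. ennreal \<bar>\<phi> a \<omega>\<bar>)
          \<le> ennreal ((T - a) powr \<alpha>) * ennreal (S * n / (T - a) powr \<alpha>)"
        by (rule mult_left_mono) simp
      also have "\<dots> = ennreal (S * n)" using a Sn by (simp add: ennreal_mult[symmetric])
      finally show ?thesis .
    qed
    have "(\<integral>\<^sup>+u\<in>{0..<T}. (ennreal ((T - u) powr (\<alpha> * 2 - 1)) * (D_bound f u)\<^sup>2) \<partial>lborel) \<le> ennreal (C * n\<^sup>2)"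
      using C(2)[of f] C(1) n by (simp add: enn_powr_2 ennreal_mult ennreal_power)
    then have "bmo2_norm M \<F> T (\<lambda>t \<omega>. riemann_liouville T \<alpha> (\<lambda>u. \<phi> u \<omega>) t - \<phi> 0 \<omega>)
      \<le> ennreal (T powr (- \<alpha>) * sqrt (4 * \<alpha> * (C * n\<^sup>2) + 8 * (S * n)\<^sup>2))"
      using C(1) by (intro riemann_liouville_bmo2_norm_le[OF compl adm[OF f] \<phi> \<alpha>_pos Sn D_le]) auto
    also have "4 * \<alpha> * (C * n\<^sup>2) + 8 * (S * n)\<^sup>2 = (4 * \<alpha> * C + 8 * S\<^sup>2) * n\<^sup>2"
      by (simp add: algebra_simps power_mult_distrib)
    also have "T powr (- \<alpha>) * sqrt ((4 * \<alpha> * C + 8 * S\<^sup>2) * n\<^sup>2) = B * n"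
      using n(1) by (simp add: B_def real_sqrt_mult)
    finally have "(SUP a\<in>{0..<T}. ennreal ((T - a) powr \<alpha>) * esssup M (\<lambda>\<omega>. ennreal \<bar>\<phi> a \<omega>\<bar>)) +
       bmo2_norm M \<F> T (\<lambda>t \<omega>. riemann_liouville T \<alpha> (\<lambda>u. \<phi> u \<omega>) t - \<phi> 0 \<omega>)
       \<le> ennreal (S * n) + ennreal (B * n)"
      by (intro add_mono SUP_least sup)
    also have "\<dots> = ennreal (S + B) * holder_norm \<eta> 2 f"
      using S B n by (simp add: ennreal_mult[symmetric] ennreal_plus[symmetric] distrib_right del: ennreal_plus)
    finally show ?thesis .
  qed
  moreover have "0 < S + B" using S B by simp
  ultimately show ?thesis by blast
qed

end

theorem theorem5:
  fixes M :: "'a measure" and X :: "real \<Rightarrow> 'a \<Rightarrow> real" and \<nu> \<rho> :: "real measure"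
    and T b \<epsilon> \<eta> q \<beta> \<alpha> :: real
  assumes T: "0 < T"
    and M: "prob_space M" "complete_measure M"
    and levy: "levy_process M T X"
    and triplet: "has_levy_triplet M T X b 0 \<nu>"
    and nu: "0 < emeasure \<nu> UNIV"
    and sets_M: "sets M = sets (augmented_filtration M T X T)"
    and rho: "prob_space \<rho>" "sets \<rho> = sets borel" "emeasure \<rho> {0} = 0"
    and eps: "0 \<le> \<epsilon>" "\<epsilon> < 1"
    and eta: "0 < \<eta>" "\<eta> < 1 - \<epsilon>"
    and q: "1 \<le> q"
    and beta: "0 < \<beta>"
    and moment: "\<exists>\<gamma>>0. \<forall>t\<in>{0..T}. integrable M (\<lambda>\<omega>. \<bar>X t \<omega>\<bar> powr (\<eta> + \<gamma>))"
    and rho_U: "\<rho> \<in> (\<Union>c\<in>{0<..}. U_small_ball \<epsilon> c)"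
    and X_U: "X \<in> (\<Union>c\<in>{0<..}. U_tv M T \<beta> (measure_support \<rho>) c)"
    and alpha: "\<alpha> = (1 - (\<epsilon> + \<eta>)) / \<beta>"
  shows "\<exists>c1 c2 :: real. 0 < c1 \<and> 0 < c2 \<and>
    (\<forall>f\<in>holder_space \<eta> q.
       enn_powr
         (\<integral>\<^sup>+ t\<in>{0..<T}. (ennreal ((T - t) powr (\<alpha> * q - 1)) *
            (SUP x. ennreal (\<bar>D_rho M T X \<rho> f t x\<bar> powr q))) \<partial>lborel)
         (1 / q)
       \<le> ennreal c1 * holder_norm \<eta> q f) \<and>
    (\<forall>f\<in>holder_space \<eta> 2. \<forall>\<phi>.
       cadlag_version M T (\<lambda>t \<omega>. D_rho M T X \<rho> f t (X t \<omega>)) \<phi> \<longrightarrow>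
       (SUP a\<in>{0..<T}. ennreal ((T - a) powr \<alpha>) * esssup M (\<lambda>\<omega>. ennreal \<bar>\<phi> a \<omega>\<bar>)) +
       bmo2_norm M (augmented_filtration M T X) T
         (\<lambda>t \<omega>. riemann_liouville T \<alpha> (\<lambda>u. \<phi> u \<omega>) t - \<phi> 0 \<omega>)
       \<le> ennreal c2 * holder_norm \<eta> 2 f)"
proof -
  obtain c\<^sub>\<rho> c\<^sub>X where c: "\<rho> \<in> U_small_ball \<epsilon> c\<^sub>\<rho>" "0 < c\<^sub>X" "X \<in> U_tv M T \<beta> (measure_support \<rho>) c\<^sub>X"
    using rho_U X_U by auto
  interpret prob_space M by (rule M(1))
  interpret \<rho>: prob_space \<rho> by (rule rho(1))
  interpret levy_smoothing M X T \<rho> \<epsilon> \<beta> c\<^sub>\<rho> c\<^sub>X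
    by unfold_locales (use T levy rho eps beta c in auto)
  obtain \<gamma> where \<gamma>: "0 < \<gamma>" "\<And>t. t \<in> {0..T} \<Longrightarrow> integrable M (\<lambda>\<omega>. \<bar>X t \<omega>\<bar> powr (\<eta> + \<gamma>))"
    using moment by blast
  \<comment> \<open>The norms for q and for 2 both control growth of order \<eta>, so the one moment
    of order \<eta> + \<gamma> covers both estimates.\<close>
  have adm: "admissible f" if "f \<in> holder_space \<eta> p" "0 < p" for f p
    using holder_space_admissible[OF that eta(1) _ \<gamma>(2)] \<gamma>(1) by simp
  have adm_q: "admissible f" if "f \<in> holder_space \<eta> q" for f using adm[OF that] q by simp
  have adm_2: "admissible f" if "f \<in> holder_space \<eta> 2" for f using adm[OF that] by simp
  obtain c1 where "0 < c1" "\<forall>f\<in>holder_space \<eta> q.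
       enn_powr (\<integral>\<^sup>+t\<in>{0..<T}. (ennreal ((T - t) powr (\<alpha> * q - 1)) *
            (SUP x. ennreal (\<bar>D f t x\<bar> powr q))) \<partial>lborel) (1 / q)
       \<le> ennreal c1 * holder_norm \<eta> q f"
    using time_integral_holder_bound[OF q eta alpha adm_q] by blast
  moreover obtain c2 where "0 < c2" "\<forall>f\<in>holder_space \<eta> 2. \<forall>\<phi>.
       cadlag_version M T (\<lambda>t \<omega>. D f t (X t \<omega>)) \<phi> \<longrightarrow>
       (SUP a\<in>{0..<T}. ennreal ((T - a) powr \<alpha>) * esssup M (\<lambda>\<omega>. ennreal \<bar>\<phi> a \<omega>\<bar>)) +
       bmo2_norm M \<F> T (\<lambda>t \<omega>. riemann_liouville T \<alpha> (\<lambda>u. \<phi> u \<omega>) t - \<phi> 0 \<omega>)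
       \<le> ennreal c2 * holder_norm \<eta> 2 f"
    using cadlag_version_holder_bound[OF M(2) eta alpha adm_2] by blast
  ultimately show ?thesis by blast
qed

end
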